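(* Let $G$ be an amenable locally compact group and let $H$ be a compact subgroup of $G$. Then the multiplier algebra $M(A(G::H))$ is isometrically isomorphic to $B(G::H)$.
   Context: $B(G)$ is the Fourier–Stieltjes algebra of $G$ with its usual norm, $B(G::H)=\{u\in B(G):u(kxh)=u(x)\ \text{for all }x\in G,\ k,h\in H\}$ with the norm of $B(G)$, and $A(G::H)$ is the closure in $B(G)$ of the set of those $u\in B(G::H)$ for which $q(\mathrm{supp}(u))$ is compact in $G//H$, where $G//H=\{HxH:x\in G\}$ has the quotient topology and $q(x)=HxH$ is the quotient map. The multiplier algebra $M(A(G::H))$ consists of the functions $u$ on $G$ such that $uv\in A(G::H)$ for every $v\in A(G::H)$, with pointwise operations and with the multiplier norm $\|u\|_M=\sup\{\|uv\|:v\in A(G::H),\ \|v\|\le 1\}$. *)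

theory Defs
  imports "HOL-Analysis.Analysis" "HOL-Library.Function_Algebras"
begin

text \<open>
  The group \<open>G\<close> is a type of sort \<open>{topological_group_add, t2_space}\<close>. The group law is written
  additively, as in the library class \<open>topological_group_add\<close>, but is not assumed commutative.
  Complex functions on \<open>G\<close> carry the pointwise operations of \<open>Function_Algebras\<close>.
\<close>


subsection \<open>Haar measure and amenability\<close>

definition left_haar_measure :: "'a::{topological_group_add,t2_space} measure \<Rightarrow> bool" where
  "left_haar_measure \<mu> \<longleftrightarrow>
     sets \<mu> = sets borel \<and>
     (\<forall>K. compact K \<longrightarrow> emeasure \<mu> K < \<infinity>) \<and>
     (\<forall>A\<in>sets borel. emeasure \<mu> A = (INF U\<in>{U. open U \<and> A \<subseteq> U}. emeasure \<mu> U)) \<and>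
     (\<forall>U. open U \<longrightarrow> emeasure \<mu> U = (SUP K\<in>{K. compact K \<and> K \<subseteq> U}. emeasure \<mu> K)) \<and>
     (\<forall>x. \<forall>A\<in>sets borel. emeasure \<mu> ((+) x ` A) = emeasure \<mu> A) \<and>
     emeasure \<mu> UNIV \<noteq> 0"

text \<open>
  \<open>L\<^sup>\<infinity>(G)\<close> consists of classes modulo locally null sets, and every class has a bounded Borel
  representative. So a functional on \<open>L\<^sup>\<infinity>(G)\<close> is a functional on these representatives which is
  compatible with the essential supremum (\<open>ess_le \<mu> f C\<close> says that it is at most \<open>C\<close>).
\<close>

definition bounded_borel :: "('a::topological_space \<Rightarrow> complex) set" where
  "bounded_borel = {f \<in> borel_measurable borel. bounded (range f)}"

definition ess_le :: "'a::topological_space measure \<Rightarrow> ('a \<Rightarrow> complex) \<Rightarrow> real \<Rightarrow> bool" where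
  "ess_le \<mu> f C \<longleftrightarrow> (\<forall>K. compact K \<longrightarrow> (AE x in \<mu>. x \<in> K \<longrightarrow> norm (f x) \<le> C))"

text \<open>
  A left invariant mean is a linear functional \<open>m\<close> on \<open>L\<^sup>\<infinity>(G)\<close> with \<open>\<parallel>m\<parallel> = m 1 = 1\<close> which is
  unchanged by left translation. The third conjunct is \<open>\<parallel>m\<parallel> \<le> 1\<close>; it also makes \<open>m\<close>
  well defined on classes.
\<close>

definition left_invariant_mean ::
  "'a::{topological_group_add,t2_space} measure \<Rightarrow> (('a \<Rightarrow> complex) \<Rightarrow> complex) \<Rightarrow> bool" where
  "left_invariant_mean \<mu> m \<longleftrightarrow>
     (\<forall>f\<in>bounded_borel. \<forall>g\<in>bounded_borel. m (f + g) = m f + m g) \<and>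
     (\<forall>c. \<forall>f\<in>bounded_borel. m (\<lambda>x. c * f x) = c * m f) \<and>
     (\<forall>f\<in>bounded_borel. \<forall>C. ess_le \<mu> f C \<longrightarrow> norm (m f) \<le> C) \<and>
     m (\<lambda>x. 1) = 1 \<and>
     (\<forall>a. \<forall>f\<in>bounded_borel. m (\<lambda>x. f (a + x)) = m f)"

text \<open>
  A left Haar measure exists on every locally compact group and is unique up to a positive factor,
  which does not affect \<open>L\<^sup>\<infinity>(G)\<close>; so the quantifier over \<open>\<mu>\<close> only names it.
\<close>

definition amenable :: "'a::{topological_group_add,t2_space} itself \<Rightarrow> bool" where
  "amenable _ \<longleftrightarrow> (\<exists>(\<mu> :: 'a measure) m. left_haar_measure \<mu> \<and> left_invariant_mean \<mu> m)"


subsection \<open>Unitary representations\<close>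

definition hnorm :: "('v \<Rightarrow> 'v \<Rightarrow> complex) \<Rightarrow> 'v \<Rightarrow> real" where
  "hnorm ip v = sqrt (Re (ip v v))"

locale complex_hilbert_space = vector_space scale
  for scale :: "complex \<Rightarrow> 'v::ab_group_add \<Rightarrow> 'v" +
  fixes V :: "'v set" and ip :: "'v \<Rightarrow> 'v \<Rightarrow> complex"
  assumes subspace_V: "subspace V"
    and ip_add_left: "\<lbrakk>u \<in> V; v \<in> V; w \<in> V\<rbrakk> \<Longrightarrow> ip (u + v) w = ip u w + ip v w"
    and ip_scale_left: "\<lbrakk>v \<in> V; w \<in> V\<rbrakk> \<Longrightarrow> ip (scale c v) w = c * ip v w"
    and ip_commute: "\<lbrakk>v \<in> V; w \<in> V\<rbrakk> \<Longrightarrow> ip w v = cnj (ip v w)"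
    and ip_pos: "\<lbrakk>v \<in> V; v \<noteq> 0\<rbrakk> \<Longrightarrow> 0 < Re (ip v v)"
    and complete_V: "\<lbrakk>\<And>n. X n \<in> V;
        \<And>e. e > 0 \<Longrightarrow> \<exists>N. \<forall>m\<ge>N. \<forall>n\<ge>N. hnorm ip (X m - X n) < e\<rbrakk>
      \<Longrightarrow> \<exists>v\<in>V. (\<lambda>n. hnorm ip (X n - v)) \<longlonglongrightarrow> 0"

locale continuous_unitary_rep = complex_hilbert_space scale V ip
  for scale :: "complex \<Rightarrow> 'v::ab_group_add \<Rightarrow> 'v" and V ip +
  fixes \<pi> :: "'a::{topological_group_add,t2_space} \<Rightarrow> 'v \<Rightarrow> 'v"
  assumes rep_closed: "v \<in> V \<Longrightarrow> \<pi> x v \<in> V"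
    and rep_add: "\<lbrakk>v \<in> V; w \<in> V\<rbrakk> \<Longrightarrow> \<pi> x (v + w) = \<pi> x v + \<pi> x w"
    and rep_scale: "v \<in> V \<Longrightarrow> \<pi> x (scale c v) = scale c (\<pi> x v)"
    and rep_ip: "\<lbrakk>v \<in> V; w \<in> V\<rbrakk> \<Longrightarrow> ip (\<pi> x v) (\<pi> x w) = ip v w"
    and rep_zero: "v \<in> V \<Longrightarrow> \<pi> 0 v = v"
    and rep_plus: "v \<in> V \<Longrightarrow> \<pi> (x + y) v = \<pi> x (\<pi> y v)"
    and rep_continuous: "v \<in> V \<Longrightarrow> ((\<lambda>x. hnorm ip (\<pi> x v - \<pi> y v)) \<longlongrightarrow> 0) (at y)"


subsection \<open>The Fourier--Stieltjes algebra\<close>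

text \<open>
  \<open>B(G)\<close> is the set of coefficients \<open>x \<mapsto> \<langle>\<pi>(x)\<xi>, \<eta>\<rangle>\<close> of continuous unitary representations, and
  \<open>\<parallel>u\<parallel>\<close> is the infimum of \<open>\<parallel>\<xi>\<parallel> \<parallel>\<eta>\<parallel>\<close> over all such descriptions of \<open>u\<close>.

  As a definition cannot quantify over types, the Hilbert spaces range over the linear subspaces
  \<open>V\<close> of \<open>G \<Rightarrow> complex\<close>, each with an arbitrary inner product that makes it complete. No coefficient
  and no value \<open>\<parallel>\<xi>\<parallel> \<parallel>\<eta>\<parallel>\<close> needed for the infimum is lost. Given any representation, replace its
  space by the closed cyclic subspace \<open>W\<close> generated by \<open>\<xi>\<close>, and \<open>\<eta>\<close> by its orthogonal
  projection on \<open>W\<close>: the coefficient is the same and \<open>\<parallel>\<eta>\<parallel>\<close> does not grow. Then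
  \<open>w \<mapsto> (x \<mapsto> \<langle>w, \<pi>(x)\<xi>\<rangle>)\<close> is linear and injective on \<open>W\<close>, so \<open>W\<close> is unitarily equivalent to
  its image with the transported inner product.
\<close>

definition coefficient_bounds :: "('a::{topological_group_add,t2_space} \<Rightarrow> complex) \<Rightarrow> real set" where
  "coefficient_bounds u =
     {hnorm ip \<xi> * hnorm ip \<eta> | V ip \<pi> \<xi> \<eta>.
        continuous_unitary_rep (\<lambda>c (f :: 'a \<Rightarrow> complex) x. c * f x) V ip \<pi> \<and>
        \<xi> \<in> V \<and> \<eta> \<in> V \<and> u = (\<lambda>x. ip (\<pi> x \<xi>) \<eta>)}"

definition B_alg :: "('a::{topological_group_add,t2_space} \<Rightarrow> complex) set" where
  "B_alg = {u. coefficient_bounds u \<noteq> {}}"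

definition B_norm :: "('a::{topological_group_add,t2_space} \<Rightarrow> complex) \<Rightarrow> real" where
  "B_norm u = Inf (coefficient_bounds u)"


subsection \<open>Double cosets\<close>

definition is_subgroup :: "'a::group_add set \<Rightarrow> bool" where
  "is_subgroup H \<longleftrightarrow> 0 \<in> H \<and> (\<forall>x\<in>H. \<forall>y\<in>H. x + y \<in> H) \<and> (\<forall>x\<in>H. - x \<in> H)"

definition double_coset :: "'a::group_add set \<Rightarrow> 'a \<Rightarrow> 'a set" where
  "double_coset H x = {k + x + h | k h. k \<in> H \<and> h \<in> H}"

definition double_coset_topology :: "'a::topological_group_add set \<Rightarrow> 'a set topology" where
  "double_coset_topology H =
     topology (\<lambda>W. W \<subseteq> range (double_coset H) \<and> open (double_coset H -` W))"

lemma openin_double_coset_topology: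
  "openin (double_coset_topology H) W \<longleftrightarrow>
     W \<subseteq> range (double_coset H) \<and> open (double_coset H -` W)"
proof -
  have "istopology (\<lambda>W. W \<subseteq> range (double_coset H) \<and> open (double_coset H -` W))"
    unfolding istopology_def by (auto simp: vimage_Union)
  then show ?thesis
    by (simp add: double_coset_topology_def topology_inverse')
qed

lemma quotient_map_double_coset:
  "quotient_map euclidean (double_coset_topology H) (double_coset H)"
proof -
  have "openin (double_coset_topology H) (range (double_coset H))"
    by (simp add: openin_double_coset_topology vimage_def)
  then have "topspace (double_coset_topology H) = range (double_coset H)"
    using openin_double_coset_topology[of H "topspace (double_coset_topology H)"] openin_subset
    by blast
  then show ?thesis
    by (auto simp: quotient_map_def openin_double_coset_topology vimage_def)
qed

definition B_double :: "'a::{topological_group_add,t2_space} set \<Rightarrow> ('a \<Rightarrow> complex) set" where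
  "B_double H = {u \<in> B_alg. \<forall>x. \<forall>k\<in>H. \<forall>h\<in>H. u (k + x + h) = u x}"

definition supp :: "('a::topological_space \<Rightarrow> complex) \<Rightarrow> 'a set" where
  "supp u = closure {x. u x \<noteq> 0}"

definition A_double :: "'a::{topological_group_add,t2_space} set \<Rightarrow> ('a \<Rightarrow> complex) set" where
  "A_double H = {u \<in> B_alg. \<forall>e>0. \<exists>v\<in>B_double H.
     compactin (double_coset_topology H) (double_coset H ` supp v) \<and> B_norm (u - v) < e}"


subsection \<open>Multipliers\<close>

definition multiplier_algebra :: "('a \<Rightarrow> complex) set \<Rightarrow> ('a \<Rightarrow> complex) set" where
  "multiplier_algebra A = {u. \<forall>v\<in>A. u * v \<in> A}"

text \<open>
  The supremum is taken in \<open>ereal\<close>, where it exists without a boundedness proof.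
\<close>

definition multiplier_norm ::
  "('a::{topological_group_add,t2_space} \<Rightarrow> complex) set \<Rightarrow> ('a \<Rightarrow> complex) \<Rightarrow> ereal" where
  "multiplier_norm A u = (SUP v\<in>{v\<in>A. B_norm v \<le> 1}. ereal (B_norm (u * v)))"

definition isometrically_isomorphic ::
  "('a \<Rightarrow> complex) set \<Rightarrow> (('a \<Rightarrow> complex) \<Rightarrow> ereal) \<Rightarrow>
   ('a \<Rightarrow> complex) set \<Rightarrow> (('a \<Rightarrow> complex) \<Rightarrow> ereal) \<Rightarrow> bool" where
  "isometrically_isomorphic A N B N' \<longleftrightarrow>
     (\<exists>\<Phi>. bij_betw \<Phi> A B \<and>
        (\<forall>u\<in>A. \<forall>v\<in>A. \<Phi> (u + v) = \<Phi> u + \<Phi> v) \<and>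
        (\<forall>c. \<forall>u\<in>A. \<Phi> (\<lambda>x. c * u x) = (\<lambda>x. c * \<Phi> u x)) \<and>
        (\<forall>u\<in>A. \<forall>v\<in>A. \<Phi> (u * v) = \<Phi> u * \<Phi> v) \<and>
        (\<forall>u\<in>A. N' (\<Phi> u) = N u))"

end

theory Submission
  imports Defs
begin

text \<open>
  The norm of \<open>B(G)\<close> is submultiplicative, so multiplication by \<open>u \<in> B(G::H)\<close> maps
  \<open>A(G::H)\<close> into itself with multiplier norm at most \<open>\<parallel>u\<parallel>\<close>. The substance is the converse, and it
  rests on a bounded approximate identity: since \<open>G\<close> is amenable, there are \<open>w \<in> A(G::H)\<close> with
  \<open>\<parallel>w\<parallel> \<le> 1\<close> which tend to \<open>1\<close> pointwise (\<open>bounded_approximate_identity\<close>). Let \<open>u\<close> be a multiplier.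
  By the Baire category theorem it acts boundedly on the Banach space \<open>A(G::H)\<close>
  (\<open>multiplier_bounded\<close>), so the functions \<open>u w\<close> have norm at most \<open>\<parallel>u\<parallel>\<^sub>M\<close> and tend to \<open>u\<close>
  pointwise. Where \<open>w \<noteq> 0\<close> one has \<open>u = u w / w\<close>, hence \<open>u\<close> is continuous and bi-invariant. As the
  balls of \<open>B(G)\<close> are closed under pointwise limits with continuous limit (\<open>B_alg_limit\<close>),
  \<open>u \<in> B(G::H)\<close> and \<open>\<parallel>u\<parallel> \<le> \<parallel>u\<parallel>\<^sub>M\<close>; the identity map is the isometric isomorphism.
  
  Everything about \<open>B(G)\<close> is derived from a description of its norm without representations
  (\<open>B_norm_le_iff\<close>): \<open>u \<in> B(G)\<close> with \<open>\<parallel>u\<parallel> \<le> r\<close> if and only if \<open>u\<close> is continuous and there is a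
  positive definite function \<open>\<phi>\<close> with \<open>\<phi>(0) \<le> r\<close> such that \<open>r \<phi>(- y + x) - u(x) cnj (u(y))\<close> is a
  positive definite kernel. For a coefficient \<open>\<langle>\<pi>(x)\<xi>, \<eta>\<rangle>\<close> with \<open>\<parallel>\<xi>\<parallel> = \<parallel>\<eta>\<parallel>\<close> take
  \<open>\<phi>(x) = \<langle>\<pi>(x)\<xi>, \<xi>\<rangle>\<close> and use the Cauchy--Schwarz inequality. Conversely, \<open>cnj u\<close> is an element \<open>\<eta>\<close>
  of the reproducing kernel Hilbert space of \<open>\<phi>\<close>, on which \<open>G\<close> acts by translation, and
  \<open>u(x) = \<langle>\<pi>(x)\<xi>, \<eta>\<rangle>\<close> for the cyclic vector \<open>\<xi>\<close> at the point \<open>0\<close>. This action need not be continuous,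
  because \<open>\<phi>\<close> need not be; but continuity of \<open>u\<close> alone forces \<open>\<eta>\<close> to be a continuous vector, and
  \<open>\<xi>\<close> may be replaced by its projection on the space of continuous vectors. Because \<open>\<phi>\<close> is allowed to be
  discontinuous, pointwise limits are easy: the functions \<open>\<phi>\<close> that belong to a convergent family
  lie in a compact product of discs and have a cluster point (\<open>dominated_limit\<close>). Products of
  coefficients are handled by the Schur product theorem in place of tensor products.
  
  The approximate identity is built in three steps. First, a Reiter type theorem (\<open>reiter_compact\<close>):
  for a compact set \<open>K\<close> there are densities \<open>f\<close> of compact support whose left translates by elements
  of \<open>K\<close> are close to \<open>f\<close> in \<open>L\<^sup>1\<close>. Otherwise a separating functional exists; on translates of
  a fixed density it is given by bounded continuous functions, and the invariant mean of these
  gives a contradiction. Secondly, the correlation \<open>\<integral> \<surd>f(y) \<surd>f(- x + y) dy\<close> is continuous, positive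
  definite, compactly supported, equal to \<open>1\<close> at \<open>0\<close> and close to \<open>1\<close> on \<open>K\<close>. Thirdly, for \<open>K\<close> a union of
  double cosets, bi-invariance is achieved without a Haar measure on \<open>H\<close>
  (\<open>biinvariant_average\<close>): in the Hilbert space of \<open>\<phi>\<close> the convex hull of the \<open>H\<close>-orbit of \<open>\<xi>\<close> has a
  unique closest point to the origin in its closure, which is therefore fixed by \<open>H\<close>; its
  coefficient is a limit of averages of \<open>\<phi>\<close> over double cosets.
\<close>

section \<open>Hilbert space geometry\<close>

text \<open>
  Definiteness and completeness are dropped, so that the finitely supported functions with the form
  given by a positive definite kernel are an instance.
\<close>

locale semi_inner_space = vector_space scale
  for scale :: "complex \<Rightarrow> 'v::ab_group_add \<Rightarrow> 'v" +
  fixes V :: "'v set" and ip :: "'v \<Rightarrow> 'v \<Rightarrow> complex"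
  assumes subspace_V: "subspace V"
    and ip_add_left: "\<lbrakk>u \<in> V; v \<in> V; w \<in> V\<rbrakk> \<Longrightarrow> ip (u + v) w = ip u w + ip v w"
    and ip_scale_left: "\<lbrakk>v \<in> V; w \<in> V\<rbrakk> \<Longrightarrow> ip (scale c v) w = c * ip v w"
    and ip_commute: "\<lbrakk>v \<in> V; w \<in> V\<rbrakk> \<Longrightarrow> ip w v = cnj (ip v w)"
    and ip_nonneg: "v \<in> V \<Longrightarrow> 0 \<le> Re (ip v v)"
begin

abbreviation nrm :: "'v \<Rightarrow> real" where "nrm \<equiv> hnorm ip"

definition cauchy_seq :: "(nat \<Rightarrow> 'v) \<Rightarrow> bool" where
  "cauchy_seq X \<longleftrightarrow> (\<forall>e>0. \<exists>N. \<forall>m\<ge>N. \<forall>n\<ge>N. nrm (X m - X n) < e)"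

lemma V_closed [simp, intro]:
  "0 \<in> V" "\<lbrakk>v \<in> V; w \<in> V\<rbrakk> \<Longrightarrow> v + w \<in> V" "v \<in> V \<Longrightarrow> scale c v \<in> V"
  "v \<in> V \<Longrightarrow> - v \<in> V" "\<lbrakk>v \<in> V; w \<in> V\<rbrakk> \<Longrightarrow> v - w \<in> V"
  using subspace_V by (auto intro: subspace_0 subspace_add subspace_scale subspace_neg subspace_diff)

lemma ip_add_right: "\<lbrakk>u \<in> V; v \<in> V; w \<in> V\<rbrakk> \<Longrightarrow> ip w (u + v) = ip w u + ip w v"
  using ip_commute[of "u + v" w] ip_commute[of u w] ip_commute[of v w] by (simp add: ip_add_left)

lemma ip_scale_right: "\<lbrakk>v \<in> V; w \<in> V\<rbrakk> \<Longrightarrow> ip w (scale c v) = cnj c * ip w v"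
  using ip_commute[of "scale c v" w] ip_commute[of v w] by (simp add: ip_scale_left)

lemma ip_minus_left: "\<lbrakk>v \<in> V; w \<in> V\<rbrakk> \<Longrightarrow> ip (- v) w = - ip v w"
  using ip_scale_left[of v w "-1"] by simp

lemma ip_minus_right: "\<lbrakk>v \<in> V; w \<in> V\<rbrakk> \<Longrightarrow> ip w (- v) = - ip w v"
  using ip_scale_right[of v w "-1"] by simp

lemma ip_diff_left: "\<lbrakk>u \<in> V; v \<in> V; w \<in> V\<rbrakk> \<Longrightarrow> ip (u - v) w = ip u w - ip v w"
  using ip_add_left[of u "- v" w] by (simp add: ip_minus_left)

lemma ip_diff_right: "\<lbrakk>u \<in> V; v \<in> V; w \<in> V\<rbrakk> \<Longrightarrow> ip w (u - v) = ip w u - ip w v"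
  using ip_add_right[of u "- v" w] by (simp add: ip_minus_right)

lemma ip_zero_left: "w \<in> V \<Longrightarrow> ip 0 w = 0"
  using ip_scale_left[of 0 w 0] by simp

lemma ip_zero_right: "w \<in> V \<Longrightarrow> ip w 0 = 0"
  using ip_scale_right[of 0 w 0] by simp

lemma V_sum: "(\<And>i. i \<in> S \<Longrightarrow> f i \<in> V) \<Longrightarrow> (\<Sum>i\<in>S. f i) \<in> V"
  using subspace_sum[OF subspace_V] .

lemma ip_sum_left: "\<lbrakk>\<And>i. i \<in> S \<Longrightarrow> f i \<in> V; w \<in> V\<rbrakk> \<Longrightarrow> ip (\<Sum>i\<in>S. f i) w = (\<Sum>i\<in>S. ip (f i) w)"
  by (induction S rule: infinite_finite_induct) (simp_all add: ip_zero_left ip_add_left V_sum)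

lemma ip_sum_right: "\<lbrakk>\<And>i. i \<in> S \<Longrightarrow> f i \<in> V; w \<in> V\<rbrakk> \<Longrightarrow> ip w (\<Sum>i\<in>S. f i) = (\<Sum>i\<in>S. ip w (f i))"
  by (induction S rule: infinite_finite_induct) (simp_all add: ip_zero_right ip_add_right V_sum)

lemma Im_ip_self: "v \<in> V \<Longrightarrow> Im (ip v v) = 0"
  using ip_commute[of v v] by (simp add: complex_eq_iff)

lemma ip_self: "v \<in> V \<Longrightarrow> ip v v = complex_of_real ((nrm v)\<^sup>2)"
  using ip_nonneg[of v] Im_ip_self[of v] by (simp add: hnorm_def complex_eq_iff)

lemma nrm_power2: "v \<in> V \<Longrightarrow> (nrm v)\<^sup>2 = Re (ip v v)"
  using ip_nonneg[of v] by (simp add: hnorm_def)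

lemma nrm_nonneg [simp]: "v \<in> V \<Longrightarrow> 0 \<le> nrm v"
  using ip_nonneg[of v] by (simp add: hnorm_def)

lemma nrm_zero [simp]: "nrm 0 = 0"
  by (simp add: hnorm_def ip_zero_left)

lemma nrm_scale: "v \<in> V \<Longrightarrow> nrm (scale c v) = cmod c * nrm v"
proof -
  assume v: "v \<in> V"
  have "ip (scale c v) (scale c v) = (c * cnj c) * ip v v"
    using v by (simp add: ip_scale_left ip_scale_right)
  also have "\<dots> = complex_of_real ((cmod c)\<^sup>2 * (nrm v)\<^sup>2)"
    unfolding ip_self[OF v] complex_norm_square[symmetric] by simp
  finally have "(nrm (scale c v))\<^sup>2 = (cmod c * nrm v)\<^sup>2"
    using nrm_power2[of "scale c v"] v by (simp add: power_mult_distrib)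
  then show ?thesis using v by (simp add: power2_eq_iff_nonneg)
qed

lemma nrm_minus: "v \<in> V \<Longrightarrow> nrm (- v) = nrm v"
  using nrm_scale[of v "-1"] by simp

lemma nrm_diff_commute: "\<lbrakk>v \<in> V; w \<in> V\<rbrakk> \<Longrightarrow> nrm (v - w) = nrm (w - v)"
  using nrm_minus[of "v - w"] by simp

lemma nrm_add_power2:
  "\<lbrakk>v \<in> V; w \<in> V\<rbrakk> \<Longrightarrow> (nrm (v + w))\<^sup>2 = (nrm v)\<^sup>2 + 2 * Re (ip v w) + (nrm w)\<^sup>2"
  using ip_commute[of v w] by (simp add: nrm_power2 ip_add_left ip_add_right)

lemma nrm_diff_power2:
  "\<lbrakk>v \<in> V; w \<in> V\<rbrakk> \<Longrightarrow> (nrm (v - w))\<^sup>2 = (nrm v)\<^sup>2 - 2 * Re (ip v w) + (nrm w)\<^sup>2"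
  using ip_commute[of v w] by (simp add: nrm_power2 ip_diff_left ip_diff_right)

lemma cauchy_schwarz:
  assumes v: "v \<in> V" and w: "w \<in> V"
  shows "cmod (ip v w) \<le> nrm v * nrm w"
proof -
  define A where "A = (cmod (ip v w))\<^sup>2"
  have quad: "0 \<le> (nrm v)\<^sup>2 - 2 * s * A + s\<^sup>2 * A * (nrm w)\<^sup>2" for s :: real
  proof -
    let ?t = "of_real s * ip v w"
    have "0 \<le> (nrm (v - scale ?t w))\<^sup>2" by simp
    also have "\<dots> = (nrm v)\<^sup>2 - 2 * Re (ip v (scale ?t w)) + (nrm (scale ?t w))\<^sup>2"
      using v w by (simp add: nrm_diff_power2)
    also have "ip v (scale ?t w) = of_real (s * A)"
    proof -
      have "of_real A = ip v w * cnj (ip v w)" unfolding A_def by (rule complex_norm_square)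
      then show ?thesis using v w by (simp add: ip_scale_right mult_ac)
    qed
    also have "(nrm (scale ?t w))\<^sup>2 = s\<^sup>2 * A * (nrm w)\<^sup>2"
      using w by (simp add: nrm_scale A_def norm_mult power_mult_distrib)
    finally show ?thesis by (simp add: mult.assoc)
  qed
  have "A \<le> (nrm v)\<^sup>2 * (nrm w)\<^sup>2"
  proof (cases "nrm w = 0")
    case True
    have "A = 0"
    proof (rule ccontr)
      assume "A \<noteq> 0"
      then show False
        using quad[of "((nrm v)\<^sup>2 + 1) / (2 * A)"] True by simp
    qed
    then show ?thesis by simp
  next
    case False
    define b where "b = (nrm w)\<^sup>2"
    have b: "b > 0" using False by (simp add: b_def)
    have "0 \<le> (nrm v)\<^sup>2 - 2 * (1 / b) * A + (1 / b)\<^sup>2 * A * b"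
      using quad[of "1 / b"] by (simp only: b_def)
    also have "\<dots> = (nrm v)\<^sup>2 - A / b" using b by (simp add: power2_eq_square)
    finally show ?thesis using b by (simp add: b_def[symmetric] field_simps)
  qed
  then have "(cmod (ip v w))\<^sup>2 \<le> (nrm v * nrm w)\<^sup>2" by (simp add: A_def power_mult_distrib)
  then show ?thesis by (rule power2_le_imp_le) (use v w in simp)
qed

lemma nrm_triangle: "\<lbrakk>v \<in> V; w \<in> V\<rbrakk> \<Longrightarrow> nrm (v + w) \<le> nrm v + nrm w"
proof (rule power2_le_imp_le)
  assume v: "v \<in> V" and w: "w \<in> V"
  have "Re (ip v w) \<le> nrm v * nrm w"
    using complex_Re_le_cmod[of "ip v w"] cauchy_schwarz[OF v w] by linarith
  then show "(nrm (v + w))\<^sup>2 \<le> (nrm v + nrm w)\<^sup>2"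
    using v w by (simp add: nrm_add_power2 power2_sum)
  show "0 \<le> nrm v + nrm w" using v w by simp
qed

lemma nrm_triangle_diff:
  "\<lbrakk>u \<in> V; v \<in> V; w \<in> V\<rbrakk> \<Longrightarrow> nrm (u - w) \<le> nrm (u - v) + nrm (v - w)"
  using nrm_triangle[of "u - v" "v - w"] by simp

lemma nrm_triangle_ineq3: "\<lbrakk>v \<in> V; w \<in> V\<rbrakk> \<Longrightarrow> \<bar>nrm v - nrm w\<bar> \<le> nrm (v - w)"
  using nrm_triangle[of "v - w" w] nrm_triangle[of "w - v" v] nrm_diff_commute[of v w] by simp

lemma cauchy_seq_bounded:
  assumes X: "\<And>n. X n \<in> V" and "cauchy_seq X"
  obtains C where "C > 0" "\<And>n. nrm (X n) \<le> C"
proof -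
  obtain N where N: "\<And>m n. m \<ge> N \<Longrightarrow> n \<ge> N \<Longrightarrow> nrm (X m - X n) < 1"
    using assms(2) unfolding cauchy_seq_def by (meson zero_less_one)
  define C where "C = 1 + (\<Sum>i\<le>N. nrm (X i))"
  have le: "nrm (X i) \<le> (\<Sum>i\<le>N. nrm (X i))" if "i \<le> N" for i
    using that X by (intro member_le_sum) auto
  have "nrm (X n) \<le> C" for n
  proof (cases "n \<le> N")
    case True
    then show ?thesis using le[of n] by (simp add: C_def)
  next
    case False
    then have "nrm (X n - X N) < 1" using N by simp
    then show ?thesis
      using nrm_triangle[of "X n - X N" "X N"] X le[of N] by (simp add: C_def)
  qed
  moreover have "0 \<le> (\<Sum>i\<le>N. nrm (X i))" using X by (intro sum_nonneg) auto
  then have "C > 0" by (simp add: C_def)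
  ultimately show ?thesis using that by blast
qed

lemma ip_tendsto:
  assumes "\<And>n. X n \<in> V" "v \<in> V" "\<And>n. Y n \<in> V" "w \<in> V"
    and "(\<lambda>n. nrm (X n - v)) \<longlonglongrightarrow> 0" "(\<lambda>n. nrm (Y n - w)) \<longlonglongrightarrow> 0"
  shows "(\<lambda>n. ip (X n) (Y n)) \<longlonglongrightarrow> ip v w"
proof -
  have "(\<lambda>n. ip (X n) (Y n) - ip v w) \<longlonglongrightarrow> 0"
  proof (rule Lim_null_comparison)
    show "\<forall>\<^sub>F n in sequentially. norm (ip (X n) (Y n) - ip v w) \<le>
      nrm (X n - v) * (nrm (Y n - w) + nrm w) + nrm v * nrm (Y n - w)"
    proof (rule always_eventually, rule allI)
      fix n
      have "ip (X n) (Y n) - ip v w = ip (X n - v) (Y n) + ip v (Y n - w)"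
        using assms by (simp add: ip_diff_left ip_diff_right)
      then have "cmod (ip (X n) (Y n) - ip v w) \<le> nrm (X n - v) * nrm (Y n) + nrm v * nrm (Y n - w)"
        using cauchy_schwarz[of "X n - v" "Y n"] cauchy_schwarz[of v "Y n - w"] assms
          norm_triangle_ineq[of "ip (X n - v) (Y n)" "ip v (Y n - w)"] by simp
      also have "nrm (X n - v) * nrm (Y n) \<le> nrm (X n - v) * (nrm (Y n - w) + nrm w)"
        using nrm_triangle[of "Y n - w" w] assms by (intro mult_left_mono) auto
      finally show "norm (ip (X n) (Y n) - ip v w) \<le>
          nrm (X n - v) * (nrm (Y n - w) + nrm w) + nrm v * nrm (Y n - w)" by simp
    qed
    have "(\<lambda>n. nrm (X n - v) * (nrm (Y n - w) + nrm w) + nrm v * nrm (Y n - w))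
        \<longlonglongrightarrow> 0 * (0 + nrm w) + nrm v * 0"
      using assms(5,6) by (intro tendsto_intros)
    then show "(\<lambda>n. nrm (X n - v) * (nrm (Y n - w) + nrm w) + nrm v * nrm (Y n - w)) \<longlonglongrightarrow> 0"
      by simp
  qed
  then show ?thesis by (simp add: LIM_zero_iff)
qed

lemma ip_convergent:
  assumes X: "\<And>n. X n \<in> V" and Y: "\<And>n. Y n \<in> V" and "cauchy_seq X" "cauchy_seq Y"
  shows "convergent (\<lambda>n. ip (X n) (Y n))"
proof -
  obtain C where C: "C > 0" "\<And>n. nrm (X n) \<le> C" using cauchy_seq_bounded[OF X assms(3)] by metis
  obtain D where D: "D > 0" "\<And>n. nrm (Y n) \<le> D" using cauchy_seq_bounded[OF Y assms(4)] by metis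
  have "Cauchy (\<lambda>n. ip (X n) (Y n))"
  proof (rule metric_CauchyI)
    fix e :: real assume "e > 0"
    then have "e / (2 * D) > 0" "e / (2 * C) > 0" using C D by auto
    then obtain N1 N2 where N: "\<And>m n. m \<ge> N1 \<Longrightarrow> n \<ge> N1 \<Longrightarrow> nrm (X m - X n) < e / (2 * D)"
      "\<And>m n. m \<ge> N2 \<Longrightarrow> n \<ge> N2 \<Longrightarrow> nrm (Y m - Y n) < e / (2 * C)"
      using assms(3,4) unfolding cauchy_seq_def by meson
    have "dist (ip (X m) (Y m)) (ip (X n) (Y n)) < e" if "m \<ge> max N1 N2" "n \<ge> max N1 N2" for m n
    proof -
      have "ip (X m) (Y m) - ip (X n) (Y n) = ip (X m - X n) (Y m) + ip (X n) (Y m - Y n)"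
        using X Y by (simp add: ip_diff_left ip_diff_right)
      then have "cmod (ip (X m) (Y m) - ip (X n) (Y n)) \<le> nrm (X m - X n) * nrm (Y m) + nrm (X n) * nrm (Y m - Y n)"
        using cauchy_schwarz[of "X m - X n" "Y m"] cauchy_schwarz[of "X n" "Y m - Y n"] X Y
          norm_triangle_ineq[of "ip (X m - X n) (Y m)" "ip (X n) (Y m - Y n)"] by simp
      also have "\<dots> \<le> nrm (X m - X n) * D + C * nrm (Y m - Y n)"
        using X Y C(2)[of n] D(2)[of m] by (intro add_mono mult_left_mono mult_right_mono) auto
      also have "\<dots> < e / (2 * D) * D + C * (e / (2 * C))"
        using that N(1)[of m n] N(2)[of m n] C(1) D(1)
        by (intro add_strict_mono mult_strict_right_mono mult_strict_left_mono) auto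
      also have "\<dots> = e" using C D by simp
      finally show ?thesis by (simp add: dist_norm)
    qed
    then show "\<exists>M. \<forall>m\<ge>M. \<forall>n\<ge>M. dist (ip (X m) (Y m)) (ip (X n) (Y n)) < e" by blast
  qed
  then show ?thesis by (simp add: Cauchy_convergent_iff)
qed

lemma cauchy_seq_diff:
  assumes X: "\<And>n. X n \<in> V" and Y: "\<And>n. Y n \<in> V" and "cauchy_seq X" "cauchy_seq Y"
  shows "cauchy_seq (\<lambda>n. X n - Y n)"
  unfolding cauchy_seq_def
proof (intro allI impI)
  fix e :: real assume "e > 0"
  then have "e / 2 > 0" by simp
  then obtain N1 N2 where N: "\<And>m n. m \<ge> N1 \<Longrightarrow> n \<ge> N1 \<Longrightarrow> nrm (X m - X n) < e / 2"
      "\<And>m n. m \<ge> N2 \<Longrightarrow> n \<ge> N2 \<Longrightarrow> nrm (Y m - Y n) < e / 2"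
    using assms(3,4) unfolding cauchy_seq_def by meson
  have "nrm (X m - Y m - (X n - Y n)) < e" if "m \<ge> max N1 N2" "n \<ge> max N1 N2" for m n
  proof -
    have eq: "X m - Y m - (X n - Y n) = (X m - X n) + (Y n - Y m)" by simp
    have "nrm (X m - Y m - (X n - Y n)) \<le> nrm (X m - X n) + nrm (Y n - Y m)"
      unfolding eq by (rule nrm_triangle) (use X Y in auto)
    then show ?thesis using N(1)[of m n] N(2)[of n m] that by simp
  qed
  then show "\<exists>N. \<forall>m\<ge>N. \<forall>n\<ge>N. nrm (X m - Y m - (X n - Y n)) < e" by blast
qed

lemma cauchy_seq_scale:
  assumes X: "\<And>n. X n \<in> V" and "cauchy_seq X"
  shows "cauchy_seq (\<lambda>n. scale c (X n))"
  unfolding cauchy_seq_def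
proof (intro allI impI)
  fix e :: real assume "e > 0"
  then have "e / (cmod c + 1) > 0" by (intro divide_pos_pos) (auto simp: add_nonneg_pos)
  then obtain N where N: "\<And>m n. m \<ge> N \<Longrightarrow> n \<ge> N \<Longrightarrow> nrm (X m - X n) < e / (cmod c + 1)"
    using assms(2) unfolding cauchy_seq_def by meson
  have "nrm (scale c (X m) - scale c (X n)) < e" if "m \<ge> N" "n \<ge> N" for m n
  proof -
    have "nrm (scale c (X m) - scale c (X n)) = cmod c * nrm (X m - X n)"
      using nrm_scale[of "X m - X n" c] X by (simp add: scale_right_diff_distrib)
    also have "\<dots> \<le> (cmod c + 1) * nrm (X m - X n)"
      using X by (intro mult_right_mono) auto
    also have "\<dots> < (cmod c + 1) * (e / (cmod c + 1))"
      using N[OF that] by (intro mult_strict_left_mono) (auto simp: add_nonneg_pos)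
    also have "\<dots> = e"
    proof -
      have "cmod c + 1 \<noteq> 0" using norm_ge_zero[of c] by linarith
      then show ?thesis by simp
    qed
    finally show ?thesis .
  qed
  then show "\<exists>N. \<forall>m\<ge>N. \<forall>n\<ge>N. nrm (scale c (X m) - scale c (X n)) < e" by blast
qed

text \<open>
  This is the parallelogram law: the midpoint of two elements of \<open>C\<close> lies in \<open>C\<close> and cannot be below
  the lower bound \<open>d\<close>. The affine term \<open>l\<close> makes one statement serve both for points of minimal norm
  (\<open>l = 0\<close>) and for representing a linear functional.
\<close>

lemma near_minimizers_close:
  assumes "C \<subseteq> V" and mid: "\<And>v w. v \<in> C \<Longrightarrow> w \<in> C \<Longrightarrow> scale (1/2) (v + w) \<in> C"
    and aff: "\<And>v w. v \<in> C \<Longrightarrow> w \<in> C \<Longrightarrow> l (scale (1/2) (v + w)) = (l v + l w) / 2"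
    and low: "\<And>v. v \<in> C \<Longrightarrow> d \<le> Re (ip v v) - 2 * l v"
    and v: "v \<in> C" and w: "w \<in> C"
  shows "(nrm (v - w))\<^sup>2 \<le>
    2 * (Re (ip v v) - 2 * l v - d) + 2 * (Re (ip w w) - 2 * l w - (d :: real))"
proof -
  have V: "v \<in> V" "w \<in> V" using v w assms(1) by auto
  have "(nrm (scale (1/2) (v + w)))\<^sup>2 = ((nrm v)\<^sup>2 + 2 * Re (ip v w) + (nrm w)\<^sup>2) / 4"
    using V by (simp add: nrm_scale nrm_add_power2 power_mult_distrib power_divide)
  moreover have "d \<le> (nrm (scale (1/2) (v + w)))\<^sup>2 - (l v + l w)"
  proof -
    have half: "2 * ((l v + l w) / 2) = l v + l w" by simp
    have "(nrm (scale (1/2) (v + w)))\<^sup>2 = Re (ip (scale (1/2) (v + w)) (scale (1/2) (v + w)))"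
      using V by (intro nrm_power2) auto
    then show ?thesis using low[OF mid[OF v w]] unfolding aff[OF v w] half by (simp only:)
  qed
  ultimately show ?thesis
    unfolding nrm_diff_power2[OF V] nrm_power2[OF V(1), symmetric] nrm_power2[OF V(2), symmetric]
    by (simp add: field_simps)
qed

lemma minimizing_cauchy:
  assumes "C \<subseteq> V" and mid: "\<And>v w. v \<in> C \<Longrightarrow> w \<in> C \<Longrightarrow> scale (1/2) (v + w) \<in> C"
    and aff: "\<And>v w. v \<in> C \<Longrightarrow> w \<in> C \<Longrightarrow> l (scale (1/2) (v + w)) = (l v + l w) / 2"
    and low: "\<And>v. v \<in> C \<Longrightarrow> d \<le> Re (ip v v) - 2 * l v"
    and X: "\<And>n. X n \<in> C" and lim: "(\<lambda>n. Re (ip (X n) (X n)) - 2 * l (X n)) \<longlonglongrightarrow> (d :: real)"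
  shows "cauchy_seq X"
  unfolding cauchy_seq_def
proof (intro allI impI)
  fix e :: real assume e: "e > 0"
  then have "e\<^sup>2 / 4 > 0" by simp
  then obtain N where N: "\<And>n. n \<ge> N \<Longrightarrow> \<bar>Re (ip (X n) (X n)) - 2 * l (X n) - d\<bar> < e\<^sup>2 / 4"
    using lim unfolding LIMSEQ_def dist_real_def by meson
  have "nrm (X m - X n) < e" if "m \<ge> N" "n \<ge> N" for m n
  proof -
    have "(nrm (X m - X n))\<^sup>2 < e\<^sup>2"
    proof -
      have "(nrm (X m - X n))\<^sup>2 \<le> 2 * (Re (ip (X m) (X m)) - 2 * l (X m) - d) +
          2 * (Re (ip (X n) (X n)) - 2 * l (X n) - d)"
        by (rule near_minimizers_close[where C = C]) (use assms in auto)
      moreover have "P < q" if "P \<le> 2 * a + 2 * b" "\<bar>a\<bar> < q / 4" "\<bar>b\<bar> < q / 4" for P a b q :: real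
        using that by (simp add: abs_less_iff)
      ultimately show ?thesis using N[OF that(1)] N[OF that(2)] by blast
    qed
    then show ?thesis by (rule power2_less_imp_less) (use e in simp)
  qed
  then show "\<exists>N. \<forall>m\<ge>N. \<forall>n\<ge>N. nrm (X m - X n) < e" by blast
qed

lemma minimizing_sequence_exists:
  assumes "C \<noteq> {}" and "\<And>v. v \<in> C \<Longrightarrow> b \<le> J v"
  obtains X and d :: real where "\<And>n::nat. X n \<in> C" "(\<lambda>n. J (X n)) \<longlonglongrightarrow> d" "\<And>v. v \<in> C \<Longrightarrow> d \<le> J v"
proof -
  define d where "d = Inf (J ` C)"
  have bdd: "bdd_below (J ` C)" using assms(2) by (intro bdd_belowI2[of C b J])
  have dl: "d \<le> J v" if "v \<in> C" for v
    unfolding d_def using that bdd by (simp add: cInf_lower)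
  have "\<exists>v\<in>C. J v < d + 1 / real (Suc n)" for n
  proof (rule ccontr)
    assume "\<not> ?thesis"
    then have "d + 1 / real (Suc n) \<le> Inf (J ` C)"
      using assms(1) by (intro cInf_greatest) force+
    then show False by (simp add: d_def add_nonneg_pos)
  qed
  then obtain X where X: "\<And>n. X n \<in> C" "\<And>n. J (X n) < d + 1 / real (Suc n)" by metis
  have "(\<lambda>n. J (X n)) \<longlonglongrightarrow> d"
  proof (rule tendsto_sandwich)
    show "\<forall>\<^sub>F n in sequentially. d \<le> J (X n)"
      using X(1) dl by (intro always_eventually) blast
    show "\<forall>\<^sub>F n in sequentially. J (X n) \<le> d + 1 / real (Suc n)"
      using X(2) by (intro always_eventually) (blast intro: less_imp_le)
    show "(\<lambda>n. d) \<longlonglongrightarrow> d" by simp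
    show "(\<lambda>n. d + 1 / real (Suc n)) \<longlonglongrightarrow> d"
      using tendsto_add[OF tendsto_const[of d] LIMSEQ_inverse_real_of_nat] by (simp add: field_simps)
  qed
  then show ?thesis using that X dl by blast
qed

text \<open>
  The Riesz representation theorem with the representing vector replaced by a Cauchy sequence, so
  that it applies before completion. The sequence minimizes \<open>\<parallel>v\<parallel>\<^sup>2 - 2 Re (l v)\<close>, and the first variation
  of this functional in the direction \<open>w\<close> is \<open>2 Re (\<langle>w, v\<rangle> - l w)\<close>.
\<close>

lemma riesz_approx:
  assumes add: "\<And>v w. v \<in> V \<Longrightarrow> w \<in> V \<Longrightarrow> l (v + w) = l v + l w"
    and scl: "\<And>c v. v \<in> V \<Longrightarrow> l (scale c v) = c * l v"
    and bd: "\<And>v. v \<in> V \<Longrightarrow> cmod (l v) \<le> A * nrm v"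
  obtains X where "\<And>n::nat. X n \<in> V" "cauchy_seq X" "\<And>w. w \<in> V \<Longrightarrow> (\<lambda>n. ip w (X n)) \<longlonglongrightarrow> l w"
proof -
  define J where "J v = Re (ip v v) - 2 * Re (l v)" for v
  have "- A\<^sup>2 \<le> J v" if "v \<in> V" for v
  proof -
    have "Re (l v) \<le> A * nrm v" using bd[OF that] complex_Re_le_cmod[of "l v"] by linarith
    moreover have "0 \<le> (nrm v - A)\<^sup>2" by simp
    ultimately show ?thesis
      unfolding J_def nrm_power2[OF that, symmetric] by (simp add: power2_diff algebra_simps)
  qed
  then obtain X d where X: "\<And>n::nat. X n \<in> V" "(\<lambda>n. J (X n)) \<longlonglongrightarrow> d" "\<And>v. v \<in> V \<Longrightarrow> d \<le> J v"
    using minimizing_sequence_exists[of V "- A\<^sup>2" J] V_closed(1) by blast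
  have cau: "cauchy_seq X"
    by (rule minimizing_cauchy[where C = V and l = "\<lambda>v. Re (l v)" and d = d])
      (use X add scl in \<open>auto simp: J_def\<close>)
  have lim_re: "(\<lambda>n. Re (ip w (X n))) \<longlonglongrightarrow> Re (l w)" if w: "w \<in> V" for w
  proof -
    have cst: "cauchy_seq (\<lambda>n. w)" by (simp add: cauchy_seq_def)
    obtain L where L: "(\<lambda>n. ip w (X n)) \<longlonglongrightarrow> L"
      using ip_convergent[of "\<lambda>n. w" X] w X(1) cst cau by (auto simp: convergent_def)
    \<comment> \<open>compare the values of \<open>J\<close> along \<open>X\<close> with those along \<open>X + t w\<close>\<close>
    have key: "0 \<le> 2 * t * (Re L - Re (l w)) + t\<^sup>2 * (nrm w)\<^sup>2" for t :: real
    proof -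
      have "J (X n + scale (of_real t) w) = J (X n) + 2 * t * (Re (ip w (X n)) - Re (l w)) + t\<^sup>2 * (nrm w)\<^sup>2" for n
      proof -
        have "Re (ip (X n + scale (of_real t) w) (X n + scale (of_real t) w))
          = (nrm (X n))\<^sup>2 + 2 * Re (ip (X n) (scale (of_real t) w)) + (nrm (scale (of_real t) w))\<^sup>2"
          using nrm_add_power2[of "X n" "scale (of_real t) w"] X(1)[of n] w by (simp add: nrm_power2)
        moreover have "Re (ip (X n) (scale (of_real t) w)) = t * Re (ip w (X n))"
          using X(1)[of n] w ip_commute[of w "X n"] by (simp add: ip_scale_right)
        ultimately show ?thesis
          using X(1)[of n] w unfolding J_def
          by (simp add: nrm_power2[symmetric] nrm_scale power_mult_distrib add scl algebra_simps)
      qed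
      moreover have "d \<le> J (X n + scale (of_real t) w)" for n
        using X(1)[of n] w by (intro X(3)) auto
      ultimately have *: "d \<le> J (X n) + 2 * t * (Re (ip w (X n)) - Re (l w)) + t\<^sup>2 * (nrm w)\<^sup>2" for n
        by metis
      have "(\<lambda>n. J (X n) + 2 * t * (Re (ip w (X n)) - Re (l w)) + t\<^sup>2 * (nrm w)\<^sup>2)
        \<longlonglongrightarrow> d + 2 * t * (Re L - Re (l w)) + t\<^sup>2 * (nrm w)\<^sup>2"
        using X(2) L by (intro tendsto_intros)
      then have "d \<le> d + 2 * t * (Re L - Re (l w)) + t\<^sup>2 * (nrm w)\<^sup>2"
        using * by (intro LIMSEQ_le_const) auto
      then show ?thesis by simp
    qed
    have "Re L - Re (l w) = 0"
    proof (rule ccontr)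
      define q where "q = Re L - Re (l w)"
      define b where "b = (nrm w)\<^sup>2 + 1"
      assume "Re L - Re (l w) \<noteq> 0"
      then have q: "q \<noteq> 0" by (simp add: q_def)
      have b: "b > 0" by (simp add: b_def add_nonneg_pos)
      have "0 \<le> 2 * (- q / b) * q + (- q / b)\<^sup>2 * (nrm w)\<^sup>2" using key[of "- q / b"] by (simp add: q_def)
      also have "\<dots> \<le> 2 * (- q / b) * q + (- q / b)\<^sup>2 * b"
        by (intro add_left_mono mult_left_mono) (auto simp: b_def)
      also have "\<dots> = - (q\<^sup>2 / b)" using b by (simp add: field_simps power2_eq_square)
      also have "\<dots> < 0" using q b by simp
      finally show False by simp
    qed
    then show ?thesis using tendsto_Re[OF L] by simp
  qed
  have "(\<lambda>n. ip w (X n)) \<longlonglongrightarrow> l w" if w: "w \<in> V" for w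
  proof -
    have "(\<lambda>n. Re (ip (scale \<i> w) (X n))) \<longlonglongrightarrow> Re (l (scale \<i> w))"
      using w by (intro lim_re) auto
    then have "(\<lambda>n. - Im (ip w (X n))) \<longlonglongrightarrow> - Im (l w)"
      using w X(1) by (simp add: ip_scale_left scl)
    from tendsto_minus[OF this] have "(\<lambda>n. Im (ip w (X n))) \<longlonglongrightarrow> Im (l w)"
      by simp
    then show ?thesis using lim_re[OF w] by (simp add: tendsto_complex_iff)
  qed
  then show ?thesis using that X(1) cau by blast
qed

end

sublocale complex_hilbert_space \<subseteq> pre: semi_inner_space scale V ip
proof
  show "0 \<le> Re (ip v v)" if "v \<in> V" for v
  proof (cases "v = 0")
    case True
    have "ip (scale 0 0) 0 = 0" using ip_scale_left[of 0 0 0] subspace_0[OF subspace_V] by simp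
    then show ?thesis using True by simp
  qed (use ip_pos[OF that] in simp)
qed (rule subspace_V ip_add_left ip_scale_left ip_commute; assumption?)+

context complex_hilbert_space
begin

lemma eq_zero_if_nrm_zero: "v \<in> V \<Longrightarrow> hnorm ip v = 0 \<Longrightarrow> v = 0"
  using ip_pos[of v] pre.nrm_power2[of v] by (cases "v = 0") simp_all

end


section \<open>Positive definite kernels\<close>

definition cscale :: "complex \<Rightarrow> ('b \<Rightarrow> complex) \<Rightarrow> 'b \<Rightarrow> complex" where
  "cscale = (\<lambda>c f x. c * f x)"

lemma cscale_apply [simp]: "cscale c f x = c * f x"
  by (simp add: cscale_def)

lemma vector_space_cscale: "vector_space (cscale :: complex \<Rightarrow> ('b \<Rightarrow> complex) \<Rightarrow> 'b \<Rightarrow> complex)"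
  by unfold_locales (auto simp: fun_eq_iff algebra_simps)

lemma subspace_cscale_iff:
  "module.subspace cscale V \<longleftrightarrow>
     0 \<in> V \<and> (\<forall>f\<in>V. \<forall>g\<in>V. f + g \<in> V) \<and> (\<forall>c. \<forall>f\<in>V. cscale c f \<in> V)"
proof -
  interpret vector_space "cscale :: complex \<Rightarrow> ('b \<Rightarrow> complex) \<Rightarrow> 'b \<Rightarrow> complex"
    by (rule vector_space_cscale)
  show ?thesis by (auto simp: subspace_def)
qed

definition finsupp :: "('b \<Rightarrow> complex) set" where
  "finsupp = {c. finite {x. c x \<noteq> 0}}"

definition point :: "'b \<Rightarrow> 'b \<Rightarrow> complex" where
  "point a = (\<lambda>x. if x = a then 1 else 0)"

definition fin_ip :: "('b \<Rightarrow> 'b \<Rightarrow> complex) \<Rightarrow> ('b \<Rightarrow> complex) \<Rightarrow> ('b \<Rightarrow> complex) \<Rightarrow> complex" where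
  "fin_ip K c d = (\<Sum>x | c x \<noteq> 0. \<Sum>y | d y \<noteq> 0. c x * cnj (d y) * K x y)"

definition fin_lin :: "('b \<Rightarrow> complex) \<Rightarrow> ('b \<Rightarrow> complex) \<Rightarrow> complex" where
  "fin_lin u c = (\<Sum>x | c x \<noteq> 0. c x * u x)"

text \<open>
  Only the real part of the quadratic form is required to be nonnegative, so the symmetry of the kernel
  is a condition of its own.
\<close>

definition pd_kernel :: "('b \<Rightarrow> 'b \<Rightarrow> complex) \<Rightarrow> bool" where
  "pd_kernel K \<longleftrightarrow> (\<forall>x y. K y x = cnj (K x y)) \<and> (\<forall>c\<in>finsupp. 0 \<le> Re (fin_ip K c c))"

lemma finsupp_iff: "c \<in> finsupp \<longleftrightarrow> finite {x. c x \<noteq> 0}"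
  by (simp add: finsupp_def)

lemma finsuppI: "finite S \<Longrightarrow> (\<And>x. x \<notin> S \<Longrightarrow> c x = 0) \<Longrightarrow> c \<in> finsupp"
  unfolding finsupp_iff by (rule finite_subset[of _ S]) auto

lemma fin_ip_eq:
  assumes "finite S" "finite T" "\<And>x. x \<notin> S \<Longrightarrow> c x = 0" "\<And>x. x \<notin> T \<Longrightarrow> d x = 0"
  shows "fin_ip K c d = (\<Sum>x\<in>S. \<Sum>y\<in>T. c x * cnj (d y) * K x y)"
proof -
  have "(\<Sum>y | d y \<noteq> 0. c x * cnj (d y) * K x y) = (\<Sum>y\<in>T. c x * cnj (d y) * K x y)" for x
    using assms by (intro sum.mono_neutral_left) auto
  moreover have "(\<Sum>x | c x \<noteq> 0. \<Sum>y\<in>T. c x * cnj (d y) * K x y) = (\<Sum>x\<in>S. \<Sum>y\<in>T. c x * cnj (d y) * K x y)"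
    using assms by (intro sum.mono_neutral_left) auto
  ultimately show ?thesis by (simp add: fin_ip_def)
qed

lemma fin_lin_eq:
  assumes "finite S" "\<And>x. x \<notin> S \<Longrightarrow> c x = 0"
  shows "fin_lin u c = (\<Sum>x\<in>S. c x * u x)"
  unfolding fin_lin_def using assms by (intro sum.mono_neutral_left) auto

lemma finsupp_zero: "0 \<in> finsupp"
  by (simp add: finsupp_iff)

lemma finsupp_add: "c \<in> finsupp \<Longrightarrow> d \<in> finsupp \<Longrightarrow> c + d \<in> finsupp"
  by (rule finsuppI[of "{x. c x \<noteq> 0} \<union> {x. d x \<noteq> 0}"]) (auto simp: finsupp_iff)

lemma finsupp_scale: "c \<in> finsupp \<Longrightarrow> cscale a c \<in> finsupp"
  by (rule finsuppI[of "{x. c x \<noteq> 0}"]) (auto simp: finsupp_iff)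

lemma point_finsupp: "point a \<in> finsupp"
  by (rule finsuppI[of "{a}"]) (auto simp: point_def)

lemma fin_ip_point_right: "c \<in> finsupp \<Longrightarrow> fin_ip K c (point a) = (\<Sum>x | c x \<noteq> 0. c x * K x a)"
  by (subst fin_ip_eq[where S = "{x. c x \<noteq> 0}" and T = "{a}"]) (auto simp: finsupp_iff point_def)

lemma fin_ip_points: "fin_ip K (point a) (point b) = K a b"
  by (subst fin_ip_eq[where S = "{a}" and T = "{b}"]) (auto simp: point_def)

lemma fin_lin_point: "fin_lin u (point a) = u a"
  by (subst fin_lin_eq[where S = "{a}"]) (auto simp: point_def)

lemma fin_ip_add_left:
  assumes "c \<in> finsupp" "d \<in> finsupp" "e \<in> finsupp"
  shows "fin_ip K (c + d) e = fin_ip K c e + fin_ip K d e"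
proof -
  define S where "S = {x. c x \<noteq> 0} \<union> {x. d x \<noteq> 0} \<union> {x. e x \<noteq> 0}"
  have S: "finite S" using assms by (simp add: S_def finsupp_iff)
  have z: "\<And>x. x \<notin> S \<Longrightarrow> c x = 0" "\<And>x. x \<notin> S \<Longrightarrow> d x = 0" "\<And>x. x \<notin> S \<Longrightarrow> e x = 0"
    by (auto simp: S_def)
  show ?thesis
    by (subst (1 2 3) fin_ip_eq[OF S S]) (auto simp: z sum.distrib[symmetric] algebra_simps)
qed

lemma fin_lin_add:
  assumes "c \<in> finsupp" "d \<in> finsupp"
  shows "fin_lin u (c + d) = fin_lin u c + fin_lin u d"
proof -
  define S where "S = {x. c x \<noteq> 0} \<union> {x. d x \<noteq> 0}"
  have S: "finite S" using assms by (simp add: S_def finsupp_iff)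
  have z: "\<And>x. x \<notin> S \<Longrightarrow> c x = 0" "\<And>x. x \<notin> S \<Longrightarrow> d x = 0"
    by (auto simp: S_def)
  show ?thesis
    by (subst (1 2 3) fin_lin_eq[OF S]) (auto simp: z sum.distrib[symmetric] algebra_simps)
qed

lemma fin_ip_scale_left:
  assumes "c \<in> finsupp" "e \<in> finsupp"
  shows "fin_ip K (cscale a c) e = a * fin_ip K c e"
proof -
  define S where "S = {x. c x \<noteq> 0} \<union> {x. e x \<noteq> 0}"
  have S: "finite S" using assms by (simp add: S_def finsupp_iff)
  have z: "\<And>x. x \<notin> S \<Longrightarrow> c x = 0" "\<And>x. x \<notin> S \<Longrightarrow> e x = 0"
    by (auto simp: S_def)
  show ?thesis
    by (subst (1 2) fin_ip_eq[OF S S]) (auto simp: z sum_distrib_left algebra_simps)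
qed

lemma fin_lin_scale:
  assumes "c \<in> finsupp"
  shows "fin_lin u (cscale a c) = a * fin_lin u c"
proof -
  define S where "S = {x. c x \<noteq> 0}"
  have S: "finite S" using assms by (simp add: S_def finsupp_iff)
  have z: "\<And>x. x \<notin> S \<Longrightarrow> c x = 0" by (auto simp: S_def)
  show ?thesis
    by (subst (1 2) fin_lin_eq[OF S]) (auto simp: z sum_distrib_left algebra_simps)
qed

lemma fin_ip_commute:
  assumes "\<And>x y. K y x = cnj (K x y)"
  shows "fin_ip K d c = cnj (fin_ip K c d)"
proof -
  have "fin_ip K d c = (\<Sum>y | c y \<noteq> 0. \<Sum>x | d x \<noteq> 0. d x * cnj (c y) * K x y)"
    unfolding fin_ip_def by (rule sum.swap)
  also have "\<dots> = cnj (fin_ip K c d)"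
    unfolding fin_ip_def cnj_sum
    by (intro sum.cong refl) (subst assms, simp add: mult_ac)
  finally show ?thesis .
qed

lemma pd_kernel_hermitian: "pd_kernel K \<Longrightarrow> K y x = cnj (K x y)"
  unfolding pd_kernel_def by blast

lemma pd_kernel_nonneg: "pd_kernel K \<Longrightarrow> c \<in> finsupp \<Longrightarrow> 0 \<le> Re (fin_ip K c c)"
  unfolding pd_kernel_def by blast

lemma pd_kernelI:
  "\<lbrakk>\<And>x y. K y x = cnj (K x y); \<And>c. c \<in> finsupp \<Longrightarrow> 0 \<le> Re (fin_ip K c c)\<rbrakk> \<Longrightarrow> pd_kernel K"
  unfolding pd_kernel_def by blast

lemma semi_inner_fin_ip: "pd_kernel K \<Longrightarrow> semi_inner_space cscale finsupp (fin_ip K)"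
proof -
  assume K: "pd_kernel K"
  interpret vector_space "cscale :: complex \<Rightarrow> ('b \<Rightarrow> complex) \<Rightarrow> 'b \<Rightarrow> complex"
    by (rule vector_space_cscale)
  show ?thesis
  proof
    show "subspace finsupp"
      by (simp add: subspace_cscale_iff finsupp_zero finsupp_add finsupp_scale)
    show "fin_ip K d c = cnj (fin_ip K c d)" for c d
      by (rule fin_ip_commute) (rule pd_kernel_hermitian[OF K])
  qed (simp_all add: fin_ip_add_left fin_ip_scale_left pd_kernel_nonneg[OF K])
qed

lemma fin_ip_kernel_add: "fin_ip (\<lambda>x y. K x y + L x y) c d = fin_ip K c d + fin_ip L c d"
  by (simp add: fin_ip_def algebra_simps sum.distrib)

lemma fin_ip_kernel_diff: "fin_ip (\<lambda>x y. K x y - L x y) c d = fin_ip K c d - fin_ip L c d"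
  by (simp add: fin_ip_def algebra_simps sum_subtractf)

lemma fin_ip_kernel_scale: "fin_ip (\<lambda>x y. t * K x y) c d = t * fin_ip K c d"
  by (simp add: fin_ip_def sum_distrib_left mult_ac)

lemma fin_ip_rank_one: "fin_ip (\<lambda>x y. u x * cnj (v y)) c d = fin_lin u c * cnj (fin_lin v d)"
  unfolding fin_ip_def fin_lin_def cnj_sum sum_product by (intro sum.cong refl) simp

lemma fin_ip_rank_one_mult:
  assumes "c \<in> finsupp" "d \<in> finsupp"
  shows "fin_ip (\<lambda>x y. u x * cnj (v y) * K x y) c d = fin_ip K (c * u) (d * v)"
proof -
  have "fin_ip K (c * u) (d * v)
      = (\<Sum>x | c x \<noteq> 0. \<Sum>y | d y \<noteq> 0. (c * u) x * cnj ((d * v) y) * K x y)"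
    using assms by (intro fin_ip_eq) (auto simp: finsupp_iff)
  then show ?thesis unfolding fin_ip_def by (simp add: mult_ac)
qed

lemma pd_kernel_add: "pd_kernel K \<Longrightarrow> pd_kernel L \<Longrightarrow> pd_kernel (\<lambda>x y. K x y + L x y)"
  by (rule pd_kernelI)
    (simp_all add: fin_ip_kernel_add pd_kernel_nonneg flip: pd_kernel_hermitian)

lemma pd_kernel_scale: "0 \<le> t \<Longrightarrow> pd_kernel K \<Longrightarrow> pd_kernel (\<lambda>x y. complex_of_real t * K x y)"
  by (rule pd_kernelI)
    (simp_all add: fin_ip_kernel_scale pd_kernel_nonneg flip: pd_kernel_hermitian)

lemma pd_kernel_rank_one_mult:
  assumes K: "pd_kernel K"
  shows "pd_kernel (\<lambda>x y. u x * cnj (u y) * K x y)"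
proof (rule pd_kernelI)
  show "u y * cnj (u x) * K y x = cnj (u x * cnj (u y) * K x y)" for x y
    by (subst pd_kernel_hermitian[OF K, of x y]) simp
  fix c :: "'a \<Rightarrow> complex" assume c: "c \<in> finsupp"
  have "c * u \<in> finsupp" using c by (intro finsuppI[of "{x. c x \<noteq> 0}"]) (auto simp: finsupp_iff)
  then show "0 \<le> Re (fin_ip (\<lambda>x y. u x * cnj (u y) * K x y) c c)"
    using K c by (simp add: fin_ip_rank_one_mult pd_kernel_nonneg)
qed

lemma pd_kernel_cauchy_schwarz:
  assumes "pd_kernel K" "c \<in> finsupp" "d \<in> finsupp"
  shows "(cmod (fin_ip K c d))\<^sup>2 \<le> Re (fin_ip K c c) * Re (fin_ip K d d)"
proof -
  interpret semi_inner_space cscale finsupp "fin_ip K" by (rule semi_inner_fin_ip[OF assms(1)])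
  have "(cmod (fin_ip K c d))\<^sup>2 \<le> (nrm c * nrm d)\<^sup>2"
    using cauchy_schwarz[OF assms(2,3)] by (intro power_mono) auto
  then show ?thesis using assms by (simp add: power_mult_distrib nrm_power2)
qed

lemma pd_kernel_diag: "pd_kernel K \<Longrightarrow> K a a = of_real (Re (K a a)) \<and> 0 \<le> Re (K a a)"
  using pd_kernel_nonneg[OF _ point_finsupp, of K a] pd_kernel_hermitian[of K a a]
  by (simp add: fin_ip_points complex_eq_iff)

lemma pd_kernel_bound: "pd_kernel K \<Longrightarrow> (cmod (K a b))\<^sup>2 \<le> Re (K a a) * Re (K b b)"
  using pd_kernel_cauchy_schwarz[of K "point a" "point b"] by (simp add: fin_ip_points point_finsupp)

text \<open>
  Domination of a rank one kernel is the same as boundedness of the linear functional given by \<open>u\<close> with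
  respect to the seminorm of \<open>K\<close>.
\<close>

lemma pd_kernel_dominates_iff:
  assumes herm: "\<And>x y. K y x = cnj (K x y)"
  shows "pd_kernel (\<lambda>x y. complex_of_real r * K x y - u x * cnj (u y)) \<longleftrightarrow>
    (\<forall>c\<in>finsupp. (cmod (fin_lin u c))\<^sup>2 \<le> r * Re (fin_ip K c c))" (is "pd_kernel ?L \<longleftrightarrow> _")
proof -
  have Re_L: "Re (fin_ip ?L c c) = r * Re (fin_ip K c c) - (cmod (fin_lin u c))\<^sup>2" for c
    by (simp add: fin_ip_kernel_diff fin_ip_kernel_scale fin_ip_rank_one cmod_power2
        power2_eq_square[of "Re _"] power2_eq_square[of "Im _"])
  have "?L y x = cnj (?L x y)" for x y
    by (subst herm[of x y]) (simp add: mult.commute)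
  then have "pd_kernel ?L \<longleftrightarrow> (\<forall>c\<in>finsupp. 0 \<le> Re (fin_ip ?L c c))"
    using pd_kernelI[of ?L] pd_kernel_nonneg[of ?L] by blast
  then show ?thesis unfolding Re_L by simp
qed

text \<open>
  One step of symmetric Gaussian elimination: subtracting the multiple of the column at \<open>a\<close> which clears
  that column leaves a positive definite kernel.
\<close>

lemma pd_kernel_column:
  assumes K: "pd_kernel K"
  shows "pd_kernel (\<lambda>x y. complex_of_real (Re (K a a)) * K x y - K x a * cnj (K y a))"
proof -
  have *: "fin_lin (\<lambda>x. K x a) c = fin_ip K c (point a)" if "c \<in> finsupp" for c
    using that by (simp add: fin_ip_point_right fin_lin_def)
  show ?thesis
    unfolding pd_kernel_dominates_iff[of K, OF pd_kernel_hermitian[OF K]]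
    using pd_kernel_cauchy_schwarz[OF K _ point_finsupp[of a]]
    by (simp add: * fin_ip_points mult.commute)
qed

text \<open>
  The Schur product theorem, by induction on the set of points where \<open>A\<close> is not yet zero. Elimination
  splits \<open>A\<close> into a rank one kernel, whose product with \<open>B\<close> amounts to a change of coefficients, and a
  kernel that vanishes at one more point.
\<close>

lemma pd_kernel_mult:
  assumes A: "pd_kernel A" and B: "pd_kernel B"
  shows "pd_kernel (\<lambda>x y. A x y * B x y)"
proof -
  have main: "0 \<le> Re (fin_ip (\<lambda>x y. A x y * B x y) c c)"
    if "finite S" "pd_kernel A" "\<And>x y. c x \<noteq> 0 \<Longrightarrow> x \<notin> S \<Longrightarrow> A x y = 0" "c \<in> finsupp" for S A c
    using that
  proof (induction S arbitrary: A rule: finite_induct)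
    case empty
    have "fin_ip (\<lambda>x y. A x y * B x y) c c = 0"
      unfolding fin_ip_def by (intro sum.neutral ballI) (use empty in auto)
    then show ?case by simp
  next
    case (insert s S)
    define q where "q = Re (A s s)"
    have q: "A s s = of_real q" "q \<ge> 0" using pd_kernel_diag[OF insert.prems(1)] by (auto simp: q_def)
    show ?case
    proof (cases "q = 0")
      case True
      have "A s y = 0" for y
        using pd_kernel_bound[OF insert.prems(1), of s y] True by (simp add: q_def)
      then show ?thesis using insert.prems by (intro insert.IH) auto
    next
      case False
      then have qp: "q > 0" using q by simp
      define A' where "A' = (\<lambda>x y. complex_of_real (1/q) * (complex_of_real q * A x y - A x s * cnj (A y s)))"
      have A': "pd_kernel A'"
        unfolding A'_def using qp pd_kernel_column[OF insert.prems(1), of s]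
        by (intro pd_kernel_scale) (auto simp: q_def)
      have "A' x y = 0" if "c x \<noteq> 0" "x \<notin> S" for x y
      proof (cases "x = s")
        case True
        have "A s y = cnj (A y s)" using insert.prems(1) by (rule pd_kernel_hermitian)
        then show ?thesis using True q qp by (simp add: A'_def)
      next
        case False
        then show ?thesis using insert.prems(2)[of x] that by (simp add: A'_def)
      qed
      then have 1: "0 \<le> Re (fin_ip (\<lambda>x y. A' x y * B x y) c c)"
        using A' insert.prems(3) by (intro insert.IH) auto
      define R where "R = (\<lambda>x y. complex_of_real (1/q) * (A x s * cnj (A y s) * B x y))"
      have "pd_kernel R"
        unfolding R_def using qp by (intro pd_kernel_scale pd_kernel_rank_one_mult B) auto
      then have 2: "0 \<le> Re (fin_ip R c c)" using insert.prems(3) by (rule pd_kernel_nonneg)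
      have "(\<lambda>x y. A x y * B x y) = (\<lambda>x y. A' x y * B x y + R x y)"
        using qp by (auto simp: fun_eq_iff A'_def R_def field_simps)
      then show ?thesis using 1 2 by (simp add: fin_ip_kernel_add)
    qed
  qed
  show ?thesis
  proof (rule pd_kernelI)
    show "A y x * B y x = cnj (A x y * B x y)" for x y
      by (subst pd_kernel_hermitian[OF A, of x y], subst pd_kernel_hermitian[OF B, of x y]) simp
    show "0 \<le> Re (fin_ip (\<lambda>x y. A x y * B x y) c c)" if "c \<in> finsupp" for c
      using that A by (intro main[of "{x. c x \<noteq> 0}"]) (auto simp: finsupp_iff)
  qed
qed

lemma fin_ip_tendsto:
  assumes "\<And>x y. ((\<lambda>i. K i x y) \<longlongrightarrow> L x y) F"
  shows "((\<lambda>i. fin_ip (K i) c d) \<longlongrightarrow> fin_ip L c d) F"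
  unfolding fin_ip_def by (intro tendsto_intros assms)

lemma pd_kernel_limit:
  fixes L :: "'b \<Rightarrow> 'b \<Rightarrow> complex"
  assumes "F \<noteq> bot" and ev: "eventually (\<lambda>i. pd_kernel (K i)) F"
    and lim: "\<And>x y. ((\<lambda>i. K i x y) \<longlongrightarrow> L x y) F"
  shows "pd_kernel L"
proof (rule pd_kernelI)
  fix x y
  have "((\<lambda>i. cnj (K i x y)) \<longlongrightarrow> cnj (L x y)) F" by (intro tendsto_intros lim)
  moreover have "eventually (\<lambda>i. cnj (K i x y) = K i y x) F"
    using ev by eventually_elim (rule pd_kernel_hermitian[symmetric])
  ultimately have "((\<lambda>i. K i y x) \<longlongrightarrow> cnj (L x y)) F" using tendsto_cong by fast
  then show "L y x = cnj (L x y)" using tendsto_unique[OF assms(1) lim] by blast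
next
  fix c :: "'b \<Rightarrow> complex" assume "c \<in> finsupp"
  then have "eventually (\<lambda>i. 0 \<le> Re (fin_ip (K i) c c)) F"
    using ev by (auto intro: pd_kernel_nonneg elim: eventually_mono)
  then show "0 \<le> Re (fin_ip L c c)"
    by (rule tendsto_lowerbound[OF tendsto_Re[OF fin_ip_tendsto[OF lim]] _ assms(1)])
qed

text \<open>
  For a continuous \<open>u\<close>, the existence of such a \<open>\<phi>\<close> turns out to mean that \<open>u \<in> B(G)\<close> and \<open>\<parallel>u\<parallel> \<le> r\<close>. No
  continuity is imposed on \<open>\<phi>\<close>, so that the condition is stable under pointwise limits.
\<close>

definition dominated :: "real \<Rightarrow> ('a::group_add \<Rightarrow> complex) \<Rightarrow> ('a \<Rightarrow> complex) \<Rightarrow> bool" where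
  "dominated r \<phi> u \<longleftrightarrow> pd_kernel (\<lambda>x y. \<phi> (- y + x)) \<and>
     pd_kernel (\<lambda>x y. complex_of_real r * \<phi> (- y + x) - u x * cnj (u y)) \<and> Re (\<phi> 0) \<le> r"

lemma pd_function_hermitian:
  "pd_kernel (\<lambda>x y. \<phi> (- y + x)) \<Longrightarrow> \<phi> (- x + y) = cnj (\<phi> (- y + x :: 'a::group_add))"
  by (rule pd_kernel_hermitian[of "\<lambda>x y. \<phi> (- y + x)"])

lemma dominated_ineq:
  assumes "dominated r \<phi> u" "c \<in> finsupp"
  shows "(cmod (fin_lin u c))\<^sup>2 \<le> r * Re (fin_ip (\<lambda>x y. \<phi> (- y + x)) c c)"
  using assms pd_kernel_dominates_iff[of "\<lambda>x y. \<phi> (- y + x)" r u, OF pd_function_hermitian]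
  unfolding dominated_def by blast

lemma dominatedI:
  assumes "pd_kernel (\<lambda>x y. \<phi> (- y + x))" "Re (\<phi> 0) \<le> r"
    "\<And>c. c \<in> finsupp \<Longrightarrow> (cmod (fin_lin u c))\<^sup>2 \<le> r * Re (fin_ip (\<lambda>x y. \<phi> (- y + x)) c c)"
  shows "dominated r \<phi> u"
  using assms pd_kernel_dominates_iff[of "\<lambda>x y. \<phi> (- y + x)" r u, OF pd_function_hermitian]
  unfolding dominated_def by blast

lemma pd_function_bound:
  assumes "pd_kernel (\<lambda>x y. \<phi> (- y + x :: 'a::group_add))"
  shows "cmod (\<phi> x) \<le> Re (\<phi> 0)" "0 \<le> Re (\<phi> 0)"
proof -
  have "(cmod (\<phi> x))\<^sup>2 \<le> (Re (\<phi> 0))\<^sup>2"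
    using pd_kernel_bound[OF assms, where a = x and b = 0] by (simp add: power2_eq_square)
  moreover show "0 \<le> Re (\<phi> 0)" using pd_kernel_diag[OF assms, of 0] by simp
  ultimately show "cmod (\<phi> x) \<le> Re (\<phi> 0)" by (rule power2_le_imp_le)
qed

lemma dominated_nonneg: "dominated r \<phi> u \<Longrightarrow> 0 \<le> r"
  using pd_function_bound(2)[of \<phi>] by (auto simp: dominated_def)

lemma dominated_bound:
  assumes "dominated r \<phi> u"
  shows "cmod (u x) \<le> r"
proof -
  have "(cmod (u x))\<^sup>2 \<le> r * Re (\<phi> 0)"
    using dominated_ineq[OF assms point_finsupp[of x]] by (simp add: fin_lin_point fin_ip_points)
  also have "\<dots> \<le> r * r"
    using assms dominated_nonneg[OF assms] by (intro mult_left_mono) (auto simp: dominated_def)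
  finally show ?thesis
    unfolding power2_eq_square[symmetric, of r] by (rule power2_le_imp_le) (rule dominated_nonneg[OF assms])
qed

lemma dominated_add:
  assumes u: "dominated r \<phi> u" and v: "dominated s \<psi> v"
  shows "dominated (r + s) (\<lambda>x. \<phi> x + \<psi> x) (u + v)"
proof (rule dominatedI)
  show "pd_kernel (\<lambda>x y. \<phi> (- y + x) + \<psi> (- y + x))"
    using u v by (intro pd_kernel_add) (auto simp: dominated_def)
  show "Re (\<phi> 0 + \<psi> 0) \<le> r + s" using u v by (simp add: dominated_def)
  fix c :: "'a \<Rightarrow> complex" assume c: "c \<in> finsupp"
  define A where "A = Re (fin_ip (\<lambda>x y. \<phi> (- y + x)) c c)"
  define B where "B = Re (fin_ip (\<lambda>x y. \<psi> (- y + x)) c c)"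
  have AB: "A \<ge> 0" "B \<ge> 0" using u v c by (auto simp: A_def B_def dominated_def pd_kernel_nonneg)
  have rs: "r \<ge> 0" "s \<ge> 0" using u v dominated_nonneg by auto
  have a: "(cmod (fin_lin u c))\<^sup>2 \<le> r * A" and b: "(cmod (fin_lin v c))\<^sup>2 \<le> s * B"
    using dominated_ineq[OF u c] dominated_ineq[OF v c] by (auto simp: A_def B_def)
  have "(2 * (cmod (fin_lin u c) * cmod (fin_lin v c)))\<^sup>2 \<le> 4 * ((r * A) * (s * B))"
    using mult_mono[OF a b] rs AB by (simp add: power_mult_distrib)
  also have "\<dots> \<le> (r * B + s * A)\<^sup>2"
    using zero_le_power2[of "r * B - s * A"] by (simp add: power2_eq_square algebra_simps)
  finally have ab: "2 * (cmod (fin_lin u c) * cmod (fin_lin v c)) \<le> r * B + s * A"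
    by (rule power2_le_imp_le) (use rs AB in simp)
  have "fin_lin (u + v) c = fin_lin u c + fin_lin v c"
    by (simp add: fin_lin_def distrib_left sum.distrib)
  then have "(cmod (fin_lin (u + v) c))\<^sup>2 \<le> (cmod (fin_lin u c) + cmod (fin_lin v c))\<^sup>2"
    using norm_triangle_ineq by (intro power_mono) auto
  also have "\<dots> \<le> (r + s) * (A + B)"
    using a b ab by (simp add: power2_sum algebra_simps)
  finally show "(cmod (fin_lin (u + v) c))\<^sup>2 \<le>
      (r + s) * Re (fin_ip (\<lambda>x y. \<phi> (- y + x) + \<psi> (- y + x)) c c)"
    by (simp add: A_def B_def fin_ip_kernel_add)
qed

lemma dominated_scale:
  assumes u: "dominated r \<phi> u"
  shows "dominated (cmod a * r) (\<lambda>x. of_real (cmod a) * \<phi> x) (\<lambda>x. a * u x)"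
proof (rule dominatedI)
  show "pd_kernel (\<lambda>x y. complex_of_real (cmod a) * \<phi> (- y + x))"
    using u by (intro pd_kernel_scale) (auto simp: dominated_def)
  show "Re (complex_of_real (cmod a) * \<phi> 0) \<le> cmod a * r"
    using u by (auto simp: dominated_def intro: mult_left_mono)
  fix c :: "'a \<Rightarrow> complex" assume c: "c \<in> finsupp"
  have "fin_lin (\<lambda>x. a * u x) c = a * fin_lin u c"
    by (simp add: fin_lin_def sum_distrib_left mult_ac)
  then have "(cmod (fin_lin (\<lambda>x. a * u x) c))\<^sup>2 = (cmod a)\<^sup>2 * (cmod (fin_lin u c))\<^sup>2"
    by (simp add: norm_mult power_mult_distrib)
  also have "\<dots> \<le> (cmod a)\<^sup>2 * (r * Re (fin_ip (\<lambda>x y. \<phi> (- y + x)) c c))"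
    using dominated_ineq[OF u c] by (intro mult_left_mono) auto
  finally show "(cmod (fin_lin (\<lambda>x. a * u x) c))\<^sup>2 \<le> cmod a * r *
      Re (fin_ip (\<lambda>x y. complex_of_real (cmod a) * \<phi> (- y + x)) c c)"
    by (simp add: fin_ip_kernel_scale power2_eq_square mult_ac)
qed

lemma dominated_mult:
  assumes u: "dominated r \<phi> u" and v: "dominated s \<psi> v"
  shows "dominated (r * s) (\<phi> * \<psi>) (u * v)"
  unfolding dominated_def
proof (intro conjI)
  have K: "pd_kernel (\<lambda>x y. \<phi> (- y + x))" "pd_kernel (\<lambda>x y. \<psi> (- y + x))"
    "pd_kernel (\<lambda>x y. complex_of_real r * \<phi> (- y + x) - u x * cnj (u y))"
    "pd_kernel (\<lambda>x y. complex_of_real s * \<psi> (- y + x) - v x * cnj (v y))"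
    using u v by (auto simp: dominated_def)
  show "pd_kernel (\<lambda>x y. (\<phi> * \<psi>) (- y + x))" using pd_kernel_mult[OF K(1,2)] by simp
  have r: "r \<ge> 0" using dominated_nonneg[OF u] .
  \<comment> \<open>\<open>r \<phi> s \<psi> - u u* v v* = r \<phi> (s \<psi> - v v*) + v v* (r \<phi> - u u*)\<close>\<close>
  have "pd_kernel (\<lambda>x y. complex_of_real r * (\<phi> (- y + x) * (complex_of_real s * \<psi> (- y + x) - v x * cnj (v y)))
      + v x * cnj (v y) * (complex_of_real r * \<phi> (- y + x) - u x * cnj (u y)))"
    by (intro pd_kernel_add pd_kernel_scale pd_kernel_mult pd_kernel_rank_one_mult K r)
  then show "pd_kernel (\<lambda>x y. complex_of_real (r * s) * (\<phi> * \<psi>) (- y + x) - (u * v) x * cnj ((u * v) y))"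
    by (rule back_subst[of pd_kernel]) (auto simp: fun_eq_iff algebra_simps)
  have "cmod ((\<phi> * \<psi>) 0) \<le> r * s"
    using pd_function_bound(1)[OF K(1), of 0] pd_function_bound(1)[OF K(2), of 0] u v r
    by (auto simp: norm_mult dominated_def intro!: mult_mono)
  then show "Re ((\<phi> * \<psi>) 0) \<le> r * s" using complex_Re_le_cmod order_trans by blast
qed

lemma pd_function_dominates_itself:
  assumes "pd_kernel (\<lambda>x y. \<phi> (- y + x :: 'a::group_add))" "Re (\<phi> 0) \<le> r"
  shows "dominated r \<phi> \<phi>"
proof (rule dominatedI[OF assms])
  fix c :: "'a \<Rightarrow> complex" assume c: "c \<in> finsupp"
  have q: "0 \<le> Re (fin_ip (\<lambda>x y. \<phi> (- y + x)) c c)" using assms(1) c by (rule pd_kernel_nonneg)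
  have "fin_lin \<phi> c = fin_ip (\<lambda>x y. \<phi> (- y + x)) c (point 0)"
    using c by (simp add: fin_ip_point_right fin_lin_def)
  then have "(cmod (fin_lin \<phi> c))\<^sup>2 \<le> Re (fin_ip (\<lambda>x y. \<phi> (- y + x)) c c) * Re (\<phi> 0)"
    using pd_kernel_cauchy_schwarz[OF assms(1) c point_finsupp[of 0]] by (simp add: fin_ip_points)
  also have "\<dots> \<le> r * Re (fin_ip (\<lambda>x y. \<phi> (- y + x)) c c)"
    using mult_left_mono[OF assms(2) q] by (simp add: mult.commute)
  finally show "(cmod (fin_lin \<phi> c))\<^sup>2 \<le> r * Re (fin_ip (\<lambda>x y. \<phi> (- y + x)) c c)" .
qed

lemma compact_bounded_functions: "compact {f :: 'b \<Rightarrow> complex. \<forall>x. cmod (f x) \<le> R}"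
proof -
  have "compactin (product_topology (\<lambda>i::'b. euclidean) UNIV) (Pi\<^sub>E UNIV (\<lambda>i. cball (0::complex) R))"
    by (simp add: compactin_PiE compactin_euclidean_iff)
  moreover have "Pi\<^sub>E UNIV (\<lambda>i::'b. cball (0::complex) R) = {f. \<forall>x. cmod (f x) \<le> R}"
    by (auto simp: PiE_def)
  ultimately show ?thesis by (simp add: euclidean_product_topology compactin_euclidean_iff)
qed

text \<open>
  The functions \<open>\<phi> i\<close> are uniformly bounded by their values at \<open>0\<close>, so they have a cluster point in the
  product topology; all conditions involve finitely many points at a time and pass to the limit
  along the refined filter \<open>G\<close>.
\<close>

lemma dominated_limit:
  fixes u :: "'a::group_add \<Rightarrow> complex"
  assumes F: "F \<noteq> bot" and dom: "eventually (\<lambda>i. dominated (r i) (\<phi> i) (f i)) F"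
    and r: "(r \<longlongrightarrow> r0) F" and lim: "\<And>x. ((\<lambda>i. f i x) \<longlongrightarrow> u x) F"
  shows "\<exists>\<psi>. dominated r0 \<psi> u"
proof -
  have "eventually (\<lambda>i. r i < r0 + 1) F" using r by (rule order_tendstoD) simp
  with dom have "eventually (\<lambda>i. \<forall>x. cmod (\<phi> i x) \<le> r0 + 1) F"
  proof eventually_elim
    case (elim i)
    then have "cmod (\<phi> i x) \<le> Re (\<phi> i 0)" for x
      using pd_function_bound(1)[of "\<phi> i" x] by (simp add: dominated_def)
    then show ?case using elim unfolding dominated_def by (meson less_imp_le order_trans)
  qed
  then have "eventually (\<lambda>g. g \<in> {g. \<forall>x. cmod (g x) \<le> r0 + 1}) (filtermap \<phi> F)"
    by (simp add: eventually_filtermap)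
  then obtain \<psi> where \<psi>: "inf (nhds \<psi>) (filtermap \<phi> F) \<noteq> bot"
    using compact_bounded_functions[of "r0 + 1"] F unfolding compact_filter
    by (metis filtermap_bot_iff)
  define G where "G = inf F (filtercomap \<phi> (nhds \<psi>))"
  have G: "G \<noteq> bot"
  proof
    assume "G = bot"
    then have "eventually (\<lambda>_. False) (inf F (filtercomap \<phi> (nhds \<psi>)))" by (simp add: G_def)
    then obtain P Q where PQ: "eventually P F" "eventually Q (filtercomap \<phi> (nhds \<psi>))" "\<And>i. P i \<Longrightarrow> Q i \<Longrightarrow> False"
      unfolding eventually_inf by blast
    then obtain W where W: "eventually W (nhds \<psi>)" "\<And>i. W (\<phi> i) \<Longrightarrow> Q i"
      unfolding eventually_filtercomap by blast
    have "eventually (\<lambda>g. \<not> W g) (filtermap \<phi> F)"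
      unfolding eventually_filtermap using PQ(1) by eventually_elim (use PQ W in blast)
    then have "eventually (\<lambda>g. False) (inf (nhds \<psi>) (filtermap \<phi> F))"
      unfolding eventually_inf using W(1) by blast
    then show False using \<psi> by (simp add: eventually_False)
  qed
  have GF: "G \<le> F" by (simp add: G_def)
  have "filterlim \<phi> (nhds \<psi>) G"
    unfolding G_def by (rule filterlim_mono[OF filterlim_filtercomap]) auto
  moreover have "((\<lambda>g. g x) \<longlongrightarrow> \<psi> x) (nhds \<psi>)" for x
    using continuous_on_product_coordinates[where i = x]
      tendsto_at_iff_tendsto_nhds[of "\<lambda>g. g x" \<psi>] unfolding continuous_on_def by blast
  ultimately have \<phi>lim: "((\<lambda>i. \<phi> i x) \<longlongrightarrow> \<psi> x) G" for x
    by (rule filterlim_compose[rotated])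
  have r': "(r \<longlongrightarrow> r0) G" and lim': "((\<lambda>i. f i x) \<longlongrightarrow> u x) G" for x
    by (rule tendsto_mono[OF GF r], rule tendsto_mono[OF GF lim])
  have dom': "eventually (\<lambda>i. dominated (r i) (\<phi> i) (f i)) G" using dom GF by (rule filter_leD[rotated])
  have "dominated r0 \<psi> u"
    unfolding dominated_def
  proof (intro conjI)
    show "pd_kernel (\<lambda>x y. \<psi> (- y + x))"
      by (rule pd_kernel_limit[OF G, where K = "\<lambda>i x y. \<phi> i (- y + x)"])
        (use dom' \<phi>lim in \<open>auto simp: dominated_def elim: eventually_mono\<close>)
    show "pd_kernel (\<lambda>x y. complex_of_real r0 * \<psi> (- y + x) - u x * cnj (u y))"
    proof (rule pd_kernel_limit[OF G, where K = "\<lambda>i x y. complex_of_real (r i) * \<phi> i (- y + x) - f i x * cnj (f i y)"])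
      show "\<forall>\<^sub>F i in G. pd_kernel (\<lambda>x y. complex_of_real (r i) * \<phi> i (- y + x) - f i x * cnj (f i y))"
        using dom' by (auto simp: dominated_def elim: eventually_mono)
    qed (intro tendsto_intros r' lim' \<phi>lim)
    show "Re (\<psi> 0) \<le> r0"
      by (rule tendsto_le[OF G r' tendsto_Re[OF \<phi>lim]])
        (use dom' in \<open>auto simp: dominated_def elim: eventually_mono\<close>)
  qed
  then show ?thesis by blast
qed

context semi_inner_space
begin

lemma fin_ip_gram:
  assumes v: "\<And>x. v x \<in> V"
  shows "fin_ip (\<lambda>x y. ip (v x) (v y)) c c
    = ip (\<Sum>x | c x \<noteq> 0. scale (c x) (v x)) (\<Sum>x | c x \<noteq> 0. scale (c x) (v x))"
proof -
  have "ip (\<Sum>x | c x \<noteq> 0. scale (c x) (v x)) (\<Sum>x | c x \<noteq> 0. scale (c x) (v x))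
      = (\<Sum>x | c x \<noteq> 0. ip (scale (c x) (v x)) (\<Sum>x | c x \<noteq> 0. scale (c x) (v x)))"
    by (rule ip_sum_left) (auto intro: V_sum v)
  also have "\<dots> = (\<Sum>x | c x \<noteq> 0. \<Sum>y | c y \<noteq> 0. ip (scale (c x) (v x)) (scale (c y) (v y)))"
    by (intro sum.cong refl ip_sum_right) (auto intro: v)
  also have "\<dots> = fin_ip (\<lambda>x y. ip (v x) (v y)) c c"
    unfolding fin_ip_def using v by (simp add: ip_scale_left ip_scale_right mult_ac)
  finally show ?thesis by simp
qed

lemma pd_kernel_gram:
  assumes v: "\<And>x. v x \<in> V"
  shows "pd_kernel (\<lambda>x y. ip (v x) (v y))"
proof (rule pd_kernelI)
  show "ip (v y) (v x) = cnj (ip (v x) (v y))" for x y by (rule ip_commute[OF v v])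
  show "0 \<le> Re (fin_ip (\<lambda>x y. ip (v x) (v y)) c c)" for c
    unfolding fin_ip_gram[OF v] by (intro ip_nonneg V_sum V_closed v)
qed

end


section \<open>The reproducing kernel Hilbert space\<close>

locale kernel_space =
  fixes K :: "'b \<Rightarrow> 'b \<Rightarrow> complex"
  assumes pd: "pd_kernel K"

sublocale kernel_space \<subseteq> E: semi_inner_space cscale finsupp "fin_ip K"
  by (rule semi_inner_fin_ip[OF pd])

context kernel_space
begin

definition ev :: "('b \<Rightarrow> complex) \<Rightarrow> 'b \<Rightarrow> complex" where
  "ev c = (\<lambda>y. fin_ip K c (point y))"

text \<open>
  The completion of the finitely supported functions is realized as a space of functions on the index
  set: an abstract limit is identified with the pointwise limit of the functions \<open>ev (X n)\<close>.
\<close>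

definition represents :: "(nat \<Rightarrow> 'b \<Rightarrow> complex) \<Rightarrow> ('b \<Rightarrow> complex) \<Rightarrow> bool" where
  "represents X f \<longleftrightarrow> (\<forall>n. X n \<in> finsupp) \<and> E.cauchy_seq X \<and> (\<forall>y. (\<lambda>n. ev (X n) y) \<longlonglongrightarrow> f y)"

definition rkhs :: "('b \<Rightarrow> complex) set" where
  "rkhs = {f. \<exists>X. represents X f}"

definition rkhs_ip :: "('b \<Rightarrow> complex) \<Rightarrow> ('b \<Rightarrow> complex) \<Rightarrow> complex" where
  "rkhs_ip f g = lim (\<lambda>n. fin_ip K ((SOME X. represents X f) n) ((SOME X. represents X g) n))"

lemma ev_linear:
  assumes "c \<in> finsupp"
  shows "d \<in> finsupp \<Longrightarrow> ev (c + d) = ev c + ev d" "d \<in> finsupp \<Longrightarrow> ev (c - d) = ev c - ev d"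
    "ev (cscale a c) = cscale a (ev c)"
  using assms by (auto simp: ev_def fun_eq_iff point_finsupp E.ip_add_left E.ip_diff_left E.ip_scale_left)

lemma fin_ip_ev:
  assumes "c \<in> finsupp"
  shows "fin_ip K c d = (\<Sum>y | d y \<noteq> 0. cnj (d y) * ev c y)"
proof -
  have "fin_ip K c d = (\<Sum>y | d y \<noteq> 0. \<Sum>x | c x \<noteq> 0. c x * cnj (d y) * K x y)"
    unfolding fin_ip_def by (rule sum.swap)
  also have "\<dots> = (\<Sum>y | d y \<noteq> 0. cnj (d y) * ev c y)"
    unfolding ev_def fin_ip_point_right[OF assms] sum_distrib_left
    by (intro sum.cong refl) (simp add: mult_ac)
  finally show ?thesis .
qed

lemma cauchy_seq_const: "E.cauchy_seq (\<lambda>n. c)"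
  by (simp add: E.cauchy_seq_def)

lemma represents_const: "c \<in> finsupp \<Longrightarrow> represents (\<lambda>n. c) (ev c)"
  by (simp add: represents_def cauchy_seq_const)

lemma represents_scale:
  "represents X f \<Longrightarrow> represents (\<lambda>n. cscale a (X n)) (cscale a f)"
  unfolding represents_def
  by (auto simp: ev_linear E.cauchy_seq_scale finsupp_scale intro: tendsto_mult_left)

lemma represents_diff:
  assumes "represents X f" "represents Y g"
  shows "represents (\<lambda>n. X n - Y n) (f - g)"
  using assms unfolding represents_def
  by (auto simp: ev_linear E.cauchy_seq_diff intro: tendsto_diff)

lemma represents_add:
  assumes "represents X f" "represents Y g"
  shows "represents (\<lambda>n. X n + Y n) (f + g)"
proof -
  have m: "cscale (- 1) h = - h" for h :: "'b \<Rightarrow> complex" by (simp add: fun_eq_iff)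
  show ?thesis
    using represents_diff[OF assms(1) represents_scale[OF assms(2), of "-1"]] by (simp add: m)
qed

text \<open>
  This makes the completion well defined. If \<open>N\<close> is large then \<open>\<parallel>X n\<parallel>\<^sup>2 = \<langle>X n, X N\<rangle> + \<langle>X n, X n - X N\<rangle>\<close>,
  where the second term is small by the Cauchy property, and the first one tends to \<open>0\<close> because \<open>X N\<close> is
  a finite combination of point evaluations.
\<close>

lemma represents_null:
  assumes X: "represents X 0"
  shows "(\<lambda>n. E.nrm (X n)) \<longlonglongrightarrow> 0"
proof (rule LIMSEQ_I)
  fix e :: real assume e: "e > 0"
  have fs: "X n \<in> finsupp" for n using X by (auto simp: represents_def)
  have cau: "E.cauchy_seq X" using X by (auto simp: represents_def)
  obtain C where C: "C > 0" "\<And>n. E.nrm (X n) \<le> C" using E.cauchy_seq_bounded[OF fs cau] by blast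
  have "e\<^sup>2 / (2 * C) > 0" using e C by simp
  then obtain N where N: "\<And>m n. m \<ge> N \<Longrightarrow> n \<ge> N \<Longrightarrow> E.nrm (X m - X n) < e\<^sup>2 / (2 * C)"
    using cau unfolding E.cauchy_seq_def by meson
  have "(\<lambda>n. ev (X n) y) \<longlonglongrightarrow> 0" for y using X by (auto simp: represents_def)
  then have "(\<lambda>n. fin_ip K (X n) (X N)) \<longlonglongrightarrow> (\<Sum>y | X N y \<noteq> 0. cnj (X N y) * 0)"
    unfolding fin_ip_ev[OF fs] by (intro tendsto_intros)
  then have null: "(\<lambda>n. fin_ip K (X n) (X N)) \<longlonglongrightarrow> 0" by simp
  have "e\<^sup>2 / 2 > 0" using e by simp
  from LIMSEQ_D[OF null this]
  obtain M where M: "\<And>n. n \<ge> M \<Longrightarrow> cmod (fin_ip K (X n) (X N)) < e\<^sup>2 / 2" by auto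
  have "norm (E.nrm (X n) - 0) < e" if n: "n \<ge> max N M" for n
  proof -
    have "(E.nrm (X n))\<^sup>2 = Re (fin_ip K (X n) (X N)) + Re (fin_ip K (X n) (X n - X N))"
      using fs by (simp add: E.nrm_power2 E.ip_diff_right)
    moreover have "Re (fin_ip K (X n) (X N)) < e\<^sup>2 / 2"
      using M[of n] n complex_Re_le_cmod[of "fin_ip K (X n) (X N)"] by simp
    moreover have "Re (fin_ip K (X n) (X n - X N)) \<le> C * (e\<^sup>2 / (2 * C))"
    proof -
      have "cmod (fin_ip K (X n) (X n - X N)) \<le> E.nrm (X n) * E.nrm (X n - X N)"
        using fs by (intro E.cauchy_schwarz) auto
      also have "\<dots> \<le> C * (e\<^sup>2 / (2 * C))"
        using C N[of n N] n fs by (intro mult_mono) auto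
      finally show ?thesis using complex_Re_le_cmod order_trans by blast
    qed
    ultimately have "(E.nrm (X n))\<^sup>2 < e\<^sup>2" using C(1) by simp
    then have "E.nrm (X n) < e" by (rule power2_less_imp_less) (use e in simp)
    then show ?thesis using fs by simp
  qed
  then show "\<exists>no. \<forall>n\<ge>no. norm (E.nrm (X n) - 0) < e" by blast
qed

lemma represents_ip:
  assumes X: "represents X f" and Y: "represents Y g"
  shows "(\<lambda>n. fin_ip K (X n) (Y n)) \<longlonglongrightarrow> rkhs_ip f g"
proof -
  define X' where "X' = (SOME X. represents X f)"
  define Y' where "Y' = (SOME X. represents X g)"
  have X': "represents X' f" unfolding X'_def using X by (rule someI[where P = "\<lambda>X. represents X f"])
  have Y': "represents Y' g" unfolding Y'_def using Y by (rule someI[where P = "\<lambda>X. represents X g"])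
  have fs: "X n \<in> finsupp" "Y n \<in> finsupp" "X' n \<in> finsupp" "Y' n \<in> finsupp" for n
    using X Y X' Y' by (auto simp: represents_def)
  have nX: "(\<lambda>n. E.nrm (X n - X' n)) \<longlonglongrightarrow> 0" and nY: "(\<lambda>n. E.nrm (Y n - Y' n)) \<longlonglongrightarrow> 0"
    using represents_diff[OF X X'] represents_diff[OF Y Y'] by (auto intro: represents_null)
  have cau: "E.cauchy_seq X'" "E.cauchy_seq Y'" "E.cauchy_seq Y"
    using X' Y' Y by (auto simp: represents_def)
  obtain C where C: "C > 0" "\<And>n. E.nrm (X' n) \<le> C" using E.cauchy_seq_bounded[of X'] fs cau by blast
  obtain D where D: "D > 0" "\<And>n. E.nrm (Y n) \<le> D" using E.cauchy_seq_bounded[of Y] fs cau by blast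
  have "convergent (\<lambda>n. fin_ip K (X' n) (Y' n))"
    using E.ip_convergent[of X' Y'] fs cau by blast
  then have lim: "(\<lambda>n. fin_ip K (X' n) (Y' n)) \<longlonglongrightarrow> rkhs_ip f g"
    unfolding rkhs_ip_def X'_def[symmetric] Y'_def[symmetric] by (simp add: convergent_LIMSEQ_iff)
  have "(\<lambda>n. fin_ip K (X n) (Y n) - fin_ip K (X' n) (Y' n)) \<longlonglongrightarrow> 0"
  proof (rule Lim_null_comparison)
    show "\<forall>\<^sub>F n in sequentially. norm (fin_ip K (X n) (Y n) - fin_ip K (X' n) (Y' n)) \<le>
      E.nrm (X n - X' n) * D + C * E.nrm (Y n - Y' n)"
    proof (rule always_eventually, rule allI)
      fix n
      have "fin_ip K (X n) (Y n) - fin_ip K (X' n) (Y' n)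
          = fin_ip K (X n - X' n) (Y n) + fin_ip K (X' n) (Y n - Y' n)"
        using fs by (simp add: E.ip_diff_left E.ip_diff_right)
      then have "cmod (fin_ip K (X n) (Y n) - fin_ip K (X' n) (Y' n))
          \<le> E.nrm (X n - X' n) * E.nrm (Y n) + E.nrm (X' n) * E.nrm (Y n - Y' n)"
        using E.cauchy_schwarz[of "X n - X' n" "Y n"] E.cauchy_schwarz[of "X' n" "Y n - Y' n"] fs
          norm_triangle_ineq[of "fin_ip K (X n - X' n) (Y n)" "fin_ip K (X' n) (Y n - Y' n)"]
        by simp
      also have "\<dots> \<le> E.nrm (X n - X' n) * D + C * E.nrm (Y n - Y' n)"
        using C(2)[of n] D(2)[of n] fs by (intro add_mono mult_left_mono mult_right_mono) auto
      finally show "norm (fin_ip K (X n) (Y n) - fin_ip K (X' n) (Y' n)) \<le>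
        E.nrm (X n - X' n) * D + C * E.nrm (Y n - Y' n)" .
    qed
    have "(\<lambda>n. E.nrm (X n - X' n) * D + C * E.nrm (Y n - Y' n)) \<longlonglongrightarrow> 0 * D + C * 0"
      by (intro tendsto_intros nX nY)
    then show "(\<lambda>n. E.nrm (X n - X' n) * D + C * E.nrm (Y n - Y' n)) \<longlonglongrightarrow> 0" by simp
  qed
  from tendsto_add[OF this lim] show ?thesis by simp
qed

lemma ev_rkhs: "c \<in> finsupp \<Longrightarrow> ev c \<in> rkhs"
  using represents_const by (auto simp: rkhs_def)

lemma rkhs_ip_eqI: "\<lbrakk>represents X f; represents Y g; (\<lambda>n. fin_ip K (X n) (Y n)) \<longlonglongrightarrow> L\<rbrakk> \<Longrightarrow> rkhs_ip f g = L"
  using represents_ip LIMSEQ_unique by blast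

lemma rkhs_ip_ev: "c \<in> finsupp \<Longrightarrow> d \<in> finsupp \<Longrightarrow> rkhs_ip (ev c) (ev d) = fin_ip K c d"
  by (rule rkhs_ip_eqI[OF represents_const represents_const]) auto

lemma rkhs_ip_ev_right:
  assumes "f \<in> rkhs" "d \<in> finsupp"
  shows "rkhs_ip f (ev d) = (\<Sum>y | d y \<noteq> 0. cnj (d y) * f y)"
proof -
  obtain X where X: "represents X f" using assms by (auto simp: rkhs_def)
  have fs: "X n \<in> finsupp" for n using X by (auto simp: represents_def)
  show ?thesis
    by (rule rkhs_ip_eqI[OF X represents_const[OF assms(2)]], unfold fin_ip_ev[OF fs])
      (use X in \<open>auto simp: represents_def intro!: tendsto_intros\<close>)
qed

lemma rkhs_ip_point: "f \<in> rkhs \<Longrightarrow> rkhs_ip f (ev (point y)) = f y"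
  by (subst rkhs_ip_ev_right) (simp_all add: point_finsupp, simp add: point_def)

lemma semi_inner_rkhs: "semi_inner_space cscale rkhs rkhs_ip"
proof -
  interpret vector_space "cscale :: complex \<Rightarrow> ('b \<Rightarrow> complex) \<Rightarrow> 'b \<Rightarrow> complex"
    by (rule vector_space_cscale)
  have fs: "X n \<in> finsupp" if "represents X f" for X f n using that by (auto simp: represents_def)
  show ?thesis
  proof
    have "ev 0 = 0" by (simp add: fun_eq_iff ev_def fin_ip_def)
    then have "0 \<in> rkhs" using ev_rkhs[OF finsupp_zero] by simp
    then show "module.subspace cscale rkhs"
      unfolding subspace_cscale_iff by (auto simp: rkhs_def intro: represents_add represents_scale)
    fix u v w assume "u \<in> rkhs" "v \<in> rkhs" "w \<in> rkhs"
    then obtain X Y Z where R: "represents X u" "represents Y v" "represents Z w" by (auto simp: rkhs_def)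
    show "rkhs_ip (u + v) w = rkhs_ip u w + rkhs_ip v w"
      by (rule rkhs_ip_eqI[OF represents_add[OF R(1,2)] R(3)])
        (simp add: E.ip_add_left fs[OF R(1)] fs[OF R(2)] fs[OF R(3)] tendsto_add represents_ip R)
  next
    fix v w c assume "v \<in> rkhs" "w \<in> rkhs"
    then obtain Y Z where R: "represents Y v" "represents Z w" by (auto simp: rkhs_def)
    show "rkhs_ip (cscale c v) w = c * rkhs_ip v w"
      by (rule rkhs_ip_eqI[OF represents_scale[OF R(1)] R(2)])
        (simp add: E.ip_scale_left fs[OF R(1)] fs[OF R(2)] tendsto_mult_left represents_ip R)
    have "fin_ip K (Z n) (Y n) = cnj (fin_ip K (Y n) (Z n))" for n
      using E.ip_commute[of "Y n" "Z n"] fs[OF R(1)] fs[OF R(2)] by blast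
    then show "rkhs_ip w v = cnj (rkhs_ip v w)"
      by (intro rkhs_ip_eqI[OF R(2,1)]) (simp only: tendsto_cnj represents_ip R)
  next
    fix v assume "v \<in> rkhs"
    then obtain Y where R: "represents Y v" by (auto simp: rkhs_def)
    show "0 \<le> Re (rkhs_ip v v)"
      by (rule LIMSEQ_le_const[OF tendsto_Re[OF represents_ip[OF R R]]])
        (use E.ip_nonneg fs[OF R] in auto)
  qed
qed

sublocale H: semi_inner_space cscale rkhs rkhs_ip by (rule semi_inner_rkhs)

lemma nrm_ev: "c \<in> finsupp \<Longrightarrow> H.nrm (ev c) = E.nrm c"
  by (simp add: hnorm_def rkhs_ip_ev)

lemma nrm_ev_diff: "c \<in> finsupp \<Longrightarrow> d \<in> finsupp \<Longrightarrow> H.nrm (ev c - ev d) = E.nrm (c - d)"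
  using nrm_ev[of "c - d"] by (simp add: ev_linear E.V_closed)

lemma represents_approx:
  assumes X: "represents X f"
  shows "(\<lambda>m. H.nrm (ev (X m) - f)) \<longlonglongrightarrow> 0"
proof (rule LIMSEQ_I)
  fix e :: real assume e: "e > 0"
  have fs: "X n \<in> finsupp" for n using X by (auto simp: represents_def)
  have f: "f \<in> rkhs" using X by (auto simp: rkhs_def)
  have cau: "E.cauchy_seq X" using X by (auto simp: represents_def)
  obtain N where N: "\<And>m n. m \<ge> N \<Longrightarrow> n \<ge> N \<Longrightarrow> E.nrm (X m - X n) < e / 2"
    using cau e unfolding E.cauchy_seq_def by (meson half_gt_zero)
  have "norm (H.nrm (ev (X m) - f) - 0) < e" if m: "m \<ge> N" for m
  proof -
    have R: "represents (\<lambda>n. X m - X n) (ev (X m) - f)"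
      by (rule represents_diff[OF represents_const[OF fs] X])
    have "(\<lambda>n. Re (fin_ip K (X m - X n) (X m - X n))) \<longlonglongrightarrow> Re (rkhs_ip (ev (X m) - f) (ev (X m) - f))"
      by (rule tendsto_Re[OF represents_ip[OF R R]])
    moreover have "\<forall>\<^sub>F n in sequentially. Re (fin_ip K (X m - X n) (X m - X n)) \<le> (e/2)\<^sup>2"
    proof (rule eventually_sequentiallyI)
      fix n assume "n \<ge> N"
      then have "(E.nrm (X m - X n))\<^sup>2 \<le> (e/2)\<^sup>2" using N[OF m, of n] fs by (intro power_mono) auto
      then show "Re (fin_ip K (X m - X n) (X m - X n)) \<le> (e/2)\<^sup>2" using fs by (simp add: E.nrm_power2)
    qed
    ultimately have "Re (rkhs_ip (ev (X m) - f) (ev (X m) - f)) \<le> (e/2)\<^sup>2"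
      by (intro tendsto_upperbound) auto
    then have "(H.nrm (ev (X m) - f))\<^sup>2 \<le> (e/2)\<^sup>2" using ev_rkhs[OF fs] f by (simp add: H.nrm_power2)
    then have "H.nrm (ev (X m) - f) \<le> e/2" by (rule power2_le_imp_le) (use e in simp)
    moreover have "0 \<le> H.nrm (ev (X m) - f)" using ev_rkhs[OF fs] f by simp
    ultimately show ?thesis using e by simp
  qed
  then show "\<exists>no. \<forall>m\<ge>no. norm (H.nrm (ev (X m) - f) - 0) < e" by blast
qed

lemma ev_dense:
  assumes "f \<in> rkhs" "e > 0"
  obtains c where "c \<in> finsupp" "H.nrm (f - ev c) < e"
proof -
  obtain X where X: "represents X f" using assms by (auto simp: rkhs_def)
  have fs: "X n \<in> finsupp" for n using X by (auto simp: represents_def)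
  obtain n where "norm (H.nrm (ev (X n) - f) - 0) < e"
    using LIMSEQ_D[OF represents_approx[OF X] assms(2)] by blast
  then have "H.nrm (f - ev (X n)) < e"
    using H.nrm_diff_commute[of f "ev (X n)"] assms ev_rkhs[OF fs] by simp
  then show ?thesis using that fs by blast
qed

text \<open>
  For completeness, a Cauchy sequence is replaced by nearby elements of the dense image of the finitely
  supported functions; these form a Cauchy sequence there and define the limit.
\<close>

lemma hilbert_rkhs: "complex_hilbert_space cscale rkhs rkhs_ip"
proof
  show "module.subspace cscale rkhs" by (rule H.subspace_V)
  show "rkhs_ip (u + v) w = rkhs_ip u w + rkhs_ip v w" if "u \<in> rkhs" "v \<in> rkhs" "w \<in> rkhs" for u v w
    using that by (rule H.ip_add_left)
  show "rkhs_ip (cscale c v) w = c * rkhs_ip v w" if "v \<in> rkhs" "w \<in> rkhs" for c v w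
    using that by (rule H.ip_scale_left)
  show "rkhs_ip w v = cnj (rkhs_ip v w)" if "v \<in> rkhs" "w \<in> rkhs" for v w
    using that by (rule H.ip_commute)
  show "0 < Re (rkhs_ip v v)" if v: "v \<in> rkhs" "v \<noteq> 0" for v
  proof (rule ccontr)
    assume "\<not> ?thesis"
    then have "H.nrm v = 0" using H.ip_nonneg[OF v(1)] by (simp add: hnorm_def)
    then have "cmod (v y) \<le> 0" for y
      using H.cauchy_schwarz[OF v(1) ev_rkhs[OF point_finsupp[of y]]] by (simp add: rkhs_ip_point v)
    then show False using v(2) by (auto simp: fun_eq_iff)
  qed
  fix F :: "nat \<Rightarrow> 'b \<Rightarrow> complex"
  assume F: "\<And>n. F n \<in> rkhs"
    and cF: "\<And>e. e > 0 \<Longrightarrow> \<exists>N. \<forall>m\<ge>N. \<forall>n\<ge>N. H.nrm (F m - F n) < e"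
  have "\<exists>c. c \<in> finsupp \<and> H.nrm (F n - ev c) < 1 / real (Suc n)" for n
    using ev_dense[OF F, of "1 / real (Suc n)" n] by auto
  then obtain c where c: "\<And>n. c n \<in> finsupp" "\<And>n. H.nrm (F n - ev (c n)) < 1 / real (Suc n)" by metis
  note evc = ev_rkhs[OF c(1)]
  have cau: "E.cauchy_seq c"
    unfolding E.cauchy_seq_def
  proof (intro allI impI)
    fix e :: real assume "e > 0"
    then have e3: "e / 3 > 0" by simp
    obtain N where N: "\<And>m n. m \<ge> N \<Longrightarrow> n \<ge> N \<Longrightarrow> H.nrm (F m - F n) < e / 3" using cF[OF e3] by blast
    obtain M where M: "1 / real (Suc M) < e / 3" using nat_approx_posE[OF e3] by blast
    have small: "H.nrm (F n - ev (c n)) < e / 3" if "n \<ge> M" for n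
    proof -
      have "1 / real (Suc n) \<le> 1 / real (Suc M)" using that by (intro divide_left_mono) auto
      then show ?thesis using c(2)[of n] M by linarith
    qed
    have "E.nrm (c m - c n) < e" if "m \<ge> max M N" "n \<ge> max M N" for m n
    proof -
      have "H.nrm (ev (c m) - ev (c n)) \<le> H.nrm (ev (c m) - F m) + H.nrm (F m - ev (c n))"
        using F evc by (intro H.nrm_triangle_diff) auto
      also have "H.nrm (F m - ev (c n)) \<le> H.nrm (F m - F n) + H.nrm (F n - ev (c n))"
        using F evc by (intro H.nrm_triangle_diff) auto
      also have "H.nrm (ev (c m) - F m) = H.nrm (F m - ev (c m))"
        using F evc by (intro H.nrm_diff_commute) auto
      finally have "H.nrm (ev (c m) - ev (c n)) < e"
        using small[of m] small[of n] N[of m n] that by linarith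
      then show ?thesis using c(1) by (simp add: nrm_ev_diff)
    qed
    then show "\<exists>N. \<forall>m\<ge>N. \<forall>n\<ge>N. E.nrm (c m - c n) < e" by blast
  qed
  have "\<exists>L. (\<lambda>n. ev (c n) y) \<longlonglongrightarrow> L" for y
    using E.ip_convergent[of c "\<lambda>n. point y"] c(1) cau cauchy_seq_const
    by (auto simp: ev_def point_finsupp convergent_def)
  then obtain f where f: "\<And>y. (\<lambda>n. ev (c n) y) \<longlonglongrightarrow> f y" by metis
  have R: "represents c f" using c(1) cau f by (auto simp: represents_def)
  then have frkhs: "f \<in> rkhs" by (auto simp: rkhs_def)
  have "(\<lambda>n. H.nrm (F n - f)) \<longlonglongrightarrow> 0"
  proof (rule Lim_null_comparison)
    show "\<forall>\<^sub>F n in sequentially. norm (H.nrm (F n - f)) \<le> 1 / real (Suc n) + H.nrm (ev (c n) - f)"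
    proof (rule always_eventually, rule allI)
      fix n
      have "H.nrm (F n - f) \<le> H.nrm (F n - ev (c n)) + H.nrm (ev (c n) - f)"
        using F evc frkhs by (intro H.nrm_triangle_diff) auto
      then show "norm (H.nrm (F n - f)) \<le> 1 / real (Suc n) + H.nrm (ev (c n) - f)"
        using c(2)[of n] F frkhs by simp
    qed
    have "(\<lambda>n. 1 / real (Suc n) + H.nrm (ev (c n) - f)) \<longlonglongrightarrow> 0 + 0"
      using LIMSEQ_inverse_real_of_nat by (intro tendsto_add represents_approx[OF R]) (simp add: field_simps)
    then show "(\<lambda>n. 1 / real (Suc n) + H.nrm (ev (c n) - f)) \<longlonglongrightarrow> 0" by simp
  qed
  then show "\<exists>v\<in>rkhs. (\<lambda>n. H.nrm (F n - v)) \<longlonglongrightarrow> 0" using frkhs by blast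
qed

end


section \<open>Coefficients and the norm of the Fourier--Stieltjes algebra\<close>

definition translate :: "'a::group_add \<Rightarrow> ('a \<Rightarrow> 'c) \<Rightarrow> 'a \<Rightarrow> 'c" where
  "translate z f = (\<lambda>y. f (- z + y))"

lemma translate_apply: "translate z f y = f (- z + y)"
  by (simp add: translate_def)

lemma translate_zero: "translate 0 f = f"
  by (simp add: translate_def)

lemma translate_plus: "translate (x + y) f = translate x (translate y f)"
  by (simp only: translate_def minus_add add.assoc)

lemma translate_add: "translate z (f + g) = translate z f + translate z g"
  by (simp add: translate_def fun_eq_iff)

lemma translate_diff: "translate z (f - g) = translate z f - translate z g"
  by (simp add: translate_def fun_eq_iff)

lemma translate_cscale: "translate z (cscale a f) = cscale a (translate z f)"
  by (simp add: translate_def fun_eq_iff)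

lemma translate_point: "translate z (point a) = point (z + a)"
  by (auto simp: translate_def point_def fun_eq_iff add.assoc[symmetric])

lemma translate_support: "{x. translate z c x \<noteq> 0} = (+) z ` {x. c x \<noteq> 0}"
proof (intro set_eqI iffI)
  fix x assume "x \<in> {x. translate z c x \<noteq> 0}"
  then show "x \<in> (+) z ` {x. c x \<noteq> 0}"
    by (intro image_eqI[of _ _ "- z + x"]) (simp_all add: translate_def add.assoc[symmetric])
qed (auto simp: translate_def add.assoc[symmetric])

lemma translate_finsupp: "c \<in> finsupp \<Longrightarrow> translate z c \<in> finsupp"
  unfolding finsupp_iff translate_support by (rule finite_imageI)

lemma fin_lin_translate: "fin_lin u (translate z c) = fin_lin (\<lambda>x. u (z + x)) c"
  unfolding fin_lin_def translate_support
  by (subst sum.reindex) (auto simp: translate_def add.assoc[symmetric])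

lemma fin_ip_translate:
  assumes "\<And>x y. K (z + x) (z + y) = K x y"
  shows "fin_ip K (translate z c) (translate z d) = fin_ip K c d"
  unfolding fin_ip_def translate_support
  by (subst (1 2) sum.reindex) (auto simp: translate_def add.assoc[symmetric] assms)

locale pd_function =
  fixes \<phi> :: "'a::{topological_group_add,t2_space} \<Rightarrow> complex"
  assumes pd_\<phi>: "pd_kernel (\<lambda>x y. \<phi> (- y + x))"

sublocale pd_function \<subseteq> kernel_space "\<lambda>x y. \<phi> (- y + x)"
  by unfold_locales (rule pd_\<phi>)

context pd_function
begin

abbreviation B :: "('a \<Rightarrow> complex) \<Rightarrow> ('a \<Rightarrow> complex) \<Rightarrow> complex" where
  "B \<equiv> fin_ip (\<lambda>x y. \<phi> (- y + x))"

lemma B_translate: "B (translate z c) (translate z d) = B c d"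
  by (rule fin_ip_translate) (simp only: minus_add add.assoc minus_add_cancel)

lemma nrm_translate: "E.nrm (translate z c) = E.nrm c"
  by (simp add: hnorm_def B_translate)

lemma ev_translate: "ev (translate z c) = translate z (ev c)"
proof
  fix y
  have "point y = translate z (point (- z + y))" by (simp add: translate_point add.assoc[symmetric])
  then show "ev (translate z c) y = translate z (ev c) y"
    by (simp add: ev_def B_translate translate_apply)
qed

lemma represents_translate:
  "represents X f \<Longrightarrow> represents (\<lambda>n. translate z (X n)) (translate z f)"
  unfolding represents_def E.cauchy_seq_def
  by (simp add: translate_finsupp ev_translate translate_diff[symmetric] nrm_translate)
    (simp add: translate_apply)

lemma translate_rkhs: "f \<in> rkhs \<Longrightarrow> translate z f \<in> rkhs"
  by (auto simp: rkhs_def intro: represents_translate)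

lemma rkhs_ip_translate:
  assumes "f \<in> rkhs" "g \<in> rkhs"
  shows "rkhs_ip (translate z f) (translate z g) = rkhs_ip f g"
proof -
  obtain X Y where R: "represents X f" "represents Y g" using assms by (auto simp: rkhs_def)
  show ?thesis
    by (rule rkhs_ip_eqI[OF R[THEN represents_translate]]) (simp add: B_translate represents_ip R)
qed

lemma hnorm_translate: "f \<in> rkhs \<Longrightarrow> H.nrm (translate z f) = H.nrm f"
  by (simp add: hnorm_def rkhs_ip_translate)

lemma rkhs_ip_translate_left:
  assumes "f \<in> rkhs" "g \<in> rkhs"
  shows "rkhs_ip (translate z f) g = rkhs_ip f (translate (- z) g)"
  using rkhs_ip_translate[of f "translate (- z) g" z] assms
  by (simp add: translate_rkhs translate_plus[symmetric] translate_zero)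

text \<open>
  The vectors with continuous orbit. They form a closed invariant subspace, on which the action by
  translations is a continuous unitary representation even if \<open>\<phi>\<close> is discontinuous.
\<close>

definition continuous_vectors :: "('a \<Rightarrow> complex) set" where
  "continuous_vectors = {f \<in> rkhs. ((\<lambda>x. H.nrm (translate x f - f)) \<longlongrightarrow> 0) (nhds 0)}"

lemma continuous_vectors_subset: "continuous_vectors \<subseteq> rkhs"
  by (auto simp: continuous_vectors_def)

lemma translate_conjugate_tendsto: "((\<lambda>x. - y + x + y) \<longlongrightarrow> (0::'a)) (nhds 0)"
proof -
  have "((\<lambda>x. - y + x + y) \<longlongrightarrow> - y + 0 + y) (nhds 0)"
    by (intro tendsto_intros filterlim_ident)
  then show ?thesis by simp
qed

lemma translate_continuous_vectors: "f \<in> continuous_vectors \<Longrightarrow> translate y f \<in> continuous_vectors"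
proof -
  assume f: "f \<in> continuous_vectors"
  have eq: "H.nrm (translate x (translate y f) - translate y f) = H.nrm (translate (- y + x + y) f - f)" for x
  proof -
    have "translate x (translate y f) - translate y f = translate y (translate (- y + x + y) f - f)"
      by (simp add: translate_diff translate_plus[symmetric] add.assoc[symmetric])
    then show ?thesis
      using f continuous_vectors_subset by (simp add: hnorm_translate translate_rkhs subset_iff)
  qed
  have "((\<lambda>x. H.nrm (translate (- y + x + y) f - f)) \<longlongrightarrow> 0) (nhds 0)"
    by (rule filterlim_compose[where g = "\<lambda>x. H.nrm (translate x f - f)", OF _ translate_conjugate_tendsto])
      (use f in \<open>simp add: continuous_vectors_def\<close>)
  then show ?thesis using f by (simp add: continuous_vectors_def translate_rkhs eq)
qed

lemma continuous_vectors_subspace: "module.subspace cscale continuous_vectors"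
  unfolding subspace_cscale_iff
proof (intro conjI ballI allI)
  have "translate x 0 - 0 = (0 :: 'a \<Rightarrow> complex)" for x by (simp add: fun_eq_iff translate_def)
  then show "0 \<in> continuous_vectors" by (simp add: continuous_vectors_def)
next
  fix f g assume f: "f \<in> continuous_vectors" and g: "g \<in> continuous_vectors"
  then have rkhs: "f \<in> rkhs" "g \<in> rkhs" by (auto simp: continuous_vectors_def)
  have "((\<lambda>x. H.nrm (translate x (f + g) - (f + g))) \<longlongrightarrow> 0) (nhds 0)"
  proof (rule Lim_null_comparison)
    show "\<forall>\<^sub>F x in nhds 0. norm (H.nrm (translate x (f + g) - (f + g)))
        \<le> H.nrm (translate x f - f) + H.nrm (translate x g - g)"
    proof (rule always_eventually, rule allI)
      fix x
      have eq: "translate x (f + g) - (f + g) = (translate x f - f) + (translate x g - g)"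
        by (simp add: translate_add)
      have V: "translate x f - f \<in> rkhs" "translate x g - g \<in> rkhs" using rkhs by (simp_all add: translate_rkhs)
      show "norm (H.nrm (translate x (f + g) - (f + g)))
        \<le> H.nrm (translate x f - f) + H.nrm (translate x g - g)"
        unfolding eq using H.nrm_triangle[OF V] H.nrm_nonneg[OF H.V_closed(2)[OF V]] by simp
    qed
    show "((\<lambda>x. H.nrm (translate x f - f) + H.nrm (translate x g - g)) \<longlongrightarrow> 0) (nhds 0)"
      using f g by (intro tendsto_add_zero) (auto simp: continuous_vectors_def)
  qed
  then show "f + g \<in> continuous_vectors" using rkhs by (simp add: continuous_vectors_def)
next
  fix f a assume f: "f \<in> continuous_vectors"
  then have rkhs: "f \<in> rkhs" by (auto simp: continuous_vectors_def)
  have "H.nrm (translate x (cscale a f) - cscale a f) = cmod a * H.nrm (translate x f - f)" for x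
  proof -
    have "translate x (cscale a f) - cscale a f = cscale a (translate x f - f)"
      by (simp add: fun_eq_iff translate_def algebra_simps)
    then show ?thesis using rkhs by (simp add: H.nrm_scale translate_rkhs)
  qed
  then show "cscale a f \<in> continuous_vectors"
    using f rkhs by (auto simp: continuous_vectors_def intro: tendsto_mult_right_zero)
qed

lemma continuous_vectors_closed:
  assumes "\<And>n. f n \<in> continuous_vectors" "g \<in> rkhs" "(\<lambda>n. H.nrm (f n - g)) \<longlonglongrightarrow> 0"
  shows "g \<in> continuous_vectors"
proof -
  have f: "f n \<in> rkhs" for n using assms(1) continuous_vectors_subset by auto
  have "((\<lambda>x. H.nrm (translate x g - g)) \<longlongrightarrow> 0) (nhds 0)"
  proof (rule tendstoI)
    fix e :: real assume "e > 0"
    then have e3: "e / 3 > 0" by simp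
    from LIMSEQ_D[OF assms(3) e3] obtain n where n: "norm (H.nrm (f n - g) - 0) < e / 3" by auto
    have "((\<lambda>x. H.nrm (translate x (f n) - f n)) \<longlongrightarrow> 0) (nhds 0)" using assms(1) by (auto simp: continuous_vectors_def)
    from order_tendstoD(2)[OF this e3]
    show "\<forall>\<^sub>F x in nhds 0. dist (H.nrm (translate x g - g)) 0 < e"
    proof eventually_elim
      case (elim x)
      have "H.nrm (translate x g - g) \<le> H.nrm (translate x g - translate x (f n)) + H.nrm (translate x (f n) - g)"
        using f assms(2) by (intro H.nrm_triangle_diff translate_rkhs) auto
      moreover have "H.nrm (translate x (f n) - g) \<le> H.nrm (translate x (f n) - f n) + H.nrm (f n - g)"
        using f assms(2) by (intro H.nrm_triangle_diff translate_rkhs) auto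
      moreover have "H.nrm (translate x g - translate x (f n)) = H.nrm (f n - g)"
        using f assms(2) H.nrm_diff_commute[of g "f n"]
        by (simp add: translate_diff[symmetric] hnorm_translate)
      ultimately have "H.nrm (translate x g - g) < e" using elim n by simp
      then show ?case using assms(2) by (simp add: translate_rkhs)
    qed
  qed
  then show ?thesis using assms(2) by (simp add: continuous_vectors_def)
qed

lemma continuous_rep_continuous_vectors: "continuous_unitary_rep cscale continuous_vectors rkhs_ip translate"
proof -
  interpret HH: complex_hilbert_space cscale rkhs rkhs_ip by (rule hilbert_rkhs)
  note in_rkhs = subsetD[OF continuous_vectors_subset]
  show ?thesis
  proof
    show "module.subspace cscale continuous_vectors" by (rule continuous_vectors_subspace)
    show "rkhs_ip (u + v) w = rkhs_ip u w + rkhs_ip v w" if "u \<in> continuous_vectors" "v \<in> continuous_vectors" "w \<in> continuous_vectors" for u v w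
      using that by (intro H.ip_add_left in_rkhs)
    show "rkhs_ip (cscale c v) w = c * rkhs_ip v w" if "v \<in> continuous_vectors" "w \<in> continuous_vectors" for c v w
      using that by (intro H.ip_scale_left in_rkhs)
    show "rkhs_ip w v = cnj (rkhs_ip v w)" if "v \<in> continuous_vectors" "w \<in> continuous_vectors" for v w
      using that by (intro H.ip_commute in_rkhs)
    show "0 < Re (rkhs_ip v v)" if v: "v \<in> continuous_vectors" "v \<noteq> 0" for v
      using that by (intro HH.ip_pos in_rkhs)
    show "\<exists>v\<in>continuous_vectors. (\<lambda>n. H.nrm (X n - v)) \<longlonglongrightarrow> 0"
      if X: "\<And>n. X n \<in> continuous_vectors" and c: "\<And>e. e > 0 \<Longrightarrow> \<exists>N. \<forall>m\<ge>N. \<forall>n\<ge>N. H.nrm (X m - X n) < e"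
      for X :: "nat \<Rightarrow> 'a \<Rightarrow> complex"
    proof -
      obtain v where v: "v \<in> rkhs" "(\<lambda>n. H.nrm (X n - v)) \<longlonglongrightarrow> 0"
        using HH.complete_V[of X, OF in_rkhs[OF X] c] by blast
      then show ?thesis using continuous_vectors_closed[of X v] X by blast
    qed
    show "translate x v \<in> continuous_vectors" if "v \<in> continuous_vectors" for x v using that by (rule translate_continuous_vectors)
    show "translate x (v + w) = translate x v + translate x w" for x and v w :: "'a \<Rightarrow> complex"
      by (rule translate_add)
    show "translate x (cscale c v) = cscale c (translate x v)" for x c and v :: "'a \<Rightarrow> complex"
      by (rule translate_cscale)
    show "rkhs_ip (translate x v) (translate x w) = rkhs_ip v w" if "v \<in> continuous_vectors" "w \<in> continuous_vectors" for x v w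
      using that by (intro rkhs_ip_translate in_rkhs)
    show "translate 0 v = v" for v :: "'a \<Rightarrow> complex" by (rule translate_zero)
    show "translate (x + y) v = translate x (translate y v)" for x y and v :: "'a \<Rightarrow> complex"
      by (rule translate_plus)
    show "((\<lambda>x. H.nrm (translate x v - translate y v)) \<longlongrightarrow> 0) (at y)" if v: "v \<in> continuous_vectors" for v y
    proof -
      have eq: "H.nrm (translate x v - translate y v) = H.nrm (translate (- y + x) v - v)" for x
      proof -
        have "translate x v - translate y v = translate y (translate (- y + x) v - v)"
          by (simp add: translate_diff translate_plus[symmetric] add.assoc[symmetric])
        then show ?thesis using in_rkhs[OF v] by (simp add: hnorm_translate translate_rkhs)
      qed
      have "((\<lambda>x. - y + x) \<longlongrightarrow> - y + y) (at y)" by (intro tendsto_intros)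
      then have lim: "((\<lambda>x. - y + x) \<longlongrightarrow> 0) (at y)" by simp
      have "((\<lambda>x. H.nrm (translate (- y + x) v - v)) \<longlongrightarrow> 0) (at y)"
        by (rule filterlim_compose[where g = "\<lambda>x. H.nrm (translate x v - v)", OF _ lim])
          (use v in \<open>simp add: continuous_vectors_def\<close>)
      then show ?thesis by (simp add: eq)
    qed
  qed
qed

text \<open>
  Bounded functionals on the finitely supported functions are represented by functions in the
  completion; evaluating the approximating sequence at points shows which function it is.
\<close>

lemma riesz_kernel:
  assumes "\<And>c. c \<in> finsupp \<Longrightarrow> cmod (fin_lin u c) \<le> A * E.nrm c"
  shows "(\<lambda>x. cnj (u x)) \<in> rkhs"
    and "c \<in> finsupp \<Longrightarrow> rkhs_ip (ev c) (\<lambda>x. cnj (u x)) = fin_lin u c"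
proof -
  obtain X where X: "\<And>n::nat. X n \<in> finsupp" "E.cauchy_seq X"
    "\<And>w. w \<in> finsupp \<Longrightarrow> (\<lambda>n. B w (X n)) \<longlonglongrightarrow> fin_lin u w"
    using E.riesz_approx[of "fin_lin u" A, OF fin_lin_add fin_lin_scale assms] by blast
  have "(\<lambda>n. ev (X n) y) \<longlonglongrightarrow> cnj (u y)" for y
  proof -
    have "(\<lambda>n. cnj (B (point y) (X n))) \<longlonglongrightarrow> cnj (fin_lin u (point y))"
      by (intro tendsto_intros X(3) point_finsupp)
    moreover have "cnj (B (point y) (X n)) = ev (X n) y" for n
      unfolding ev_def using E.ip_commute[OF point_finsupp[of y] X(1)[of n]] by simp
    ultimately show ?thesis by (simp add: fin_lin_point)
  qed
  then have R: "represents X (\<lambda>x. cnj (u x))" using X(1,2) by (auto simp: represents_def)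
  then show "(\<lambda>x. cnj (u x)) \<in> rkhs" by (auto simp: rkhs_def)
  show "rkhs_ip (ev c) (\<lambda>x. cnj (u x)) = fin_lin u c" if "c \<in> finsupp"
    using that by (intro rkhs_ip_eqI[OF represents_const R] X(3))
qed

lemma rkhs_ip_dense_bound:
  assumes g: "g \<in> rkhs" and "A \<ge> 0" and bd: "\<And>c. c \<in> finsupp \<Longrightarrow> cmod (rkhs_ip (ev c) g) \<le> A * H.nrm (ev c)"
  shows "H.nrm g \<le> A"
proof -
  obtain X where X: "represents X g" using g by (auto simp: rkhs_def)
  have fs: "X n \<in> finsupp" for n using X by (auto simp: represents_def)
  note lim = represents_approx[OF X]
  have evX: "ev (X n) \<in> rkhs" for n using ev_rkhs fs by blast
  have 1: "(\<lambda>n. cmod (rkhs_ip (ev (X n)) g)) \<longlonglongrightarrow> cmod (rkhs_ip g g)"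
    by (intro tendsto_norm H.ip_tendsto evX g lim) simp
  have 2: "(\<lambda>n. H.nrm (ev (X n))) \<longlonglongrightarrow> H.nrm g"
  proof -
    have "(\<lambda>n. H.nrm (ev (X n)) - H.nrm g) \<longlonglongrightarrow> 0"
      by (rule Lim_null_comparison[OF _ lim]) (use H.nrm_triangle_ineq3[OF evX g] in auto)
    then show ?thesis by (simp add: LIM_zero_iff)
  qed
  have "cmod (rkhs_ip g g) \<le> A * H.nrm g"
    by (rule LIMSEQ_le[OF 1 tendsto_mult_left[OF 2]]) (use bd fs in auto)
  then have "H.nrm g * H.nrm g \<le> A * H.nrm g"
    unfolding H.ip_self[OF g] norm_of_real by (simp add: power2_eq_square)
  then show ?thesis using \<open>A \<ge> 0\<close> H.nrm_nonneg[OF g] by (cases "H.nrm g = 0") auto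
qed

text \<open>
  The hard half of the description of the norm. With \<open>\<eta> = cnj u\<close> and the cyclic vector \<open>\<xi>\<close> the
  function \<open>u\<close> is the coefficient of \<open>\<xi>\<close> and \<open>\<eta>\<close> in the whole space. Continuity of \<open>u\<close> says that
  \<open>\<langle>\<pi>(x)\<eta>, w\<rangle>\<close> is continuous in \<open>x\<close> for \<open>w\<close> in a dense set, so \<open>\<langle>\<pi>(x)\<eta>, \<eta>\<rangle>\<close> is continuous at \<open>0\<close>, which for
  unitary operators yields norm continuity. Thus \<open>\<eta>\<close> is a continuous vector; since the coefficient
  only tests \<open>\<xi>\<close> against the orbit of \<open>\<eta>\<close>, projecting \<open>\<xi>\<close> on the continuous vectors changes nothing.
\<close>

theorem coefficient_bound_exists:
  assumes cont: "continuous_on UNIV u" and dom: "dominated r \<phi> u"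
  shows "\<exists>b\<in>coefficient_bounds u. b \<le> r"
proof -
  have r: "r \<ge> 0" by (rule dominated_nonneg[OF dom])
  define \<eta> where "\<eta> = (\<lambda>x. cnj (u x))"
  define \<xi> where "\<xi> = ev (point 0)"
  have bd: "cmod (fin_lin u c) \<le> sqrt r * E.nrm c" if c: "c \<in> finsupp" for c
  proof (rule power2_le_imp_le)
    show "(cmod (fin_lin u c))\<^sup>2 \<le> (sqrt r * E.nrm c)\<^sup>2"
      using dominated_ineq[OF dom c] r c by (simp add: power_mult_distrib E.nrm_power2)
    show "0 \<le> sqrt r * E.nrm c" using r c by simp
  qed
  have \<eta>: "\<eta> \<in> rkhs" and rkhs_ip\<eta>: "\<And>c. c \<in> finsupp \<Longrightarrow> rkhs_ip (ev c) \<eta> = fin_lin u c"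
    unfolding \<eta>_def using riesz_kernel[of u "sqrt r", OF bd] by auto
  have \<xi>: "\<xi> \<in> rkhs" unfolding \<xi>_def by (intro ev_rkhs point_finsupp)
  have n\<eta>: "H.nrm \<eta> \<le> sqrt r"
    using \<eta> r bd by (intro rkhs_ip_dense_bound) (auto simp: rkhs_ip\<eta> nrm_ev)
  have n\<xi>: "H.nrm \<xi> \<le> sqrt r"
  proof -
    have "(H.nrm \<xi>)\<^sup>2 \<le> r"
      using \<xi> dom by (simp add: H.nrm_power2 \<xi>_def rkhs_ip_ev point_finsupp fin_ip_points dominated_def)
    then show ?thesis by (rule real_le_rsqrt)
  qed
  have \<eta>C: "\<eta> \<in> continuous_vectors"
  proof -
    have evl: "((\<lambda>x. rkhs_ip (translate x \<eta> - \<eta>) (ev w)) \<longlongrightarrow> 0) (nhds 0)" if w: "w \<in> finsupp" for w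
    proof -
      have "isCont u y" for y using cont by (simp add: continuous_on_eq_continuous_at)
      then have "(u \<longlongrightarrow> u y) (nhds y)" for y by (simp add: isCont_def tendsto_at_iff_tendsto_nhds)
      moreover have "((\<lambda>x. - x + y) \<longlongrightarrow> - 0 + y) (nhds 0)" for y :: 'a
        by (intro tendsto_intros filterlim_ident)
      then have "((\<lambda>x. - x + y) \<longlongrightarrow> y) (nhds 0)" for y :: 'a by simp
      ultimately have "((\<lambda>x. u (- x + y)) \<longlongrightarrow> u y) (nhds 0)" for y
        by (rule filterlim_compose)
      then have "((\<lambda>x. \<Sum>y | w y \<noteq> 0. cnj (w y) * (cnj (u (- x + y)) - cnj (u y))) \<longlongrightarrow>
          (\<Sum>y | w y \<noteq> 0. cnj (w y) * (cnj (u y) - cnj (u y)))) (nhds 0)"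
        by (intro tendsto_intros)
      then show ?thesis using w \<eta> by (simp add: rkhs_ip_ev_right translate_rkhs translate_apply \<eta>_def)
    qed
    have lim: "((\<lambda>x. rkhs_ip (translate x \<eta> - \<eta>) \<eta>) \<longlongrightarrow> 0) (nhds 0)"
    proof (rule tendstoI)
      fix e :: real assume e: "e > 0"
      define d where "d = e / 2 / (2 * H.nrm \<eta> + 1)"
      have d: "d > 0" using e \<eta> by (auto simp: d_def add_nonneg_pos)
      obtain w where w: "w \<in> finsupp" "H.nrm (\<eta> - ev w) < d" using ev_dense[OF \<eta> d] by blast
      have "e / 2 > 0" using e by simp
      from tendstoD[OF evl[OF w(1)] this]
      show "\<forall>\<^sub>F x in nhds 0. dist (rkhs_ip (translate x \<eta> - \<eta>) \<eta>) 0 < e"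
      proof eventually_elim
        case (elim x)
        have ew: "ev w \<in> rkhs" using w(1) by (rule ev_rkhs)
        have t: "translate x \<eta> - \<eta> \<in> rkhs" using \<eta> by (simp add: translate_rkhs)
        have "H.nrm (translate x \<eta> - \<eta>) \<le> 2 * H.nrm \<eta>"
          using H.nrm_triangle[of "translate x \<eta>" "- \<eta>"] \<eta>
          by (simp add: translate_rkhs hnorm_translate H.nrm_minus)
        then have "cmod (rkhs_ip (translate x \<eta> - \<eta>) (\<eta> - ev w)) \<le> 2 * H.nrm \<eta> * d"
          using H.cauchy_schwarz[OF t, of "\<eta> - ev w"] w(2) \<eta> ew t
          by (smt (verit) H.V_closed(5) H.nrm_nonneg mult_mono)
        also have "\<dots> \<le> e / 2"
        proof -
          have "2 * H.nrm \<eta> * d \<le> (2 * H.nrm \<eta> + 1) * d" using d by (intro mult_right_mono) auto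
          also have "\<dots> = e / 2"
          proof -
            have "2 * H.nrm \<eta> + 1 \<noteq> 0" using H.nrm_nonneg[OF \<eta>] by linarith
            then show ?thesis unfolding d_def by (rule nonzero_mult_div_cancel_left[of _ "e / 2", unfolded times_divide_eq_right[symmetric]])
          qed
          finally show ?thesis .
        qed
        finally have a: "cmod (rkhs_ip (translate x \<eta> - \<eta>) (\<eta> - ev w)) \<le> e / 2" .
        have "rkhs_ip (translate x \<eta> - \<eta>) \<eta> = rkhs_ip (translate x \<eta> - \<eta>) (\<eta> - ev w) + rkhs_ip (translate x \<eta> - \<eta>) (ev w)"
          using H.ip_diff_right[OF \<eta> ew t] by simp
        then show ?case
          using a elim norm_triangle_ineq[of "rkhs_ip (translate x \<eta> - \<eta>) (\<eta> - ev w)" "rkhs_ip (translate x \<eta> - \<eta>) (ev w)"]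
          by simp
      qed
    qed
    have "H.nrm (translate x \<eta> - \<eta>) = sqrt (- 2 * Re (rkhs_ip (translate x \<eta> - \<eta>) \<eta>))" for x
    proof -
      have "(H.nrm (translate x \<eta> - \<eta>))\<^sup>2 = - 2 * Re (rkhs_ip (translate x \<eta> - \<eta>) \<eta>)"
        using \<eta> H.nrm_power2[OF \<eta>]
        by (simp add: H.nrm_diff_power2 translate_rkhs hnorm_translate H.ip_diff_left)
      then show ?thesis
        using \<eta> by (metis H.V_closed(5) H.nrm_nonneg real_sqrt_abs abs_of_nonneg translate_rkhs)
    qed
    moreover have "((\<lambda>x. sqrt (- 2 * Re (rkhs_ip (translate x \<eta> - \<eta>) \<eta>))) \<longlongrightarrow> sqrt (- 2 * Re 0)) (nhds 0)"
      by (intro tendsto_intros lim)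
    ultimately show ?thesis using \<eta> by (simp add: continuous_vectors_def)
  qed
  interpret C: continuous_unitary_rep cscale continuous_vectors rkhs_ip translate by (rule continuous_rep_continuous_vectors)
  note in_rkhs = subsetD[OF continuous_vectors_subset]
  \<comment> \<open>the limit \<open>p\<close> of this sequence is the projection of \<open>\<xi>\<close> on the continuous vectors\<close>
  obtain X where X: "\<And>n::nat. X n \<in> continuous_vectors" "C.pre.cauchy_seq X" "\<And>w. w \<in> continuous_vectors \<Longrightarrow> (\<lambda>n. rkhs_ip w (X n)) \<longlonglongrightarrow> rkhs_ip w \<xi>"
  proof (rule C.pre.riesz_approx[of "\<lambda>w. rkhs_ip w \<xi>" "H.nrm \<xi>"])
    show "rkhs_ip (v + w) \<xi> = rkhs_ip v \<xi> + rkhs_ip w \<xi>" if "v \<in> continuous_vectors" "w \<in> continuous_vectors" for v w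
      by (rule H.ip_add_left[OF in_rkhs[OF that(1)] in_rkhs[OF that(2)] \<xi>])
    show "rkhs_ip (cscale c v) \<xi> = c * rkhs_ip v \<xi>" if "v \<in> continuous_vectors" for c v
      by (rule H.ip_scale_left[OF in_rkhs[OF that] \<xi>])
    show "cmod (rkhs_ip v \<xi>) \<le> H.nrm \<xi> * H.nrm v" if "v \<in> continuous_vectors" for v
      using H.cauchy_schwarz[OF in_rkhs[OF that] \<xi>] by (simp add: mult.commute)
  qed blast
  obtain p where p: "p \<in> continuous_vectors" "(\<lambda>n. H.nrm (X n - p)) \<longlonglongrightarrow> 0"
    using C.complete_V[of X] X(1,2) unfolding C.pre.cauchy_seq_def by blast
  have hp: "rkhs_ip w p = rkhs_ip w \<xi>" if w: "w \<in> continuous_vectors" for w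
  proof (rule LIMSEQ_unique[OF _ X(3)[OF w]])
    show "(\<lambda>n. rkhs_ip w (X n)) \<longlonglongrightarrow> rkhs_ip w p"
      by (rule C.pre.ip_tendsto[of "\<lambda>n. w"]) (use w X(1) p in auto)
  qed
  have np: "H.nrm p \<le> H.nrm \<xi>"
  proof -
    have "(H.nrm p)\<^sup>2 = Re (rkhs_ip p \<xi>)" using hp[OF p(1)] in_rkhs[OF p(1)] by (simp add: H.nrm_power2)
    also have "\<dots> \<le> H.nrm p * H.nrm \<xi>"
      using H.cauchy_schwarz[OF in_rkhs[OF p(1)] \<xi>] complex_Re_le_cmod order_trans by blast
    finally have "H.nrm p * H.nrm p \<le> H.nrm p * H.nrm \<xi>" by (simp add: power2_eq_square)
    then show ?thesis using H.nrm_nonneg[OF in_rkhs[OF p(1)]] H.nrm_nonneg[OF \<xi>] by (cases "H.nrm p = 0") auto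
  qed
  have u_eq: "u = (\<lambda>x. rkhs_ip (translate x p) \<eta>)"
  proof
    fix x
    have t: "translate (- x) \<eta> \<in> continuous_vectors" by (rule translate_continuous_vectors[OF \<eta>C])
    have "rkhs_ip (translate x p) \<eta> = rkhs_ip p (translate (- x) \<eta>)"
      by (rule rkhs_ip_translate_left[OF in_rkhs[OF p(1)] \<eta>])
    also have "\<dots> = cnj (rkhs_ip (translate (- x) \<eta>) p)"
      by (rule H.ip_commute) (use t p in_rkhs in auto)
    also have "rkhs_ip (translate (- x) \<eta>) p = (translate (- x) \<eta>) 0"
      unfolding hp[OF t] \<xi>_def by (rule rkhs_ip_point[OF in_rkhs[OF t]])
    also have "cnj (translate (- x) \<eta> 0) = u x" by (simp add: translate_apply \<eta>_def)
    finally show "u x = rkhs_ip (translate x p) \<eta>" by (rule sym)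
  qed
  have "H.nrm p * H.nrm \<eta> \<in> coefficient_bounds u"
    unfolding coefficient_bounds_def using C.continuous_unitary_rep_axioms p(1) \<eta>C u_eq
    unfolding cscale_def by blast
  moreover have "H.nrm p * H.nrm \<eta> \<le> sqrt r * sqrt r"
    using np n\<xi> n\<eta> \<eta> r in_rkhs[OF p(1)] by (intro mult_mono) auto
  ultimately show ?thesis using r by auto
qed

end

text \<open>
  By the Cauchy--Schwarz inequality \<open>\<bar>\<Sum> c\<^sub>x u(x)\<bar> \<le> \<parallel>\<Sum> c\<^sub>x \<pi>(x)\<xi>\<parallel> \<parallel>\<eta>\<parallel>\<close>, and the square of the first factor is
  the quadratic form of \<open>\<langle>\<pi>(x)\<xi>, \<xi>\<rangle>\<close>. The factor \<open>t\<close> in the proof has the effect of rescaling \<open>\<xi>\<close> and \<open>\<eta>\<close> to equal norms.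
\<close>

lemma (in continuous_unitary_rep) coefficient_dominated:
  assumes \<xi>: "\<xi> \<in> V" and \<eta>: "\<eta> \<in> V"
  defines "u \<equiv> (\<lambda>x. ip (\<pi> x \<xi>) \<eta>)"
  shows "continuous_on UNIV u" and "\<exists>\<phi>. dominated (hnorm ip \<xi> * hnorm ip \<eta>) \<phi> u"
proof -
  have \<pi>: "\<pi> x \<xi> \<in> V" for x by (rule rep_closed[OF \<xi>])
  have "(u \<longlongrightarrow> u y) (at y)" for y
  proof -
    have "((\<lambda>x. u x - u y) \<longlongrightarrow> 0) (at y)"
    proof (rule Lim_null_comparison)
      show "\<forall>\<^sub>F x in at y. norm (u x - u y) \<le> hnorm ip (\<pi> x \<xi> - \<pi> y \<xi>) * hnorm ip \<eta>"
        using pre.cauchy_schwarz[of "\<pi> _ \<xi> - \<pi> y \<xi>" \<eta>] \<pi> \<eta>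
        by (intro always_eventually) (simp add: u_def pre.ip_diff_left[symmetric])
      show "((\<lambda>x. hnorm ip (\<pi> x \<xi> - \<pi> y \<xi>) * hnorm ip \<eta>) \<longlongrightarrow> 0) (at y)"
        by (intro tendsto_mult_left_zero rep_continuous \<xi>)
    qed
    then show ?thesis by (simp add: LIM_zero_iff)
  qed
  then show "continuous_on UNIV u" by (simp add: continuous_on_def)
  define v where "v c = (\<Sum>x | c x \<noteq> 0. scale (c x) (\<pi> x \<xi>))" for c :: "'a \<Rightarrow> complex"
  have vV: "v c \<in> V" for c unfolding v_def by (intro pre.V_sum pre.V_closed \<pi>)
  have fl: "fin_lin u c = ip (v c) \<eta>" for c
    unfolding v_def fin_lin_def u_def using \<pi> \<eta>
    by (subst pre.ip_sum_left) (auto simp: ip_scale_left)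
  have orbit: "ip (\<pi> (- y + x) \<xi>) \<xi> = ip (\<pi> x \<xi>) (\<pi> y \<xi>)" for x y
    using rep_ip[of "\<pi> (- y + x) \<xi>" \<xi> y] \<xi> \<pi> rep_plus[of \<xi> y "- y + x"]
    by (simp add: add.assoc[symmetric])
  have fq: "fin_ip (\<lambda>x y. ip (\<pi> (- y + x) \<xi>) \<xi>) c c = ip (v c) (v c)" for c
    unfolding orbit v_def by (rule pre.fin_ip_gram[OF \<pi>])
  have pdK: "pd_kernel (\<lambda>x y. ip (\<pi> (- y + x) \<xi>) \<xi>)"
    unfolding orbit by (rule pre.pd_kernel_gram[OF \<pi>])
  show "\<exists>\<phi>. dominated (hnorm ip \<xi> * hnorm ip \<eta>) \<phi> u"
  proof (cases "hnorm ip \<xi> = 0")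
    case True
    have "u x = 0" for x
    proof -
      have "\<xi> = 0" by (rule eq_zero_if_nrm_zero[OF \<xi> True])
      then have "\<pi> x \<xi> = 0" using rep_scale[OF \<xi>, of x 0] by simp
      then show ?thesis using \<eta> by (simp add: u_def pre.ip_zero_left)
    qed
    then have "fin_lin u c = 0" for c by (simp add: fin_lin_def)
    then have "dominated 0 (\<lambda>x. 0) u"
      by (intro dominatedI pd_kernelI) (auto simp: fin_ip_def)
    then show ?thesis using True by auto
  next
    case False
    define t where "t = hnorm ip \<eta> / hnorm ip \<xi>"
    have t: "t \<ge> 0" using \<xi> \<eta> by (simp add: t_def)
    have nt: "hnorm ip \<xi> * hnorm ip \<eta> * t = (hnorm ip \<eta>)\<^sup>2"
      using False by (simp add: t_def power2_eq_square)
    have "dominated (hnorm ip \<xi> * hnorm ip \<eta>) (\<lambda>x. complex_of_real t * ip (\<pi> x \<xi>) \<xi>) u"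
    proof (rule dominatedI)
      show "pd_kernel (\<lambda>x y. complex_of_real t * ip (\<pi> (- y + x) \<xi>) \<xi>)"
        using pd_kernel_scale[OF t pdK] .
      have "Re (complex_of_real t * ip (\<pi> 0 \<xi>) \<xi>) = t * (hnorm ip \<xi>)\<^sup>2"
        using \<xi> by (simp add: rep_zero pre.nrm_power2)
      then show "Re (complex_of_real t * ip (\<pi> 0 \<xi>) \<xi>) \<le> hnorm ip \<xi> * hnorm ip \<eta>"
        using False by (simp add: t_def power2_eq_square)
      fix c :: "'a \<Rightarrow> complex" assume c: "c \<in> finsupp"
      have "(cmod (fin_lin u c))\<^sup>2 \<le> (hnorm ip (v c) * hnorm ip \<eta>)\<^sup>2"
        unfolding fl using vV \<eta> by (intro power_mono pre.cauchy_schwarz) auto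
      also have "\<dots> = hnorm ip \<xi> * hnorm ip \<eta> * t * Re (ip (v c) (v c))"
        unfolding nt using vV[of c] by (simp add: power_mult_distrib pre.nrm_power2)
      also have "\<dots> = hnorm ip \<xi> * hnorm ip \<eta> * Re (fin_ip (\<lambda>x y. complex_of_real t * ip (\<pi> (- y + x) \<xi>) \<xi>) c c)"
        by (simp add: fin_ip_kernel_scale fq)
      finally show "(cmod (fin_lin u c))\<^sup>2 \<le> hnorm ip \<xi> * hnorm ip \<eta> *
        Re (fin_ip (\<lambda>x y. complex_of_real t * ip (\<pi> (- y + x) \<xi>) \<xi>) c c)" .
    qed
    then show ?thesis by blast
  qed
qed

lemma coefficient_bounds_dominated:
  assumes "b \<in> coefficient_bounds u"
  shows "continuous_on UNIV u" "\<exists>\<phi>. dominated b \<phi> u"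
proof -
  from assms obtain V ip \<pi> \<xi> \<eta> where
    rep: "continuous_unitary_rep (\<lambda>c (f :: 'a \<Rightarrow> complex) x. c * f x) V ip \<pi>"
    and *: "\<xi> \<in> V" "\<eta> \<in> V" "u = (\<lambda>x. ip (\<pi> x \<xi>) \<eta>)" "b = hnorm ip \<xi> * hnorm ip \<eta>"
    unfolding coefficient_bounds_def by blast
  show "continuous_on UNIV u" "\<exists>\<phi>. dominated b \<phi> u"
    using continuous_unitary_rep.coefficient_dominated[OF rep *(1,2)] *(3,4) by simp_all
qed

lemma dominated_mono:
  assumes "dominated r \<phi> u" "r \<le> s"
  shows "dominated s \<phi> u"
proof (rule dominatedI)
  show pd: "pd_kernel (\<lambda>x y. \<phi> (- y + x))" using assms by (simp add: dominated_def)
  show "Re (\<phi> 0) \<le> s" using assms by (simp add: dominated_def)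
  fix c :: "'a \<Rightarrow> complex" assume c: "c \<in> finsupp"
  show "(cmod (fin_lin u c))\<^sup>2 \<le> s * Re (fin_ip (\<lambda>x y. \<phi> (- y + x)) c c)"
    using dominated_ineq[OF assms(1) c] mult_right_mono[OF assms(2) pd_kernel_nonneg[OF pd c]]
    by linarith
qed

text \<open>
  The infimum in the definition of the norm is attained on the right-hand side because domination
  passes to limits; this is why no strict inequality or error term appears.
\<close>

theorem B_norm_le_iff:
  "u \<in> B_alg \<and> B_norm u \<le> r \<longleftrightarrow> continuous_on UNIV u \<and> (\<exists>\<phi>. dominated r \<phi> u)"
proof -
  have nonneg: "0 \<le> b" if "b \<in> coefficient_bounds u" for b
    using coefficient_bounds_dominated(2)[OF that] dominated_nonneg by blast
  then have bdd: "bdd_below (coefficient_bounds u)" by (rule bdd_belowI)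
  show ?thesis
  proof
    assume *: "u \<in> B_alg \<and> B_norm u \<le> r"
    then obtain b where "b \<in> coefficient_bounds u" by (auto simp: B_alg_def)
    then have cont: "continuous_on UNIV u" by (rule coefficient_bounds_dominated)
    have "\<exists>b\<in>coefficient_bounds u. b < B_norm u + 1 / real (Suc n)" for n
      using * bdd unfolding B_norm_def B_alg_def
      by (subst cInf_less_iff[symmetric]) auto
    then obtain b where b: "\<And>n. b n \<in> coefficient_bounds u" "\<And>n. b n < B_norm u + 1 / real (Suc n)"
      by metis
    have "\<exists>\<phi>. dominated (B_norm u + 1 / real (Suc n)) \<phi> u" for n
      using coefficient_bounds_dominated(2)[OF b(1)[of n]] b(2)[of n] dominated_mono less_imp_le by metis
    then obtain \<phi> where \<phi>: "\<And>n. dominated (B_norm u + 1 / real (Suc n)) (\<phi> n) u" by metis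
    have lim: "(\<lambda>n. B_norm u + 1 / real (Suc n)) \<longlonglongrightarrow> B_norm u"
      using tendsto_add[OF tendsto_const[of "B_norm u"] LIMSEQ_inverse_real_of_nat]
      by (simp add: field_simps)
    have "\<exists>\<psi>. dominated (B_norm u) \<psi> u"
      by (rule dominated_limit[OF _ _ lim, of \<phi> "\<lambda>n. u"]) (use \<phi> in auto)
    then show "continuous_on UNIV u \<and> (\<exists>\<phi>. dominated r \<phi> u)"
      using cont * dominated_mono by blast
  next
    assume *: "continuous_on UNIV u \<and> (\<exists>\<phi>. dominated r \<phi> u)"
    then obtain \<phi> where \<phi>: "dominated r \<phi> u" by blast
    interpret pd_function \<phi> by unfold_locales (use \<phi> in \<open>simp add: dominated_def\<close>)
    obtain b where "b \<in> coefficient_bounds u" "b \<le> r" using coefficient_bound_exists \<phi> * by blast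
    then show "u \<in> B_alg \<and> B_norm u \<le> r"
      unfolding B_alg_def B_norm_def using cInf_lower2[OF _ _ bdd] by auto
  qed
qed

lemma B_algI: "continuous_on UNIV u \<Longrightarrow> dominated r \<phi> u \<Longrightarrow> u \<in> B_alg \<and> B_norm u \<le> r"
  using B_norm_le_iff by blast

lemma B_alg_dominated:
  assumes "u \<in> B_alg"
  shows "\<exists>\<phi>. dominated (B_norm u) \<phi> u" and "continuous_on UNIV u"
  using assms B_norm_le_iff[of u "B_norm u"] by auto

lemma B_norm_nonneg: "u \<in> B_alg \<Longrightarrow> 0 \<le> B_norm u"
  using B_alg_dominated(1) dominated_nonneg by blast

lemma B_norm_bound: "u \<in> B_alg \<Longrightarrow> cmod (u x) \<le> B_norm u"
  using B_alg_dominated(1) dominated_bound by blast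

lemma B_alg_zero:
  "(0 :: 'a \<Rightarrow> complex) \<in> B_alg \<and> B_norm (0 :: 'a::{topological_group_add,t2_space} \<Rightarrow> complex) = 0"
proof -
  have "dominated 0 (\<lambda>x. 0) (0 :: 'a \<Rightarrow> complex)"
    by (intro dominatedI pd_kernelI) (auto simp: fin_ip_def fin_lin_def)
  then have *: "(0 :: 'a \<Rightarrow> complex) \<in> B_alg \<and> B_norm (0 :: 'a \<Rightarrow> complex) \<le> 0"
    by (rule B_algI[rotated]) (simp add: zero_fun_def)
  then show ?thesis using B_norm_nonneg[of "0 :: 'a \<Rightarrow> complex"] by auto
qed

lemma B_alg_add:
  assumes "u \<in> B_alg" "v \<in> B_alg"
  shows "u + v \<in> B_alg \<and> B_norm (u + v) \<le> B_norm u + B_norm v"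
proof -
  obtain \<phi> \<psi> where "dominated (B_norm u) \<phi> u" "dominated (B_norm v) \<psi> v"
    using B_alg_dominated(1) assms by blast
  from dominated_add[OF this] show ?thesis
    by (rule B_algI[rotated])
      (use assms[THEN B_alg_dominated(2)] in \<open>auto simp: plus_fun_def intro!: continuous_intros\<close>)
qed

lemma B_alg_mult:
  assumes "u \<in> B_alg" "v \<in> B_alg"
  shows "u * v \<in> B_alg \<and> B_norm (u * v) \<le> B_norm u * B_norm v"
proof -
  obtain \<phi> \<psi> where "dominated (B_norm u) \<phi> u" "dominated (B_norm v) \<psi> v"
    using B_alg_dominated(1) assms by blast
  from dominated_mult[OF this] show ?thesis
    by (rule B_algI[rotated])
      (use assms[THEN B_alg_dominated(2)] in \<open>auto simp: times_fun_def intro!: continuous_intros\<close>)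
qed

lemma B_alg_scale:
  assumes "u \<in> B_alg"
  shows "(\<lambda>x. a * u x) \<in> B_alg \<and> B_norm (\<lambda>x. a * u x) \<le> cmod a * B_norm u"
proof -
  obtain \<phi> where "dominated (B_norm u) \<phi> u" using B_alg_dominated(1) assms by blast
  from dominated_scale[OF this] show ?thesis
    by (rule B_algI[rotated])
      (use assms[THEN B_alg_dominated(2)] in \<open>auto intro!: continuous_intros\<close>)
qed

lemma B_alg_minus: "u \<in> B_alg \<Longrightarrow> - u \<in> B_alg \<and> B_norm (- u) = B_norm u"
proof -
  have le: "- v \<in> B_alg \<and> B_norm (- v) \<le> B_norm v"
    if "v \<in> B_alg" for v :: "'b::{topological_group_add,t2_space} \<Rightarrow> complex"
  proof -
    have "(\<lambda>x. - 1 * v x) = - v" by (simp add: fun_eq_iff)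
    then show ?thesis using B_alg_scale[OF that, of "-1"] by simp
  qed
  assume "u \<in> B_alg"
  then show ?thesis using le[of u] le[of "- u"] by auto
qed

lemma B_alg_diff:
  assumes "u \<in> B_alg" "v \<in> B_alg"
  shows "u - v \<in> B_alg \<and> B_norm (u - v) \<le> B_norm u + B_norm v"
  using B_alg_add[of u "- v"] B_alg_minus[of v] assms by auto

text \<open>
  Pointwise convergence along any filter is enough; continuity of the limit cannot be omitted since a
  pointwise limit of continuous positive definite functions may be discontinuous.
\<close>

lemma B_alg_limit:
  assumes "F \<noteq> bot" "eventually (\<lambda>i. f i \<in> B_alg \<and> B_norm (f i) \<le> C) F"
    and "\<And>x. ((\<lambda>i. f i x) \<longlongrightarrow> u x) F" and "continuous_on UNIV u"
  shows "u \<in> B_alg \<and> B_norm u \<le> C"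
proof -
  have "eventually (\<lambda>i. \<exists>\<phi>. dominated C \<phi> (f i)) F"
    using assms(2) by eventually_elim (use B_norm_le_iff in blast)
  then have "eventually (\<lambda>i. dominated C (SOME \<phi>. dominated C \<phi> (f i)) (f i)) F"
    by eventually_elim (rule someI_ex[where P = "\<lambda>\<phi>. dominated C \<phi> (f _)"])
  from dominated_limit[OF assms(1) this tendsto_const assms(3)]
  show ?thesis using assms(4) B_norm_le_iff by blast
qed


section \<open>Integration of compactly supported functions\<close>

lemma compact_uniform_nbhd:
  fixes P :: "'b::topological_space \<Rightarrow> 'c::topological_space \<Rightarrow> real"
  assumes K: "compact K" and cont: "continuous_on UNIV (\<lambda>(x, y). P x y)"
    and less: "\<And>y. y \<in> K \<Longrightarrow> P x0 y < e"
  obtains U where "open U" "x0 \<in> U" "\<And>x y. x \<in> U \<Longrightarrow> y \<in> K \<Longrightarrow> P x y < e"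
proof -
  define W where "W = {z. (case z of (x, y) \<Rightarrow> P x y) < e}"
  have W: "open W" unfolding W_def by (rule open_Collect_less[OF cont]) simp
  have sub: "{x0} \<times> K \<subseteq> W" using less by (auto simp: W_def)
  obtain U where U: "x0 \<in> U" "open U" "U \<times> K \<subseteq> W"
    using Elementary_Topology.tube_lemma[OF K W sub] by (elim exE conjE)
  show ?thesis
  proof (rule that[OF U(2,1)])
    fix x y assume "x \<in> U" "y \<in> K"
    then have "(x, y) \<in> W" using U(3) by blast
    then show "P x y < e" by (simp add: W_def)
  qed
qed

lemma Hausdorff_space_t2: "Hausdorff_space (euclidean :: 'a::t2_space topology)"
  unfolding Hausdorff_space_def
  by (metis disjnt_def hausdorff open_openin)

lemma continuous_on_group_compose:
  fixes f :: "'a::topological_group_add \<Rightarrow> 'b::topological_space"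
  assumes "continuous_on UNIV f" "continuous_on S h"
  shows "continuous_on S (\<lambda>x. f (h x))"
  using continuous_on_compose2[OF assms] by simp

definition Cc :: "('a::topological_space \<Rightarrow> real) set" where
  "Cc = {f. continuous_on UNIV f \<and> (\<exists>K. compact K \<and> (\<forall>x. x \<notin> K \<longrightarrow> f x = 0))}"

lemma CcI: "continuous_on UNIV f \<Longrightarrow> compact K \<Longrightarrow> (\<And>x. x \<notin> K \<Longrightarrow> f x = 0) \<Longrightarrow> f \<in> Cc"
  by (auto simp: Cc_def)

lemma Cc_continuous: "f \<in> Cc \<Longrightarrow> continuous_on UNIV f"
  by (simp add: Cc_def)

lemma Cc_support: "f \<in> Cc \<Longrightarrow> (\<And>K. compact K \<Longrightarrow> (\<And>x. x \<notin> K \<Longrightarrow> f x = 0) \<Longrightarrow> thesis) \<Longrightarrow> thesis"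
  by (auto simp: Cc_def)

lemma Cc_zero: "(\<lambda>x. 0) \<in> Cc"
  by (rule CcI[of _ "{}"]) auto

lemma Cc_mult:
  assumes f: "f \<in> Cc" and g: "continuous_on UNIV g"
  shows "(\<lambda>x. f x * g x) \<in> Cc"
  using f
proof (rule Cc_support)
  fix K assume "compact K" "\<And>x. x \<notin> K \<Longrightarrow> f x = 0"
  then show ?thesis
    by (intro CcI[of _ K] continuous_on_mult Cc_continuous[OF f] g) auto
qed

lemma Cc_mult_left: "f \<in> Cc \<Longrightarrow> continuous_on UNIV g \<Longrightarrow> (\<lambda>x. g x * f x) \<in> Cc"
  using Cc_mult[of f g] by (simp add: mult.commute)

lemma Cc_cmult: "f \<in> Cc \<Longrightarrow> (\<lambda>x. c * f x) \<in> Cc"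
  by (rule Cc_mult_left) auto

lemma Cc_add:
  assumes "f \<in> Cc" "g \<in> Cc"
  shows "(\<lambda>x. f x + g x) \<in> Cc"
proof -
  obtain K L where "compact K" "\<And>x. x \<notin> K \<Longrightarrow> f x = 0" "compact L" "\<And>x. x \<notin> L \<Longrightarrow> g x = 0"
    using assms by (metis Cc_support)
  then show ?thesis
    by (intro CcI[of _ "K \<union> L"] continuous_on_add assms[THEN Cc_continuous] compact_Un) auto
qed

lemma Cc_diff: "f \<in> Cc \<Longrightarrow> g \<in> Cc \<Longrightarrow> (\<lambda>x. f x - g x) \<in> Cc"
  using Cc_add[of f "\<lambda>x. - 1 * g x"] Cc_cmult[of g "-1"] by simp

lemma Cc_sum: "(\<And>i. i \<in> S \<Longrightarrow> f i \<in> Cc) \<Longrightarrow> (\<lambda>x. \<Sum>i\<in>S. f i x) \<in> Cc"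
  by (induction S rule: infinite_finite_induct) (auto simp: Cc_zero intro: Cc_add)

lemma Cc_comp:
  assumes "f \<in> Cc" "continuous_on UNIV h" "h 0 = 0"
  shows "(\<lambda>x. h (f x)) \<in> Cc"
  using assms(1)
proof (rule Cc_support)
  fix K assume "compact K" "\<And>x. x \<notin> K \<Longrightarrow> f x = 0"
  then show ?thesis
    using assms by (intro CcI[of _ K]) (auto intro: continuous_on_compose2[OF assms(2) Cc_continuous])
qed

lemma Cc_abs: "f \<in> Cc \<Longrightarrow> (\<lambda>x. \<bar>f x\<bar>) \<in> Cc"
  by (rule Cc_comp) (auto intro!: continuous_intros)

lemma Cc_translate:
  fixes f :: "'a::topological_group_add \<Rightarrow> real"
  assumes "f \<in> Cc"
  shows "(\<lambda>x. f (a + x)) \<in> Cc"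
  using assms
proof (rule Cc_support)
  fix K assume K: "compact K" "\<And>x. x \<notin> K \<Longrightarrow> f x = 0"
  show ?thesis
  proof (rule CcI)
    show "continuous_on UNIV (\<lambda>x. f (a + x))"
      by (rule continuous_on_group_compose[OF Cc_continuous[OF assms]]) (intro continuous_intros)
    show "compact ((+) (- a) ` K)" using K by (intro compact_continuous_image continuous_intros)
    fix x assume x: "x \<notin> (+) (- a) ` K"
    have "a + x \<notin> K"
    proof
      assume "a + x \<in> K"
      then have "- a + (a + x) \<in> (+) (- a) ` K" by (rule imageI)
      then show False using x by (simp add: add.assoc[symmetric])
    qed
    then show "f (a + x) = 0" by (rule K(2))
  qed
qed

lemma Cc_bounded:
  assumes "f \<in> Cc"
  obtains C where "C > 0" "\<And>x. \<bar>f x\<bar> \<le> C"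
  using assms
proof (rule Cc_support)
  fix K assume K: "compact K" "\<And>x. x \<notin> K \<Longrightarrow> f x = 0"
  have "compact (f ` K)"
    using K continuous_on_subset[OF Cc_continuous[OF assms]] by (intro compact_continuous_image) auto
  then have "bounded (f ` K)" by (rule compact_imp_bounded)
  then obtain C where C: "C > 0" "\<And>x. x \<in> K \<Longrightarrow> \<bar>f x\<bar> \<le> C"
    unfolding bounded_pos by auto
  have "\<bar>f x\<bar> \<le> C" for x using C K(2)[of x] by (cases "x \<in> K") auto
  then show ?thesis using C that by blast
qed

lemma Cc_left_uniform:
  fixes f :: "'a::topological_group_add \<Rightarrow> real"
  assumes f: "f \<in> Cc" and e: "e > 0"
  obtains U where "open U" "0 \<in> U" "\<And>z y. z \<in> U \<Longrightarrow> \<bar>f (z + y) - f y\<bar> < e"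
  using f
proof (rule Cc_support)
  fix K assume K: "compact K" "\<And>x. x \<notin> K \<Longrightarrow> f x = 0"
  have cont: "continuous_on UNIV (\<lambda>(z, y). \<bar>f (z + y) - f y\<bar>)"
    unfolding split_beta
    by (intro continuous_intros continuous_on_group_compose[OF Cc_continuous[OF f]])
  obtain U where U: "open U" "0 \<in> U" "\<And>z y. z \<in> U \<Longrightarrow> y \<in> K \<Longrightarrow> \<bar>f (z + y) - f y\<bar> < e"
    by (rule compact_uniform_nbhd[OF K(1) cont, of 0 e]) (use e in auto)
  define W where "W = U \<inter> uminus -` U"
  have "open (uminus -` U)"
    using U(1) by (intro open_vimage) (auto intro: continuous_intros)
  then have W: "open W" "0 \<in> W" using U by (auto simp: W_def)
  have "\<bar>f (z + y) - f y\<bar> < e" if z: "z \<in> W" for z y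
  proof (cases "y \<in> K")
    case True
    then show ?thesis using U z by (simp add: W_def)
  next
    case y: False
    show ?thesis
    proof (cases "z + y \<in> K")
      case True
      then have "\<bar>f (- z + (z + y)) - f (z + y)\<bar> < e" using z by (intro U(3)) (simp_all add: W_def)
      then show ?thesis by (simp add: add.assoc[symmetric] abs_minus_commute)
    next
      case False
      then show ?thesis using K y e by simp
    qed
  qed
  then show ?thesis using that W by blast
qed

locale haar_measure =
  fixes \<mu> :: "'a::{topological_group_add,t2_space} measure"
  assumes haar: "left_haar_measure \<mu>"
    and lc: "locally_compact_space (euclidean :: 'a topology)"
begin

abbreviation I :: "('a \<Rightarrow> real) \<Rightarrow> real" where
  "I f \<equiv> integral\<^sup>L \<mu> f"

lemma sets_\<mu>: "sets \<mu> = sets borel"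
  using haar by (simp add: left_haar_measure_def)

lemma space_\<mu>: "space \<mu> = UNIV"
  using sets_eq_imp_space_eq[OF sets_\<mu>] by simp

lemma emeasure_compact: "compact K \<Longrightarrow> emeasure \<mu> K < \<infinity>"
  using haar by (simp add: left_haar_measure_def)

lemma compact_sets: "compact K \<Longrightarrow> K \<in> sets \<mu>"
  by (simp add: sets_\<mu> compact_imp_closed)

lemma continuous_measurable: "continuous_on UNIV f \<Longrightarrow> f \<in> borel_measurable \<mu>"
  using borel_measurable_continuous_onI[of f] measurable_cong_sets[OF sets_\<mu> refl] by blast

lemma integrable_Cc:
  assumes f: "f \<in> Cc"
  shows "integrable \<mu> f"
proof -
  obtain K where K: "compact K" "\<And>x. x \<notin> K \<Longrightarrow> f x = 0" using f Cc_support by blast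
  obtain C where C: "\<And>x. \<bar>f x\<bar> \<le> C" using f Cc_bounded by blast
  show ?thesis
    by (rule integrableI_bounded_set[OF compact_sets[OF K(1)] continuous_measurable[OF Cc_continuous[OF f]]
          emeasure_compact[OF K(1)], of C])
      (use K C in auto)
qed

lemma I_mono: "f \<in> Cc \<Longrightarrow> g \<in> Cc \<Longrightarrow> (\<And>x. f x \<le> g x) \<Longrightarrow> I f \<le> I g"
  by (intro integral_mono integrable_Cc)

lemma I_add: "f \<in> Cc \<Longrightarrow> g \<in> Cc \<Longrightarrow> I (\<lambda>x. f x + g x) = I f + I g"
  by (intro Bochner_Integration.integral_add integrable_Cc)

lemma I_diff: "f \<in> Cc \<Longrightarrow> g \<in> Cc \<Longrightarrow> I (\<lambda>x. f x - g x) = I f - I g"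
  by (intro Bochner_Integration.integral_diff integrable_Cc)

lemma I_cmult: "I (\<lambda>x. c * f x) = c * I f"
  by simp

lemma I_sum: "(\<And>i. i \<in> S \<Longrightarrow> f i \<in> Cc) \<Longrightarrow> I (\<lambda>x. \<Sum>i\<in>S. f i x) = (\<Sum>i\<in>S. I (f i))"
  by (intro Bochner_Integration.integral_sum integrable_Cc)

lemma I_nonneg: "(\<And>x. 0 \<le> f x) \<Longrightarrow> 0 \<le> I f"
  by (rule Bochner_Integration.integral_nonneg) auto

lemma I_abs: "\<bar>I f\<bar> \<le> I (\<lambda>x. \<bar>f x\<bar>)"
  by (rule integral_abs_bound)

lemma I_abs_le: "f \<in> Cc \<Longrightarrow> h \<in> Cc \<Longrightarrow> (\<And>x. \<bar>f x\<bar> \<le> h x) \<Longrightarrow> \<bar>I f\<bar> \<le> I h"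
  by (rule order_trans[OF I_abs I_mono[OF Cc_abs]])

lemma I_diff_le:
  "f \<in> Cc \<Longrightarrow> g \<in> Cc \<Longrightarrow> h \<in> Cc \<Longrightarrow> (\<And>x. \<bar>f x - g x\<bar> \<le> h x) \<Longrightarrow> \<bar>I f - I g\<bar> \<le> I h"
  using I_abs_le[OF Cc_diff, of f g h] by (simp add: I_diff)

lemma I_abs_triangle:
  "f \<in> Cc \<Longrightarrow> g \<in> Cc \<Longrightarrow> I (\<lambda>x. \<bar>f x + g x\<bar>) \<le> I (\<lambda>x. \<bar>f x\<bar>) + I (\<lambda>x. \<bar>g x\<bar>)"
  by (subst I_add[symmetric]) (auto intro!: I_mono Cc_add Cc_abs)

lemma I_small:
  assumes f: "f \<in> Cc" and K: "compact K" "\<And>x. x \<notin> K \<Longrightarrow> f x = 0" and le: "\<And>x. \<bar>f x\<bar> \<le> e"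
  shows "I (\<lambda>x. \<bar>f x\<bar>) \<le> e * measure \<mu> K"
proof -
  have int: "integrable \<mu> (indicator K :: 'a \<Rightarrow> real)"
    using compact_sets[OF K(1)] emeasure_compact[OF K(1)] by (simp add: integrable_indicator_iff space_\<mu>)
  have "I (\<lambda>x. \<bar>f x\<bar>) \<le> I (\<lambda>x. e * indicator K x)"
  proof (rule integral_mono)
    show "integrable \<mu> (\<lambda>x. \<bar>f x\<bar>)" by (rule integrable_Cc[OF Cc_abs[OF f]])
    show "integrable \<mu> (\<lambda>x. e * indicator K x)" using int by simp
    show "\<bar>f x\<bar> \<le> e * indicator K x" for x
      using le[of x] K(2)[of x] by (auto simp: indicator_def)
  qed
  also have "\<dots> = e * measure \<mu> K" by (simp add: space_\<mu>)
  finally show ?thesis .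
qed

lemma distr_translate: "distr \<mu> \<mu> ((+) a) = \<mu>"
proof (rule measure_eqI)
  have m: "(+) a \<in> measurable \<mu> \<mu>"
  proof -
    have "(+) a \<in> borel_measurable borel"
      by (intro borel_measurable_continuous_onI continuous_intros)
    then show ?thesis using measurable_cong_sets[OF sets_\<mu> sets_\<mu>] by blast
  qed
  fix A assume "A \<in> sets (distr \<mu> \<mu> ((+) a))"
  then have A: "A \<in> sets borel" by (simp add: sets_\<mu>)
  have "(+) a -` A = (+) (- a) ` A"
  proof (intro set_eqI iffI)
    fix x assume "x \<in> (+) a -` A"
    then show "x \<in> (+) (- a) ` A" by (intro image_eqI[of _ _ "a + x"]) (simp_all add: add.assoc[symmetric])
  qed (auto simp: add.assoc[symmetric])
  then have "emeasure (distr \<mu> \<mu> ((+) a)) A = emeasure \<mu> ((+) (- a) ` A)"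
    using A by (simp add: emeasure_distr[OF m] sets_\<mu> space_\<mu>)
  also have "\<dots> = emeasure \<mu> A" using haar A unfolding left_haar_measure_def by blast
  finally show "emeasure (distr \<mu> \<mu> ((+) a)) A = emeasure \<mu> A" .
qed simp

lemma I_translate:
  assumes "continuous_on UNIV f"
  shows "I (\<lambda>x. f (a + x)) = I f"
proof -
  have m: "(+) a \<in> measurable \<mu> \<mu>"
  proof -
    have "(+) a \<in> borel_measurable borel"
      by (intro borel_measurable_continuous_onI continuous_intros)
    then show ?thesis using measurable_cong_sets[OF sets_\<mu> sets_\<mu>] by blast
  qed
  have "I f = integral\<^sup>L (distr \<mu> \<mu> ((+) a)) f" by (simp only: distr_translate)
  also have "\<dots> = I (\<lambda>x. f (a + x))"
    by (rule integral_distr[OF m continuous_measurable[OF assms]])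
  finally show ?thesis by simp
qed

lemma compact_nbhd:
  obtains V N where "open V" "compact N" "(x :: 'a) \<in> V" "V \<subseteq> N"
proof -
  have "\<exists>V N. openin euclidean V \<and> compactin euclidean N \<and> x \<in> V \<and> V \<subseteq> N"
    using lc unfolding locally_compact_space_def by simp
  then show thesis using that by (auto simp: compactin_euclidean_iff)
qed

lemma Cc_bump:
  assumes "open U" "(x :: 'a) \<in> U"
  obtains f where "f \<in> Cc" "\<And>y. 0 \<le> f y" "\<And>y. f y \<le> 1" "f x = 1" "\<And>y. y \<notin> U \<Longrightarrow> f y = 0"
proof -
  obtain V N where V: "open V" "compact N" "x \<in> V" "V \<subseteq> N" by (rule compact_nbhd)
  have cr: "completely_regular_space (euclidean :: 'a topology)"
    using lc Hausdorff_space_t2 by (intro locally_compact_regular_imp_completely_regular_space) auto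
  have "closedin euclidean (- (U \<inter> V))" "x \<in> topspace euclidean - (- (U \<inter> V))"
    using assms V by (auto simp: closed_closedin[symmetric])
  then obtain g :: "'a \<Rightarrow> real" where g: "continuous_map euclidean (top_of_set {0..1}) g"
      "g x = 0" "g ` (- (U \<inter> V)) \<subseteq> {1}"
    using cr unfolding completely_regular_space_def by metis
  have cont: "continuous_on UNIV g" and g01: "\<And>y. g y \<in> {0..1}"
    using g(1) by (auto simp: continuous_map_in_subtopology)
  have z: "1 - g y = 0" if "y \<notin> U \<inter> V" for y using g(3) that by auto
  show ?thesis
  proof (rule that[of "\<lambda>y. 1 - g y"])
    show "(\<lambda>y. 1 - g y) \<in> Cc"
      by (rule CcI[OF _ V(2)]) (use cont z V in \<open>auto intro!: continuous_intros\<close>)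
  qed (use g01 g z in auto)
qed

lemma Cc_cutoff:
  assumes K: "compact (K :: 'a set)"
  obtains f where "f \<in> Cc" "\<And>y. y \<in> K \<Longrightarrow> f y = 1"
proof -
  have "\<exists>f. f \<in> Cc \<and> (\<forall>y. 0 \<le> f y) \<and> f x = (1::real)" for x :: 'a
    using Cc_bump[OF open_UNIV UNIV_I, of x] by metis
  then obtain F where F: "\<And>x::'a. F x \<in> Cc" "\<And>x y. 0 \<le> F x y" "\<And>x. F x x = (1::real)" by metis
  have op: "open {y. 1/2 < F x y}" for x
    by (intro open_Collect_less continuous_intros Cc_continuous F)
  have "K \<subseteq> (\<Union>x\<in>K. {y. 1/2 < F x y})" using F(3) by auto
  then obtain D where D: "D \<subseteq> K" "finite D" "K \<subseteq> (\<Union>x\<in>D. {y. 1/2 < F x y})"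
    using compactE_image[OF K, of K "\<lambda>x. {y. 1/2 < F x y}"] op by blast
  show ?thesis
  proof (rule that[of "\<lambda>y. min 1 (2 * (\<Sum>x\<in>D. F x y))"])
    show "(\<lambda>y. min 1 (2 * (\<Sum>x\<in>D. F x y))) \<in> Cc"
      by (rule Cc_comp[where h = "min 1"]) (auto intro!: Cc_cmult Cc_sum F continuous_intros)
    fix y assume "y \<in> K"
    then obtain x where x: "x \<in> D" "1/2 < F x y" using D by auto
    have "F x y \<le> (\<Sum>x\<in>D. F x y)" using x(1) D(2) F(2) by (intro member_le_sum) auto
    then show "min 1 (2 * (\<Sum>x\<in>D. F x y)) = 1" using x by simp
  qed
qed

text \<open>
  If the integral were zero, finitely many translates of \<open>f\<close> would dominate any compact set, so every
  compact set, and by inner regularity the whole group, would be null.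
\<close>

lemma I_pos:
  assumes f: "f \<in> Cc" "\<And>y. 0 \<le> f y" and x0: "0 < f x0"
  shows "0 < I f"
proof (rule ccontr)
  assume "\<not> 0 < I f"
  then have I0: "I f = 0" using I_nonneg[of f, OF f(2)] by linarith
  define s where "s = f x0"
  have null: "emeasure \<mu> K = 0" if K: "compact K" for K
  proof -
    have op: "open {y. s / 2 < f (x0 - x + y)}" for x
      by (intro open_Collect_less continuous_intros continuous_on_group_compose[OF Cc_continuous[OF f(1)]])
    have "K \<subseteq> (\<Union>x\<in>K. {y. s / 2 < f (x0 - x + y)})" using x0 by (auto simp: s_def)
    then obtain D where D: "D \<subseteq> K" "finite D" "K \<subseteq> (\<Union>x\<in>D. {y. s / 2 < f (x0 - x + y)})"
      using compactE_image[OF K, of K "\<lambda>x. {y. s / 2 < f (x0 - x + y)}"] op by blast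
    have tr: "(\<lambda>y. f (x0 - x + y)) \<in> Cc" for x by (rule Cc_translate[OF f(1)])
    have int: "integrable \<mu> (indicator K :: 'a \<Rightarrow> real)"
      using compact_sets[OF K] emeasure_compact[OF K] by (simp add: integrable_indicator_iff space_\<mu>)
    have "measure \<mu> K = I (indicator K)" by (simp add: space_\<mu>)
    also have "\<dots> \<le> I (\<lambda>y. (2 / s) * (\<Sum>x\<in>D. f (x0 - x + y)))"
    proof (rule integral_mono[OF int integrable_Cc])
      show "(\<lambda>y. (2 / s) * (\<Sum>x\<in>D. f (x0 - x + y))) \<in> Cc" by (intro Cc_cmult Cc_sum tr)
      fix y
      show "indicator K y \<le> (2 / s) * (\<Sum>x\<in>D. f (x0 - x + y))"
      proof (cases "y \<in> K")
        case True
        then obtain x where x: "x \<in> D" "s / 2 < f (x0 - x + y)" using D by auto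
        have "f (x0 - x + y) \<le> (\<Sum>x\<in>D. f (x0 - x + y))" using x(1) D(2) f(2) by (intro member_le_sum) auto
        then have "s / 2 \<le> (\<Sum>x\<in>D. f (x0 - x + y))" using x by simp
        then show ?thesis using x0 True by (simp add: s_def field_simps)
      next
        case False
        then show ?thesis using f(2) x0 by (simp add: s_def sum_nonneg)
      qed
    qed
    also have "\<dots> = (2 / s) * (\<Sum>x\<in>D. I (\<lambda>y. f (x0 - x + y)))"
      by (subst I_cmult, subst I_sum) (auto intro: tr)
    also have "\<dots> = 0" using I_translate[OF Cc_continuous[OF f(1)]] I0 by simp
    finally have "measure \<mu> K = 0" using measure_nonneg[of \<mu> K] by linarith
    moreover have "emeasure \<mu> K \<noteq> \<infinity>" using emeasure_compact[OF K] by simp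
    ultimately show ?thesis by (simp add: emeasure_eq_ennreal_measure)
  qed
  have "emeasure \<mu> UNIV = (SUP K\<in>{K. compact K \<and> K \<subseteq> UNIV}. emeasure \<mu> K)"
    using haar unfolding left_haar_measure_def by blast
  also have "\<dots> = 0" using null by (intro antisym SUP_least) auto
  finally show False using haar by (simp add: left_haar_measure_def)
qed

lemma Cc_narrow:
  assumes "open U" "(0 :: 'a) \<in> U"
  obtains f where "f \<in> Cc" "\<And>y. 0 \<le> f y" "I f = 1" "\<And>y. y \<notin> U \<Longrightarrow> f y = 0"
proof -
  obtain f where f: "f \<in> Cc" "\<And>y. 0 \<le> f y" "f (0::'a) = 1" "\<And>y. y \<notin> U \<Longrightarrow> f y = 0"
    using Cc_bump[OF assms] by metis
  have p: "0 < I f" by (rule I_pos[OF f(1,2), of 0]) (simp add: f(3))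
  show ?thesis
    by (rule that[OF Cc_cmult[OF f(1), of "1 / I f"]]) (use f p in auto)
qed

text \<open>
  The nodes and weights depend only on \<open>a\<close> and the neighbourhoods \<open>U\<close>, not on \<open>\<phi>\<close>. All exchanges of
  integrals with other limits below are obtained from this uniformity. It stands in for the theorems of
  Fubini and Bochner, which are not directly applicable: the measure need not be \<open>\<sigma>\<close>-finite, and
  the Borel sets of the product may exceed the product of the Borel sets.
\<close>

lemma riemann_sum:
  assumes a: "a \<in> Cc" and K: "compact K" "\<And>x. x \<notin> K \<Longrightarrow> a x = 0"
    and U: "\<And>w. open (U w)" "\<And>w. w \<in> U w"
  shows "\<exists>W c. finite W \<and> W \<subseteq> K \<and> (\<forall>\<phi> e. continuous_on UNIV \<phi> \<longrightarrow>
      (\<forall>w\<in>W. \<forall>y\<in>U w. \<bar>\<phi> y - \<phi> w\<bar> \<le> e) \<longrightarrow>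
      \<bar>I (\<lambda>x. a x * \<phi> x) - (\<Sum>w\<in>W. c w * \<phi> w)\<bar> \<le> e * I (\<lambda>x. \<bar>a x\<bar>))"
proof -
  obtain D where DK: "D \<subseteq> K" and D: "finite D" "K \<subseteq> (\<Union>w\<in>D. U w)"
  proof (rule compactE_image[OF K(1), of K U])
    show "open (U w)" for w by (rule U(1))
    show "K \<subseteq> (\<Union>w\<in>K. U w)" using U(2) by auto
  qed
  have intg: "integrable \<mu> (\<lambda>x. indicator A x * f x)" if "f \<in> Cc" "A \<in> sets borel" for A and f :: "'a \<Rightarrow> real"
    using integrable_mult_indicator[OF _ integrable_Cc[OF that(1)], of A] that(2) by (simp add: sets_\<mu>)
  define Q where "Q W A c \<longleftrightarrow> (\<forall>\<phi> e. continuous_on UNIV \<phi> \<longrightarrow> (\<forall>w\<in>W. \<forall>y\<in>U w. \<bar>\<phi> y - \<phi> w\<bar> \<le> e) \<longrightarrow>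
      \<bar>I (\<lambda>x. indicator A x * (a x * \<phi> x)) - (\<Sum>w\<in>W. c w * \<phi> w)\<bar> \<le> e * I (\<lambda>x. indicator A x * \<bar>a x\<bar>))"
    for W A and c :: "'a \<Rightarrow> real"
  have main: "\<exists>c. Q W A c"
    if "finite W" "A \<in> sets borel" "A \<subseteq> (\<Union>w\<in>W. U w)" for W A
    using that
  proof (induction W arbitrary: A rule: finite_induct)
    case empty
    then have "A = {}" by simp
    then show ?case by (simp add: Q_def)
  next
    case (insert w W)
    define A1 where "A1 = A \<inter> U w"
    define A2 where "A2 = A - U w"
    have A: "A1 \<in> sets borel" "A2 \<in> sets borel" using insert.prems U(1) by (auto simp: A1_def A2_def)
    have "A2 \<subseteq> (\<Union>w\<in>W. U w)" using insert.prems by (auto simp: A2_def)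
    from insert.IH[OF A(2) this] obtain c where c: "Q W A2 c" by blast
    have split: "I (\<lambda>x. indicator A x * f x) = I (\<lambda>x. indicator A1 x * f x) + I (\<lambda>x. indicator A2 x * f x)"
      if "f \<in> Cc" for f :: "'a \<Rightarrow> real"
    proof -
      have "indicator A x * f x = indicator A1 x * f x + indicator A2 x * f x" for x
        by (auto simp: A1_def A2_def indicator_def)
      then show ?thesis using intg[OF that] A by simp
    qed
    \<comment> \<open>the part of the domain inside \<open>U w\<close> contributes to the weight of the node \<open>w\<close>\<close>
    define c' where "c' = c(w := I (\<lambda>x. indicator A1 x * a x))"
    have "\<bar>I (\<lambda>x. indicator A x * (a x * \<phi> x)) - (\<Sum>w\<in>insert w W. c' w * \<phi> w)\<bar> \<le> e * I (\<lambda>x. indicator A x * \<bar>a x\<bar>)"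
      if \<phi>: "continuous_on UNIV \<phi>" and le: "\<forall>v\<in>insert w W. \<forall>y\<in>U v. \<bar>\<phi> y - \<phi> v\<bar> \<le> e" for \<phi> e
    proof -
      have aphi: "(\<lambda>x. a x * \<phi> x) \<in> Cc" by (rule Cc_mult[OF a \<phi>])
      have s: "(\<Sum>w\<in>insert w W. c' w * \<phi> w) = I (\<lambda>x. indicator A1 x * a x) * \<phi> w + (\<Sum>w\<in>W. c w * \<phi> w)"
        using insert.hyps by (auto simp: c'_def intro!: sum.cong)
      have "I (\<lambda>x. indicator A1 x * (a x * \<phi> x)) - I (\<lambda>x. indicator A1 x * a x) * \<phi> w
          = I (\<lambda>x. indicator A1 x * (a x * \<phi> x) - indicator A1 x * a x * \<phi> w)"
        using intg[OF aphi A(1)] intg[OF a A(1)] by simp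
      also have "\<bar>\<dots>\<bar> \<le> I (\<lambda>x. \<bar>indicator A1 x * (a x * \<phi> x) - indicator A1 x * a x * \<phi> w\<bar>)"
        by (rule I_abs)
      also have "\<dots> \<le> I (\<lambda>x. e * (indicator A1 x * \<bar>a x\<bar>))"
      proof (rule integral_mono)
        show "integrable \<mu> (\<lambda>x. \<bar>indicator A1 x * (a x * \<phi> x) - indicator A1 x * a x * \<phi> w\<bar>)"
          using intg[OF aphi A(1)] intg[OF a A(1)] by simp
        show "integrable \<mu> (\<lambda>x. e * (indicator A1 x * \<bar>a x\<bar>))"
          using intg[OF Cc_abs[OF a] A(1)] by simp
        fix x
        show "\<bar>indicator A1 x * (a x * \<phi> x) - indicator A1 x * a x * \<phi> w\<bar> \<le> e * (indicator A1 x * \<bar>a x\<bar>)"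
        proof (cases "x \<in> A1")
          case True
          then have "\<bar>\<phi> x - \<phi> w\<bar> \<le> e" using le by (auto simp: A1_def)
          then have "\<bar>a x\<bar> * \<bar>\<phi> x - \<phi> w\<bar> \<le> \<bar>a x\<bar> * e" by (rule mult_left_mono) simp
          then show ?thesis using True by (simp add: abs_mult[symmetric] algebra_simps)
        qed simp
      qed
      finally have 1: "\<bar>I (\<lambda>x. indicator A1 x * (a x * \<phi> x)) - I (\<lambda>x. indicator A1 x * a x) * \<phi> w\<bar>
          \<le> e * I (\<lambda>x. indicator A1 x * \<bar>a x\<bar>)" by simp
      have 2: "\<bar>I (\<lambda>x. indicator A2 x * (a x * \<phi> x)) - (\<Sum>w\<in>W. c w * \<phi> w)\<bar> \<le> e * I (\<lambda>x. indicator A2 x * \<bar>a x\<bar>)"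
        using c[unfolded Q_def, rule_format, OF \<phi>] le by blast
      show ?thesis
        unfolding s split[OF aphi] split[OF Cc_abs[OF a]] distrib_left using 1 2 by linarith
    qed
    then have "Q (insert w W) A c'" unfolding Q_def by blast
    then show ?case by blast
  qed
  have KU: "K \<in> sets borel" using K(1) by (simp add: compact_imp_closed)
  from main[OF D(1) KU D(2)] obtain c where c: "Q D K c" by blast
  have e1: "(\<lambda>x. indicator K x * (a x * \<phi> x)) = (\<lambda>x. a x * \<phi> x)" for \<phi>
    using K(2) by (auto simp: fun_eq_iff indicator_def)
  have e2: "(\<lambda>x. indicator K x * \<bar>a x\<bar>) = (\<lambda>x. \<bar>a x\<bar>)"
    using K(2) by (auto simp: fun_eq_iff indicator_def)
  show ?thesis
    using D(1) DK c[unfolded Q_def e1 e2] by blast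
qed

lemma I_param_continuous:
  fixes F :: "'a \<Rightarrow> 'b::topological_space \<Rightarrow> real"
  assumes b: "b \<in> Cc" and F: "continuous_on UNIV (\<lambda>(w, g). F w g)"
  shows "continuous_on UNIV (\<lambda>g. I (\<lambda>w. b w * F w g))"
proof -
  obtain K where K: "compact K" "\<And>x. x \<notin> K \<Longrightarrow> b x = 0" using b Cc_support by blast
  have cF: "continuous_on S (\<lambda>x. F (p x) (q x))" if "continuous_on S p" "continuous_on S q"
    for S :: "'z::topological_space set" and p q
    using continuous_on_compose2[OF F continuous_on_Pair[OF that]] by simp
  have bF: "(\<lambda>w. b w * F w g) \<in> Cc" for g by (rule Cc_mult[OF b cF]) (auto intro: continuous_intros)
  have "((\<lambda>g. I (\<lambda>w. b w * F w g)) \<longlongrightarrow> I (\<lambda>w. b w * F w g0)) (at g0)" for g0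
  proof (rule tendstoI)
    fix e :: real assume e: "e > 0"
    define d where "d = e / 2 / (I (\<lambda>w. \<bar>b w\<bar>) + 1)"
    have nn: "0 \<le> I (\<lambda>w. \<bar>b w\<bar>)" by (rule I_nonneg) simp
    have d: "d > 0" using e nn by (auto simp: d_def add_nonneg_pos)
    have cont: "continuous_on UNIV (\<lambda>(g, w). \<bar>F w g - F w g0\<bar>)"
      unfolding split_beta by (intro continuous_intros cF)
    obtain U where U: "open U" "g0 \<in> U" "\<And>g w. g \<in> U \<Longrightarrow> w \<in> K \<Longrightarrow> \<bar>F w g - F w g0\<bar> < d"
      by (rule compact_uniform_nbhd[OF K(1) cont, of g0 d]) (use d in auto)
    have "dist (I (\<lambda>w. b w * F w g)) (I (\<lambda>w. b w * F w g0)) < e" if g: "g \<in> U" for g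
    proof -
      have "\<bar>I (\<lambda>w. b w * F w g) - I (\<lambda>w. b w * F w g0)\<bar> \<le> I (\<lambda>w. d * \<bar>b w\<bar>)"
      proof (rule I_diff_le[OF bF bF Cc_cmult[OF Cc_abs[OF b]]])
        fix w
        show "\<bar>b w * F w g - b w * F w g0\<bar> \<le> d * \<bar>b w\<bar>"
        proof (cases "w \<in> K")
          case True
          then have "\<bar>b w\<bar> * \<bar>F w g - F w g0\<bar> \<le> \<bar>b w\<bar> * d"
            using U(3)[OF g True] by (intro mult_left_mono) auto
          then show ?thesis by (simp add: abs_mult[symmetric] algebra_simps)
        next
          case False
          then show ?thesis using K(2) by simp
        qed
      qed
      also have "\<dots> = d * I (\<lambda>w. \<bar>b w\<bar>)" by simp
      also have "\<dots> \<le> d * (I (\<lambda>w. \<bar>b w\<bar>) + 1)" using d by (intro mult_left_mono) auto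
      also have "\<dots> = e / 2"
      proof -
        have "I (\<lambda>w. \<bar>b w\<bar>) + 1 \<noteq> 0" using nn by linarith
        then show ?thesis unfolding d_def by (rule nonzero_eq_divide_eq[THEN iffD1]) simp
      qed
      finally show ?thesis using e by (simp add: dist_real_def)
    qed
    then show "\<forall>\<^sub>F g in at g0. dist (I (\<lambda>w. b w * F w g)) (I (\<lambda>w. b w * F w g0)) < e"
      unfolding eventually_at_topological using U by blast
  qed
  then show ?thesis by (simp add: continuous_on_def)
qed

lemma eq_if_close: "(\<And>e. e > 0 \<Longrightarrow> \<bar>x - y\<bar> \<le> C * e) \<Longrightarrow> x = (y :: real)"
proof (rule ccontr)
  assume *: "\<And>e. e > 0 \<Longrightarrow> \<bar>x - y\<bar> \<le> C * e" and "x \<noteq> y"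
  then have p: "\<bar>x - y\<bar> > 0" by simp
  define D where "D = \<bar>C\<bar> + 1"
  have "D > 0" by (simp add: D_def add_nonneg_pos)
  have "\<bar>x - y\<bar> \<le> C * (\<bar>x - y\<bar> / (2 * D))" using p \<open>D > 0\<close> by (intro *) simp
  also have "\<dots> \<le> D * (\<bar>x - y\<bar> / (2 * D))" using p \<open>D > 0\<close> by (intro mult_right_mono) (auto simp: D_def)
  also have "\<dots> = \<bar>x - y\<bar> / 2" using \<open>D > 0\<close> by simp
  finally show False using p by simp
qed

text \<open>
  Replacing the integral over \<open>w\<close> by one Riemann sum, chosen so that \<open>F\<close> varies little in \<open>w\<close> uniformly for
  \<open>y\<close> in the support of \<open>a\<close>, changes both sides by little and makes them equal.
\<close>

lemma I_swap:
  assumes a: "a \<in> Cc" and b: "b \<in> Cc" and F: "continuous_on UNIV (\<lambda>(w, y). F w y)"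
  shows "I (\<lambda>w. b w * I (\<lambda>y. a y * F w y)) = I (\<lambda>y. a y * I (\<lambda>w. b w * F w y))"
proof -
  obtain K where K: "compact K" "\<And>x. x \<notin> K \<Longrightarrow> a x = 0" using a Cc_support by blast
  obtain L where L: "compact L" "\<And>x. x \<notin> L \<Longrightarrow> b x = 0" using b Cc_support by blast
  have cF: "continuous_on S (\<lambda>x. F (p x) (q x))" if "continuous_on S p" "continuous_on S q"
    for S :: "'z::topological_space set" and p q
    using continuous_on_compose2[OF F continuous_on_Pair[OF that]] by simp
  have aF: "(\<lambda>y. a y * F w y) \<in> Cc" for w by (rule Cc_mult[OF a cF]) (auto intro: continuous_intros)
  have cont\<Psi>: "continuous_on UNIV (\<lambda>w. I (\<lambda>y. a y * F w y))"
    by (rule I_param_continuous[OF a]) (unfold split_beta, intro cF continuous_intros)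
  have cont2: "continuous_on UNIV (\<lambda>y. I (\<lambda>w. b w * F w y))"
    by (rule I_param_continuous[OF b F])
  define Ia where "Ia = I (\<lambda>x. \<bar>a x\<bar>)"
  define Ib where "Ib = I (\<lambda>x. \<bar>b x\<bar>)"
  show ?thesis
  proof (rule eq_if_close[where C = "2 * Ia * Ib"])
    fix e :: real assume e: "e > 0"
    have "\<exists>U. open U \<and> w \<in> U \<and> (\<forall>w'\<in>U. \<forall>y\<in>K. \<bar>F w' y - F w y\<bar> < e)" for w
    proof -
      have cont: "continuous_on UNIV (\<lambda>(w', y). \<bar>F w' y - F w y\<bar>)"
        unfolding split_beta by (intro continuous_intros cF)
      obtain U where "open U" "w \<in> U" "\<And>w' y. w' \<in> U \<Longrightarrow> y \<in> K \<Longrightarrow> \<bar>F w' y - F w y\<bar> < e"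
        by (rule compact_uniform_nbhd[OF K(1) cont, of w e]) (use e in auto)
      then show ?thesis by blast
    qed
    then obtain U where U: "\<And>w. open (U w)" "\<And>w. w \<in> U w"
      "\<And>w w' y. w' \<in> U w \<Longrightarrow> y \<in> K \<Longrightarrow> \<bar>F w' y - F w y\<bar> < e" by metis
    obtain W c where W: "finite W" and R0: "\<forall>\<phi> e. continuous_on UNIV \<phi> \<longrightarrow>
      (\<forall>w\<in>W. \<forall>y\<in>U w. \<bar>\<phi> y - \<phi> w\<bar> \<le> e) \<longrightarrow>
      \<bar>I (\<lambda>x. b x * \<phi> x) - (\<Sum>w\<in>W. c w * \<phi> w)\<bar> \<le> e * Ib"
      using riemann_sum[where K = L and U = U, OF b L U(1,2)] unfolding Ib_def by blast
    note R = R0[rule_format]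
    define S where "S = (\<Sum>w\<in>W. c w * I (\<lambda>y. a y * F w y))"
    have 1: "\<bar>I (\<lambda>w. b w * I (\<lambda>y. a y * F w y)) - S\<bar> \<le> (e * Ia) * Ib"
      unfolding S_def
    proof (rule R[OF cont\<Psi>])
      fix w w' assume w': "w' \<in> U w"
      have "\<bar>I (\<lambda>y. a y * F w' y) - I (\<lambda>y. a y * F w y)\<bar> \<le> I (\<lambda>y. e * \<bar>a y\<bar>)"
      proof (rule I_diff_le[OF aF aF Cc_cmult[OF Cc_abs[OF a]]])
        fix y
        show "\<bar>a y * F w' y - a y * F w y\<bar> \<le> e * \<bar>a y\<bar>"
        proof (cases "y \<in> K")
          case True
          then have "\<bar>a y\<bar> * \<bar>F w' y - F w y\<bar> \<le> \<bar>a y\<bar> * e"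
            using U(3)[OF w' True] by (intro mult_left_mono) auto
          then show ?thesis by (simp add: abs_mult[symmetric] algebra_simps)
        qed (use K(2) in simp)
      qed
      then show "\<bar>I (\<lambda>y. a y * F w' y) - I (\<lambda>y. a y * F w y)\<bar> \<le> e * Ia" by (simp add: Ia_def)
    qed
    have S: "S = I (\<lambda>y. a y * (\<Sum>w\<in>W. c w * F w y))"
    proof -
      have "I (\<lambda>y. \<Sum>w\<in>W. c w * (a y * F w y)) = S"
        unfolding S_def by (subst I_sum) (auto intro: Cc_cmult aF)
      then show ?thesis by (simp add: sum_distrib_left mult_ac)
    qed
    have 2: "\<bar>I (\<lambda>y. a y * I (\<lambda>w. b w * F w y)) - S\<bar> \<le> e * Ib * Ia"
    proof -
      have C1: "(\<lambda>y. a y * I (\<lambda>w. b w * F w y)) \<in> Cc" by (rule Cc_mult[OF a cont2])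
      have C2: "(\<lambda>y. a y * (\<Sum>w\<in>W. c w * F w y)) \<in> Cc"
        by (rule Cc_mult[OF a]) (intro continuous_intros cF)
      have "\<bar>I (\<lambda>y. a y * I (\<lambda>w. b w * F w y)) - S\<bar> \<le> I (\<lambda>y. (e * Ib) * \<bar>a y\<bar>)"
        unfolding S
      proof (rule I_diff_le[OF C1 C2 Cc_cmult[OF Cc_abs[OF a]]])
        fix y
        show "\<bar>a y * I (\<lambda>w. b w * F w y) - a y * (\<Sum>w\<in>W. c w * F w y)\<bar> \<le> (e * Ib) * \<bar>a y\<bar>"
        proof (cases "y \<in> K")
          case True
          have "\<bar>I (\<lambda>w. b w * F w y) - (\<Sum>w\<in>W. c w * F w y)\<bar> \<le> e * Ib"
            by (rule R) (use U(3)[OF _ True] in \<open>auto intro!: cF continuous_intros less_imp_le\<close>)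
          then have "\<bar>a y\<bar> * \<bar>I (\<lambda>w. b w * F w y) - (\<Sum>w\<in>W. c w * F w y)\<bar> \<le> \<bar>a y\<bar> * (e * Ib)"
            by (intro mult_left_mono) auto
          then show ?thesis by (simp add: abs_mult[symmetric] algebra_simps)
        qed (use K(2) in simp)
      qed
      then show ?thesis by (simp add: Ia_def)
    qed
    show "\<bar>I (\<lambda>w. b w * I (\<lambda>y. a y * F w y)) - I (\<lambda>y. a y * I (\<lambda>w. b w * F w y))\<bar> \<le> 2 * Ia * Ib * e"
      using 1 2 by (simp add: mult_ac)
  qed
qed

lemma L1_translate_continuous:
  assumes a: "a \<in> Cc" and e: "e > 0"
  obtains U where "open U" "(0::'a) \<in> U" "\<And>z. z \<in> U \<Longrightarrow> I (\<lambda>y. \<bar>a (z + y) - a y\<bar>) \<le> e"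
proof -
  obtain K where K: "compact K" "\<And>x. x \<notin> K \<Longrightarrow> a x = 0" using a Cc_support by blast
  obtain V N where V: "open V" "compact N" "(0::'a) \<in> V" "V \<subseteq> N" by (rule compact_nbhd)
  define L where "L = (\<lambda>(z, y). - z + y) ` (N \<times> K) \<union> K"
  have L: "compact L"
    unfolding L_def split_beta using V K by (intro compact_Un compact_continuous_image compact_Times continuous_intros) auto
  define d where "d = e / (measure \<mu> L + 1)"
  have d: "d > 0" using e by (simp add: d_def add_nonneg_pos)
  obtain U where U: "open U" "0 \<in> U" "\<And>z y. z \<in> U \<Longrightarrow> \<bar>a (z + y) - a y\<bar> < d"
    using Cc_left_uniform[OF a d] by metis
  show ?thesis
  proof (rule that[of "U \<inter> V"])
    show "open (U \<inter> V)" "0 \<in> U \<inter> V" using U V by auto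
    fix z assume z: "z \<in> U \<inter> V"
    have "I (\<lambda>y. \<bar>a (z + y) - a y\<bar>) \<le> d * measure \<mu> L"
    proof (rule I_small[OF _ L])
      show "(\<lambda>y. a (z + y) - a y) \<in> Cc" by (intro Cc_diff Cc_translate a)
      show "\<bar>a (z + y) - a y\<bar> \<le> d" for y using U(3)[of z y] z by auto
      fix y assume y: "y \<notin> L"
      have "z + y \<notin> K"
      proof
        assume "z + y \<in> K"
        then have "- z + (z + y) \<in> L" using z V(4) unfolding L_def by force
        then show False using y by (simp add: add.assoc[symmetric])
      qed
      moreover have "y \<notin> K" using y by (simp add: L_def)
      ultimately show "a (z + y) - a y = 0" using K by simp
    qed
    also have "\<dots> \<le> d * (measure \<mu> L + 1)" using d by (intro mult_left_mono) auto
    also have "\<dots> = e"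
    proof -
      have "measure \<mu> L + 1 \<noteq> 0" using measure_nonneg[of \<mu> L] by linarith
      then show ?thesis unfolding d_def by (rule nonzero_eq_divide_eq[THEN iffD1]) simp
    qed
    finally show "I (\<lambda>y. \<bar>a (z + y) - a y\<bar>) \<le> e" .
  qed
qed

end


section \<open>Separation by linear functionals\<close>

definition sublinear_on :: "(real \<Rightarrow> 'v \<Rightarrow> 'v) \<Rightarrow> 'v::ab_group_add set \<Rightarrow> ('v \<Rightarrow> real) \<Rightarrow> bool" where
  "sublinear_on sc S q \<longleftrightarrow> (\<forall>v\<in>S. \<forall>w\<in>S. q (v + w) \<le> q v + q w) \<and>
     (\<forall>t\<ge>0. \<forall>v\<in>S. q (sc t v) = t * q v)"

locale real_subspace = vector_space scale
  for scale :: "real \<Rightarrow> 'v::ab_group_add \<Rightarrow> 'v" +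
  fixes S :: "'v set"
  assumes sub: "subspace S"
begin

lemma S_closed [simp, intro]:
  "0 \<in> S" "\<lbrakk>v \<in> S; w \<in> S\<rbrakk> \<Longrightarrow> v + w \<in> S" "v \<in> S \<Longrightarrow> scale c v \<in> S" "v \<in> S \<Longrightarrow> - v \<in> S"
  using sub by (auto intro: subspace_0 subspace_add subspace_scale subspace_neg)

abbreviation "sublin \<equiv> sublinear_on scale S"

lemma sublinD:
  assumes "sublin q"
  shows "v \<in> S \<Longrightarrow> w \<in> S \<Longrightarrow> q (v + w) \<le> q v + q w"
    and "0 \<le> t \<Longrightarrow> v \<in> S \<Longrightarrow> q (scale t v) = t * q v"
    and "q 0 = 0"
    and "v \<in> S \<Longrightarrow> - q (- v) \<le> q v"
proof -
  show 1: "v \<in> S \<Longrightarrow> w \<in> S \<Longrightarrow> q (v + w) \<le> q v + q w" for v w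
    using assms by (auto simp: sublinear_on_def)
  show "0 \<le> t \<Longrightarrow> v \<in> S \<Longrightarrow> q (scale t v) = t * q v"
    using assms by (auto simp: sublinear_on_def)
  have "\<forall>t\<ge>0. \<forall>v\<in>S. q (scale t v) = t * q v" using assms by (simp add: sublinear_on_def)
  then have "q (scale 0 0) = 0 * q 0" by (meson S_closed(1) order_refl)
  then show 3: "q 0 = 0" by simp
  show "v \<in> S \<Longrightarrow> - q (- v) \<le> q v" using 1[of v "- v"] 3 by simp
qed

text \<open>
  The functional \<open>r(v) = inf (q(v + t c) - t d)\<close> over \<open>t \<ge> 0\<close> and \<open>c \<in> C\<close>; convexity of \<open>C\<close> gives its
  subadditivity and the bound on \<open>C\<close> its finiteness. It is used with \<open>C = {x}\<close> and \<open>d = q x\<close> to show that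
  minimal sublinear functionals are linear, and with a convex set away from the origin for separation.
\<close>

lemma sublinear_reduce:
  assumes q: "sublin q" and C: "C \<subseteq> S" "C \<noteq> {}"
    and conv: "\<And>c c' t. c \<in> C \<Longrightarrow> c' \<in> C \<Longrightarrow> 0 \<le> t \<Longrightarrow> t \<le> 1 \<Longrightarrow> scale t c + scale (1 - t) c' \<in> C"
    and d: "\<And>c. c \<in> C \<Longrightarrow> d \<le> q c"
  obtains r where "sublin r" "\<And>v. v \<in> S \<Longrightarrow> r v \<le> q v" "\<And>c. c \<in> C \<Longrightarrow> r (- c) \<le> - d" "\<And>v. v \<notin> S \<Longrightarrow> r v = 0"
proof -
  define A where "A v = {q (v + scale t c) - t * d | t c. 0 \<le> t \<and> c \<in> C}" for v
  define r where "r v = (if v \<in> S then Inf (A v) else 0)" for v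
  have lower: "- q (- v) \<le> x" if "x \<in> A v" "v \<in> S" for x v
  proof -
    obtain t c where tc: "0 \<le> t" "c \<in> C" "x = q (v + scale t c) - t * d" using \<open>x \<in> A v\<close> by (auto simp: A_def)
    have c: "c \<in> S" using tc C by auto
    have "t * d \<le> q (scale t c)" using sublinD(2)[OF q tc(1) c] d[OF tc(2)] tc(1) by (simp add: mult_left_mono)
    also have "\<dots> = q ((v + scale t c) + - v)" by simp
    also have "\<dots> \<le> q (v + scale t c) + q (- v)" using that c by (intro sublinD(1)[OF q]) auto
    finally show ?thesis using tc by simp
  qed
  have bdd: "bdd_below (A v)" if "v \<in> S" for v using lower[OF _ that] by (rule bdd_belowI)
  obtain c0 where c0: "c0 \<in> C" using C by auto
  have mem: "q v \<in> A v" for v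
    unfolding A_def using c0 by (intro CollectI exI[of _ 0] exI[of _ c0]) auto
  then have ne: "A v \<noteq> {}" for v by auto
  have r_le: "r v \<le> x" if "v \<in> S" "x \<in> A v" for v x
    using that bdd by (simp add: r_def cInf_lower)
  have r_ge: "y \<le> r v" if "v \<in> S" "\<And>x. x \<in> A v \<Longrightarrow> y \<le> x" for v y
    using that ne by (simp add: r_def cInf_greatest)
  have scal: "s * x \<in> A (scale s v)" if "x \<in> A v" "0 < s" "v \<in> S" for s x v
  proof -
    obtain t c where tc: "0 \<le> t" "c \<in> C" "x = q (v + scale t c) - t * d" using \<open>x \<in> A v\<close> by (auto simp: A_def)
    have "c \<in> S" using tc C by auto
    then have "q (scale s (v + scale t c)) = s * q (v + scale t c)"
      using that by (intro sublinD(2)[OF q]) auto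
    then have "s * x = q (scale s v + scale (s * t) c) - (s * t) * d"
      by (simp add: tc(3) scale_right_distrib right_diff_distrib mult.assoc)
    then show ?thesis unfolding A_def using tc(1,2) that(2)
      by (intro CollectI exI[of _ "s * t"] exI[of _ c]) simp
  qed
  show ?thesis
  proof
    show "r v \<le> q v" if "v \<in> S" for v using r_le[OF that mem] .
    show "r v = 0" if "v \<notin> S" for v using that by (simp add: r_def)
    show "r (- c) \<le> - d" if "c \<in> C" for c
    proof (rule r_le)
      show "- c \<in> S" using that C by auto
      show "- d \<in> A (- c)"
        unfolding A_def using that sublinD(3)[OF q] by (intro CollectI exI[of _ 1] exI[of _ c]) simp
    qed
    show "sublin r"
      unfolding sublinear_on_def
    proof (intro conjI ballI allI impI)
      fix v w assume v: "v \<in> S" and w: "w \<in> S"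
      have sum: "r (v + w) \<le> x + y" if x: "x \<in> A v" and y: "y \<in> A w" for x y
      proof -
        obtain t c where tc: "0 \<le> t" "c \<in> C" "x = q (v + scale t c) - t * d" using x by (auto simp: A_def)
        obtain s b where sb: "0 \<le> s" "b \<in> C" "y = q (w + scale s b) - s * d" using y by (auto simp: A_def)
        obtain e where e: "e \<in> C" "scale (t + s) e = scale t c + scale s b"
        proof (cases "t + s = 0")
          case True
          then have "t = 0" "s = 0" using tc sb by auto
          then show ?thesis using that[of c] tc by simp
        next
          case False
          then have p: "t + s > 0" using tc sb by simp
          show ?thesis
          proof (rule that)
            have "1 - t / (t + s) = s / (t + s)" using p by (simp add: field_simps)
            then show "scale (t / (t + s)) c + scale (s / (t + s)) b \<in> C"
              using conv[of c b "t / (t + s)"] tc sb p by simp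
            show "scale (t + s) (scale (t / (t + s)) c + scale (s / (t + s)) b) = scale t c + scale s b"
              using False by (simp add: scale_right_distrib)
          qed
        qed
        have "r (v + w) \<le> q (v + w + scale (t + s) e) - (t + s) * d"
          using v w e tc sb by (intro r_le) (auto simp: A_def intro!: exI[of _ "t + s"] exI[of _ e])
        also have "v + w + scale (t + s) e = (v + scale t c) + (w + scale s b)"
          unfolding e(2) by (simp add: algebra_simps)
        also have "q \<dots> \<le> q (v + scale t c) + q (w + scale s b)"
          using v w tc sb C by (intro sublinD(1)[OF q]) auto
        finally show ?thesis using tc sb by (simp add: algebra_simps)
      qed
      have "r (v + w) - r v \<le> y" if y: "y \<in> A w" for y
      proof -
        have "r (v + w) - y \<le> r v"
          by (rule r_ge[OF v]) (use sum[OF _ y] in \<open>simp only: diff_le_eq\<close>)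
        then show ?thesis by linarith
      qed
      then have "r (v + w) - r v \<le> r w" by (rule r_ge[OF w])
      then show "r (v + w) \<le> r v + r w" by simp
    next
      fix t :: real and v assume t: "0 \<le> t" and v: "v \<in> S"
      show "r (scale t v) = t * r v"
      proof (cases "t = 0")
        case True
        have "r 0 \<le> 0" using r_le[of 0 "q 0"] mem[of 0] sublinD(3)[OF q] by simp
        moreover have "0 \<le> r 0" using lower[of _ 0] sublinD(3)[OF q] by (intro r_ge) auto
        ultimately show ?thesis using True by simp
      next
        case False
        then have tp: "t > 0" using t by simp
        have "r (scale t v) / t \<le> r v"
        proof (rule r_ge[OF v])
          fix x assume "x \<in> A v"
          then have "r (scale t v) \<le> t * x" using v tp by (intro r_le scal) auto
          then show "r (scale t v) / t \<le> x" using tp by (simp add: field_simps)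
        qed
        moreover have "t * r v \<le> r (scale t v)"
        proof (rule r_ge)
          show "scale t v \<in> S" using v by auto
          fix x assume "x \<in> A (scale t v)"
          then have "1 / t * x \<in> A (scale (1 / t) (scale t v))" using tp v by (intro scal) auto
          then have "r v \<le> 1 / t * x" using v tp by (intro r_le) auto
          then show "t * r v \<le> x" using tp by (simp add: field_simps)
        qed
        ultimately show ?thesis using tp by (simp add: field_simps)
      qed
    qed
  qed
qed

text \<open>
  The Hahn--Banach theorem in the form: a minimal sublinear functional, which exists by Zorn's lemma,
  is linear. Requiring the value \<open>0\<close> outside \<open>S\<close> makes the pointwise order antisymmetric.
\<close>

lemma linear_below_sublinear:
  assumes p: "sublin p"
  obtains L where "\<And>v w. v \<in> S \<Longrightarrow> w \<in> S \<Longrightarrow> L (v + w) = L v + L w"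
    "\<And>t v. v \<in> S \<Longrightarrow> L (scale t v) = t * L v" "\<And>v. v \<in> S \<Longrightarrow> L v \<le> (p v :: real)"
proof -
  define Q where "Q = {q. sublin q \<and> (\<forall>v\<in>S. q v \<le> p v) \<and> (\<forall>v. v \<notin> S \<longrightarrow> q v = 0)}"
  define R where "R q q' \<longleftrightarrow> (\<forall>v. q' v \<le> (q v :: real))" for q q' :: "'v \<Rightarrow> real"
  have Q0: "(\<lambda>v. if v \<in> S then p v else 0) \<in> Q"
    using p by (auto simp: Q_def sublinear_on_def)
  have "\<exists>m\<in>Q. \<forall>a\<in>Q. R m a \<longrightarrow> a = m"
  proof (rule predicate_Zorn)
    show "partial_order_on Q (relation_of R Q)"
      by (rule partial_order_on_relation_ofI) (auto simp: R_def fun_eq_iff intro: order_trans antisym)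
    fix C assume "C \<in> Chains (relation_of R Q)"
    then have CQ: "C \<subseteq> Q" and ch: "\<And>a b. a \<in> C \<Longrightarrow> b \<in> C \<Longrightarrow> R a b \<or> R b a"
      by (auto simp: Chains_def relation_of_def)
    show "\<exists>u\<in>Q. \<forall>a\<in>C. R a u"
    proof (cases "C = {}")
      case True
      then show ?thesis using Q0 by auto
    next
      case ne: False
      define r where "r v = (if v \<in> S then (INF q\<in>C. q v) else 0)" for v
      have lower: "- p (- v) \<le> q v" if "q \<in> C" "v \<in> S" for q v
      proof -
        have "sublin q" "q (- v) \<le> p (- v)" using that CQ by (auto simp: Q_def)
        then show ?thesis using sublinD(4)[of q v] that by simp
      qed
      have bdd: "bdd_below ((\<lambda>q. q v) ` C)" if "v \<in> S" for v
        using lower that by (intro bdd_belowI2) auto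
      have r_le: "r v \<le> q v" if "v \<in> S" "q \<in> C" for v q
        using cINF_lower[OF bdd[OF that(1)] that(2)] that(1) by (simp add: r_def)
      have r_ge: "y \<le> r v" if "v \<in> S" "\<And>q. q \<in> C \<Longrightarrow> y \<le> q v" for v y
        using that ne by (simp add: r_def cINF_greatest)
      have "sublin r"
        unfolding sublinear_on_def
      proof (intro conjI ballI allI impI)
        fix v w assume v: "v \<in> S" and w: "w \<in> S"
        have sum: "r (v + w) \<le> q v + q' w" if q: "q \<in> C" and q': "q' \<in> C" for q q'
        proof -
          have "\<exists>m\<in>C. m v \<le> q v \<and> m w \<le> q' w" using ch[OF q q'] q q' by (auto simp: R_def)
          then obtain m where m: "m \<in> C" "m v \<le> q v" "m w \<le> q' w" by blast
          have "r (v + w) \<le> m (v + w)" using v w m by (intro r_le) auto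
          also have "\<dots> \<le> m v + m w" using m(1) CQ v w by (intro sublinD(1)) (auto simp: Q_def)
          finally show ?thesis using m by simp
        qed
        have "r (v + w) - r v \<le> q' w" if q': "q' \<in> C" for q'
        proof -
          have "r (v + w) - q' w \<le> r v"
            by (rule r_ge[OF v]) (use sum[OF _ q'] in \<open>simp only: diff_le_eq\<close>)
          then show ?thesis by linarith
        qed
        then have "r (v + w) - r v \<le> r w" by (rule r_ge[OF w])
        then show "r (v + w) \<le> r v + r w" by simp
      next
        fix t :: real and v assume t: "0 \<le> t" and v: "v \<in> S"
        have hom: "q (scale t v) = t * q v" if "q \<in> C" for q
          using that CQ t v by (intro sublinD(2)) (auto simp: Q_def)
        show "r (scale t v) = t * r v"
        proof (cases "t = 0")
          case True
          have "r 0 = 0"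
          proof (rule antisym)
            obtain q where "q \<in> C" using ne by auto
            then show "r 0 \<le> 0" using r_le[of 0 q] sublinD(3)[of q] CQ by (auto simp: Q_def)
            show "0 \<le> r 0"
            proof (rule r_ge)
              fix q assume "q \<in> C"
              then have "sublin q" using CQ by (auto simp: Q_def)
              then show "0 \<le> q 0" using sublinD(3)[of q] by simp
            qed simp
          qed
          then show ?thesis using True by simp
        next
          case False
          then have tp: "t > 0" using t by simp
          have "r (scale t v) / t \<le> r v"
          proof (rule r_ge[OF v])
            fix q assume q: "q \<in> C"
            then have "r (scale t v) \<le> t * q v" using v r_le[of "scale t v" q] hom[OF q] by simp
            then show "r (scale t v) / t \<le> q v" using tp by (simp add: field_simps)
          qed
          moreover have "t * r v \<le> r (scale t v)"
          proof (rule r_ge)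
            show "scale t v \<in> S" using v by auto
            fix q assume q: "q \<in> C"
            show "t * r v \<le> q (scale t v)" unfolding hom[OF q] using r_le[OF v q] tp by simp
          qed
          ultimately show ?thesis using tp by (simp add: field_simps)
        qed
      qed
      moreover have "r v \<le> p v" if "v \<in> S" for v
      proof -
        obtain q where q: "q \<in> C" using ne by auto
        then have "q v \<le> p v" using CQ that by (auto simp: Q_def)
        then show ?thesis using r_le[OF that q] by simp
      qed
      ultimately have "r \<in> Q" by (auto simp: Q_def r_def)
      moreover have "R q r" if "q \<in> C" for q
      proof -
        have "r v \<le> q v" for v
        proof (cases "v \<in> S")
          case True
          then show ?thesis using that by (rule r_le)
        next
          case False
          then show ?thesis using that CQ by (auto simp: Q_def r_def)
        qed
        then show ?thesis by (simp add: R_def)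
      qed
      ultimately show ?thesis by blast
    qed
  qed
  then obtain m where m: "m \<in> Q" and min: "\<And>a. a \<in> Q \<Longrightarrow> R m a \<Longrightarrow> a = m" by blast
  have sm: "sublin m" using m by (simp add: Q_def)
  have neg: "m (- x) = - m x" if x: "x \<in> S" for x
  proof -
    have conv: "scale t c + scale (1 - t) c' \<in> {x}" if "c \<in> {x}" "c' \<in> {x}" for c c' t
      using that by (simp add: scale_left_distrib[symmetric])
    obtain r where r: "sublin r" "\<And>v. v \<in> S \<Longrightarrow> r v \<le> m v" "\<And>c. c \<in> {x} \<Longrightarrow> r (- c) \<le> - m x"
        "\<And>v. v \<notin> S \<Longrightarrow> r v = 0"
      by (rule sublinear_reduce[OF sm, of "{x}" "m x"]) (use x conv in auto)
    have mp: "\<And>v. v \<in> S \<Longrightarrow> m v \<le> p v" "\<And>v. v \<notin> S \<Longrightarrow> m v = 0" using m by (auto simp: Q_def)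
    have "r \<in> Q" unfolding Q_def using r(1,2,4) mp by (auto intro: order_trans)
    moreover have "R m r" unfolding R_def
    proof
      fix v show "r v \<le> m v" using r(2,4)[of v] mp(2)[of v] by (cases "v \<in> S") auto
    qed
    ultimately have "r = m" by (rule min)
    then have "m (- x) \<le> - m x" using r(3)[of x] by simp
    then show ?thesis using sublinD(4)[OF sm x] by simp
  qed
  show ?thesis
  proof
    show add: "m (v + w) = m v + m w" if "v \<in> S" "w \<in> S" for v w
    proof (rule antisym)
      show "m (v + w) \<le> m v + m w" using that by (rule sublinD(1)[OF sm])
      have "m (- v + - w) \<le> m (- v) + m (- w)" using that by (intro sublinD(1)[OF sm]) auto
      moreover have "- v + - w = - (v + w)" by simp
      ultimately show "m v + m w \<le> m (v + w)" using that by (simp only: neg S_closed)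
    qed
    show "m (scale t v) = t * m v" if v: "v \<in> S" for t v
    proof (cases "0 \<le> t")
      case True
      then show ?thesis using v by (rule sublinD(2)[OF sm])
    next
      case False
      have "m (- scale (- t) v) = - m (scale (- t) v)" using v by (intro neg) auto
      also have "\<dots> = t * m v" using sublinD(2)[OF sm, of "- t" v] v False by simp
      finally show ?thesis by simp
    qed
    show "m v \<le> p v" if "v \<in> S" for v using m that by (simp add: Q_def)
  qed
qed

theorem separating_functional:
  assumes N: "sublin N" and C: "C \<subseteq> S" "C \<noteq> {}"
    and conv: "\<And>c c' t. c \<in> C \<Longrightarrow> c' \<in> C \<Longrightarrow> 0 \<le> t \<Longrightarrow> t \<le> 1 \<Longrightarrow> scale t c + scale (1 - t) c' \<in> C"
    and d: "\<And>c. c \<in> C \<Longrightarrow> d \<le> N c"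
  obtains L where "\<And>v w. v \<in> S \<Longrightarrow> w \<in> S \<Longrightarrow> L (v + w) = L v + L w"
    "\<And>t v. v \<in> S \<Longrightarrow> L (scale t v) = t * L v" "\<And>v. v \<in> S \<Longrightarrow> L v \<le> N v" "\<And>c. c \<in> C \<Longrightarrow> d \<le> (L c :: real)"
proof -
  obtain r where r: "sublin r" "\<And>v. v \<in> S \<Longrightarrow> r v \<le> N v" "\<And>c. c \<in> C \<Longrightarrow> r (- c) \<le> - d"
    by (rule sublinear_reduce[OF N C conv d]) auto
  obtain L where L: "\<And>v w. v \<in> S \<Longrightarrow> w \<in> S \<Longrightarrow> L (v + w) = L v + L w"
    "\<And>t v. v \<in> S \<Longrightarrow> L (scale t v) = t * L v" "\<And>v. v \<in> S \<Longrightarrow> L v \<le> r v"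
    by (rule linear_below_sublinear[OF r(1)]) auto
  show ?thesis
  proof (rule that[OF L(1,2)])
    show "L v \<le> N v" if "v \<in> S" for v using L(3)[OF that] r(2)[OF that] by simp
    fix c assume c: "c \<in> C"
    then have cS: "c \<in> S" using C by auto
    have "L (- c) = - L c" using L(2)[OF cS, of "-1"] by simp
    then show "d \<le> L c" using L(3)[of "- c"] r(3)[OF c] cS by simp
  qed auto
qed

end


section \<open>Invariant means on continuous functions\<close>

definition BC :: "('a::topological_space \<Rightarrow> real) set" where
  "BC = {f. continuous_on UNIV f \<and> (\<exists>C. \<forall>x. \<bar>f x\<bar> \<le> C)}"

lemma BCI: "continuous_on UNIV f \<Longrightarrow> (\<And>x. \<bar>f x\<bar> \<le> C) \<Longrightarrow> f \<in> BC"
  by (auto simp: BC_def)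

lemma BC_continuous: "f \<in> BC \<Longrightarrow> continuous_on UNIV f"
  by (simp add: BC_def)

lemma BC_bound:
  assumes "f \<in> BC"
  obtains C where "C > 0" "\<And>x. \<bar>f x\<bar> \<le> C"
proof -
  obtain C where C: "\<And>x. \<bar>f x\<bar> \<le> C" using assms by (auto simp: BC_def)
  have "\<bar>f x\<bar> \<le> \<bar>C\<bar> + 1" for x using C[of x] by linarith
  then show ?thesis using that[of "\<bar>C\<bar> + 1"] by auto
qed

lemma BC_add:
  assumes "f \<in> BC" "g \<in> BC"
  shows "(\<lambda>x. f x + g x) \<in> BC"
proof -
  obtain C D where "\<And>x. \<bar>f x\<bar> \<le> C" "\<And>x. \<bar>g x\<bar> \<le> D" using assms BC_bound by metis
  then have "\<bar>f x + g x\<bar> \<le> C + D" for x by (meson abs_triangle_ineq add_mono order_trans)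
  then show ?thesis by (rule BCI[OF continuous_on_add[OF assms[THEN BC_continuous]]])
qed

lemma BC_cmult:
  assumes "f \<in> BC"
  shows "(\<lambda>x. c * f x) \<in> BC"
proof -
  obtain C where "\<And>x. \<bar>f x\<bar> \<le> C" using assms BC_bound by metis
  then have "\<bar>c * f x\<bar> \<le> \<bar>c\<bar> * C" for x by (simp add: abs_mult mult_left_mono)
  then show ?thesis by (rule BCI[OF continuous_on_mult_left[OF BC_continuous[OF assms]]])
qed

lemma BC_const: "(\<lambda>x. c) \<in> BC"
  by (rule BCI[of _ "\<bar>c\<bar>"]) auto

lemma BC_diff: "f \<in> BC \<Longrightarrow> g \<in> BC \<Longrightarrow> (\<lambda>x. f x - g x) \<in> BC"
  using BC_add[of f "\<lambda>x. - 1 * g x"] BC_cmult[of g "-1"] by simp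

lemma BC_sum: "(\<And>i. i \<in> S \<Longrightarrow> f i \<in> BC) \<Longrightarrow> (\<lambda>x. \<Sum>i\<in>S. f i x) \<in> BC"
  by (induction S rule: infinite_finite_induct) (auto simp: BC_const intro: BC_add)

lemma BC_translate:
  fixes f :: "'a::topological_group_add \<Rightarrow> real"
  assumes "f \<in> BC"
  shows "(\<lambda>x. f (a + x)) \<in> BC"
proof -
  obtain C where "\<And>x. \<bar>f x\<bar> \<le> C" using assms BC_bound by metis
  moreover have "continuous_on UNIV (\<lambda>x. f (a + x))"
    by (intro continuous_on_group_compose[OF BC_continuous[OF assms]] continuous_intros)
  ultimately show ?thesis using BCI[of "\<lambda>x. f (a + x)"] by blast
qed

locale amenable_haar = haar_measure \<mu> for \<mu> :: "'a::{topological_group_add,t2_space} measure" +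
  fixes m :: "('a \<Rightarrow> complex) \<Rightarrow> complex"
  assumes mean: "left_invariant_mean \<mu> m"
begin

definition M :: "('a \<Rightarrow> real) \<Rightarrow> real" where
  "M f = Re (m (\<lambda>x. complex_of_real (f x)))"

lemma BC_bounded_borel: "f \<in> BC \<Longrightarrow> (\<lambda>x. complex_of_real (f x)) \<in> bounded_borel"
proof -
  assume f: "f \<in> BC"
  obtain C where "\<And>x. \<bar>f x\<bar> \<le> C" using f BC_bound by metis
  then have "bounded (range (\<lambda>x. complex_of_real (f x)))" by (auto simp: bounded_iff)
  moreover have "(\<lambda>x. complex_of_real (f x)) \<in> borel_measurable borel"
    by (intro borel_measurable_continuous_onI continuous_intros BC_continuous f)
  ultimately show ?thesis by (simp add: bounded_borel_def)
qed

lemma mean_props: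
  shows m_scale: "f \<in> bounded_borel \<Longrightarrow> m (\<lambda>x. c * f x) = c * m f"
    and m_le: "f \<in> bounded_borel \<Longrightarrow> ess_le \<mu> f C \<Longrightarrow> cmod (m f) \<le> C"
    and m_translate: "f \<in> bounded_borel \<Longrightarrow> m (\<lambda>x. f (a + x)) = m f"
  using mean by (simp_all add: left_invariant_mean_def)

lemma M_add:
  assumes "f \<in> BC" "g \<in> BC"
  shows "M (\<lambda>x. f x + g x) = M f + M g"
proof -
  have "(\<lambda>x. complex_of_real (f x + g x)) = (\<lambda>x. complex_of_real (f x)) + (\<lambda>x. complex_of_real (g x))"
    by (simp add: fun_eq_iff)
  moreover have "m ((\<lambda>x. complex_of_real (f x)) + (\<lambda>x. complex_of_real (g x)))
      = m (\<lambda>x. complex_of_real (f x)) + m (\<lambda>x. complex_of_real (g x))"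
    using mean assms[THEN BC_bounded_borel] unfolding left_invariant_mean_def by blast
  ultimately show ?thesis by (simp add: M_def)
qed

lemma M_cmult:
  assumes "f \<in> BC"
  shows "M (\<lambda>x. c * f x) = c * M f"
proof -
  have "m (\<lambda>x. complex_of_real c * complex_of_real (f x)) = complex_of_real c * m (\<lambda>x. complex_of_real (f x))"
    by (rule m_scale[OF BC_bounded_borel[OF assms]])
  then show ?thesis by (simp add: M_def)
qed

lemma M_const: "M (\<lambda>x. c) = c"
proof -
  have "m (\<lambda>x. 1) = 1" using mean unfolding left_invariant_mean_def by blast
  then have "M (\<lambda>x. 1) = 1" by (simp add: M_def)
  then show ?thesis using M_cmult[OF BC_const[of 1], of c] by simp
qed

lemma M_diff: "f \<in> BC \<Longrightarrow> g \<in> BC \<Longrightarrow> M (\<lambda>x. f x - g x) = M f - M g"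
  using M_add[of f "\<lambda>x. - 1 * g x"] BC_cmult[of g "-1"] M_cmult[of g "-1"] by simp

lemma M_sum: "(\<And>i. i \<in> S \<Longrightarrow> f i \<in> BC) \<Longrightarrow> M (\<lambda>x. \<Sum>i\<in>S. f i x) = (\<Sum>i\<in>S. M (f i))"
  by (induction S rule: infinite_finite_induct) (auto simp: M_const M_add BC_sum)

lemma M_abs_le:
  assumes "f \<in> BC" "\<And>x. \<bar>f x\<bar> \<le> C"
  shows "\<bar>M f\<bar> \<le> C"
proof -
  have "ess_le \<mu> (\<lambda>x. complex_of_real (f x)) C" using assms(2) by (auto simp: ess_le_def)
  then have "cmod (m (\<lambda>x. complex_of_real (f x))) \<le> C"
    by (rule m_le[OF BC_bounded_borel[OF assms(1)]])
  then show ?thesis unfolding M_def using abs_Re_le_cmod order_trans by blast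
qed

text \<open>
  Positivity follows from norm one: \<open>C - f\<close> lies between \<open>0\<close> and \<open>C - d\<close> for any upper bound \<open>C\<close> of \<open>f\<close>.
\<close>

lemma M_ge:
  assumes f: "f \<in> BC" "\<And>x. d \<le> f x"
  shows "d \<le> M f"
proof -
  obtain C where C: "\<And>x. \<bar>f x\<bar> \<le> C" using f BC_bound by metis
  have "\<bar>M (\<lambda>x. C - f x)\<bar> \<le> C - d"
  proof (rule M_abs_le)
    show "(\<lambda>x. C - f x) \<in> BC" by (intro BC_diff BC_const f)
    fix x show "\<bar>C - f x\<bar> \<le> C - d" using C[of x] f(2)[of x] by linarith
  qed
  then show ?thesis using M_diff[OF BC_const f(1), of C] by (simp add: M_const)
qed

lemma M_translate: "f \<in> BC \<Longrightarrow> M (\<lambda>x. f (a + x)) = M f"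
  unfolding M_def by (subst m_translate[OF BC_bounded_borel]) simp_all

definition conv :: "('a \<Rightarrow> real) \<Rightarrow> ('a \<Rightarrow> real) \<Rightarrow> 'a \<Rightarrow> real" where
  "conv a \<Phi> g = I (\<lambda>w. a w * \<Phi> (w + g))"

lemma conv_integrand:
  fixes \<Phi> :: "'a \<Rightarrow> real"
  assumes "a \<in> Cc" "\<Phi> \<in> BC"
  shows "(\<lambda>w. a w * \<Phi> (w + g)) \<in> Cc"
  by (intro Cc_mult[OF assms(1)] continuous_on_group_compose[OF BC_continuous[OF assms(2)]] continuous_intros)

lemma conv_bound:
  assumes a: "a \<in> Cc" and \<Phi>: "\<Phi> \<in> BC" "\<And>x. \<bar>\<Phi> x\<bar> \<le> C"
  shows "\<bar>conv a \<Phi> g\<bar> \<le> C * I (\<lambda>w. \<bar>a w\<bar>)"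
proof -
  have "\<bar>conv a \<Phi> g\<bar> \<le> I (\<lambda>w. C * \<bar>a w\<bar>)"
    unfolding conv_def
  proof (rule I_abs_le[OF conv_integrand[OF a \<Phi>(1)] Cc_cmult[OF Cc_abs[OF a]]])
    show "\<bar>a w * \<Phi> (w + g)\<bar> \<le> C * \<bar>a w\<bar>" for w
      using mult_left_mono[OF \<Phi>(2), of "\<bar>a w\<bar>" "w + g"] by (simp add: abs_mult mult.commute)
  qed
  then show ?thesis by simp
qed

lemma conv_BC:
  assumes a: "a \<in> Cc" and \<Phi>: "\<Phi> \<in> BC"
  shows "conv a \<Phi> \<in> BC"
proof -
  obtain C where C: "\<And>x. \<bar>\<Phi> x\<bar> \<le> C" using \<Phi> BC_bound by metis
  have "continuous_on UNIV (\<lambda>g. I (\<lambda>w. a w * \<Phi> (w + g)))"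
    by (rule I_param_continuous[OF a])
      (unfold split_beta, intro continuous_on_group_compose[OF BC_continuous[OF \<Phi>]] continuous_intros)
  then show ?thesis
    using conv_bound[OF a \<Phi> C] unfolding conv_def by (rule BCI)
qed

text \<open>
  A finitely additive mean does not commute with integrals in general. It does if the left translates of
  \<open>\<Theta>\<close> depend continuously on the translation in the supremum norm: then the integral is uniformly
  approximated by finite combinations of translates, all of which have the same mean.
\<close>

lemma M_conv_uniform:
  assumes b: "b \<in> Cc" and \<Theta>: "\<Theta> \<in> BC"
    and unif: "\<And>w e. e > 0 \<Longrightarrow> \<exists>U. open U \<and> w \<in> U \<and> (\<forall>w'\<in>U. \<forall>g. \<bar>\<Theta> (w' + g) - \<Theta> (w + g)\<bar> \<le> e)"
  shows "M (conv b \<Theta>) = I b * M \<Theta>"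
proof (rule eq_if_close[where C = "I (\<lambda>x. \<bar>b x\<bar>)"])
  fix e :: real assume e: "e > 0"
  obtain K where K: "compact K" "\<And>x. x \<notin> K \<Longrightarrow> b x = 0" using b Cc_support by blast
  obtain U where U: "\<And>w. open (U w)" "\<And>w. w \<in> U w"
    "\<And>w w' g. w' \<in> U w \<Longrightarrow> \<bar>\<Theta> (w' + g) - \<Theta> (w + g)\<bar> \<le> e"
    using unif[OF e] by metis
  obtain W c where W: "finite W" and R0: "\<forall>\<phi> e. continuous_on UNIV \<phi> \<longrightarrow>
      (\<forall>w\<in>W. \<forall>y\<in>U w. \<bar>\<phi> y - \<phi> w\<bar> \<le> e) \<longrightarrow>
      \<bar>I (\<lambda>x. b x * \<phi> x) - (\<Sum>w\<in>W. c w * \<phi> w)\<bar> \<le> e * I (\<lambda>x. \<bar>b x\<bar>)"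
    using riemann_sum[where K = K and U = U, OF b K U(1,2)] by blast
  note R = R0[rule_format]
  have Ib: "I b = sum c W" using R[of "\<lambda>x. 1" 0] by simp
  have tr: "(\<lambda>g. \<Theta> (w + g)) \<in> BC" for w by (rule BC_translate[OF \<Theta>])
  have sumBC: "(\<lambda>g. \<Sum>w\<in>W. c w * \<Theta> (w + g)) \<in> BC" by (intro BC_sum BC_cmult tr)
  have "M (\<lambda>g. \<Sum>w\<in>W. c w * \<Theta> (w + g)) = I b * M \<Theta>"
    by (subst M_sum) (auto intro: BC_cmult tr simp: M_cmult[OF tr] M_translate[OF \<Theta>] Ib sum_distrib_right)
  then have "M (conv b \<Theta>) - I b * M \<Theta> = M (\<lambda>g. conv b \<Theta> g - (\<Sum>w\<in>W. c w * \<Theta> (w + g)))"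
    using M_diff[OF conv_BC[OF b \<Theta>] sumBC] by simp
  also have "\<bar>\<dots>\<bar> \<le> e * I (\<lambda>x. \<bar>b x\<bar>)"
  proof (rule M_abs_le)
    show "(\<lambda>g. conv b \<Theta> g - (\<Sum>w\<in>W. c w * \<Theta> (w + g))) \<in> BC"
      by (intro BC_diff conv_BC b \<Theta> sumBC)
    fix g show "\<bar>conv b \<Theta> g - (\<Sum>w\<in>W. c w * \<Theta> (w + g))\<bar> \<le> e * I (\<lambda>x. \<bar>b x\<bar>)"
      unfolding conv_def
    proof (rule R)
      show "continuous_on UNIV (\<lambda>w. \<Theta> (w + g))"
        by (intro continuous_on_group_compose[OF BC_continuous[OF \<Theta>]] continuous_intros)
    qed (rule U(3))
  qed
  finally show "\<bar>M (conv b \<Theta>) - I b * M \<Theta>\<bar> \<le> I (\<lambda>x. \<bar>b x\<bar>) * e" by (simp add: mult.commute)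
qed

text \<open>
  Invariance under translations improves to invariance under averaging against densities, although the
  translates of \<open>\<Phi>\<close> need not be norm continuous. The function \<open>\<Phi>\<close> is first smoothed to \<open>\<Theta>\<close> with a weight
  \<open>\<epsilon>\<close> concentrated near \<open>0\<close>. Exchanging integrals moves this smoothing onto \<open>a\<close>, where it is harmless
  by continuity of translation in \<open>L\<^sup>1\<close>, so that the mean of \<open>conv a \<Phi>\<close> is close to \<open>I a * M \<Theta>\<close>, which depends on
  \<open>a\<close> through its integral only. Writing \<open>\<Phi> (- y + g)\<close> in \<open>\<Theta>\<close> keeps all substitutions left
  translations, so the modular function never enters.
\<close>

lemma M_conv_invariant:
  assumes \<Phi>: "\<Phi> \<in> BC" and a: "a \<in> Cc" and b: "b \<in> Cc" and eq: "I a = I b"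
  shows "M (conv a \<Phi>) = M (conv b \<Phi>)"
proof -
  obtain C where C: "C > 0" "\<And>x. \<bar>\<Phi> x\<bar> \<le> C" using \<Phi> BC_bound by metis
  have c\<Phi>: "continuous_on S (\<lambda>x. \<Phi> (h x))" if "continuous_on S h" for S :: "'z::topological_space set" and h
    by (rule continuous_on_group_compose[OF BC_continuous[OF \<Phi>] that])
  show ?thesis
  proof (rule eq_if_close[where C = "2 * C"])
    fix e :: real assume e: "e > 0"
    obtain U1 where U1: "open U1" "(0::'a) \<in> U1" "\<And>z. z \<in> U1 \<Longrightarrow> I (\<lambda>y. \<bar>a (z + y) - a y\<bar>) \<le> e"
      using L1_translate_continuous[OF a e] by metis
    obtain U2 where U2: "open U2" "(0::'a) \<in> U2" "\<And>z. z \<in> U2 \<Longrightarrow> I (\<lambda>y. \<bar>b (z + y) - b y\<bar>) \<le> e"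
      using L1_translate_continuous[OF b e] by metis
    obtain \<epsilon> where \<epsilon>: "\<epsilon> \<in> Cc" "\<And>y. 0 \<le> \<epsilon> y" "I \<epsilon> = 1" "\<And>y. y \<notin> U1 \<inter> U2 \<Longrightarrow> \<epsilon> y = 0"
      using Cc_narrow[of "U1 \<inter> U2"] U1(1,2) U2(1,2) by (metis IntI open_Int)
    define \<Theta> where "\<Theta> g = I (\<lambda>y. \<epsilon> y * \<Phi> (- y + g))" for g
    have \<Theta>_int: "(\<lambda>y. \<epsilon> y * \<Phi> (- y + g)) \<in> Cc" for g
      by (intro Cc_mult \<epsilon>(1) c\<Phi> continuous_intros)
    have \<Theta>_shift: "\<Theta> (w + g) = I (\<lambda>y. \<epsilon> (w + y) * \<Phi> (- y + g))" for w g
    proof -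
      have "I (\<lambda>y. \<epsilon> (w + (- w + y)) * \<Phi> (- (- w + y) + g)) = I (\<lambda>y. \<epsilon> (w + y) * \<Phi> (- y + g))"
        by (rule I_translate)
          (intro continuous_intros c\<Phi> continuous_on_group_compose[OF Cc_continuous[OF \<epsilon>(1)]])
      then show ?thesis by (simp add: \<Theta>_def minus_add add.assoc[symmetric])
    qed
    have shift_int: "(\<lambda>y. \<epsilon> (w + y) * \<Phi> (- y + g)) \<in> Cc" for w g
      by (intro Cc_mult Cc_translate \<epsilon>(1) c\<Phi> continuous_intros)
    have \<Theta>_BC: "\<Theta> \<in> BC"
    proof (rule BCI)
      show "continuous_on UNIV \<Theta>" unfolding \<Theta>_def
        by (rule I_param_continuous[OF \<epsilon>(1)]) (unfold split_beta, intro c\<Phi> continuous_intros)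
      fix g
      have "\<bar>\<Theta> g\<bar> \<le> I (\<lambda>y. C * \<epsilon> y)"
        unfolding \<Theta>_def
      proof (rule I_abs_le[OF \<Theta>_int Cc_cmult[OF \<epsilon>(1)]])
        show "\<bar>\<epsilon> y * \<Phi> (- y + g)\<bar> \<le> C * \<epsilon> y" for y
          using mult_left_mono[OF C(2)[of "- y + g"] \<epsilon>(2)[of y]] \<epsilon>(2)[of y] by (simp add: abs_mult mult.commute)
      qed
      then show "\<bar>\<Theta> g\<bar> \<le> C" using \<epsilon>(3) by simp
    qed
    have unif: "\<exists>U. open U \<and> w \<in> U \<and> (\<forall>w'\<in>U. \<forall>g. \<bar>\<Theta> (w' + g) - \<Theta> (w + g)\<bar> \<le> d)" if d: "d > 0" for w d
    proof -
      have "d / C > 0" using d C by simp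
      then obtain U where U: "open U" "(0::'a) \<in> U" "\<And>z. z \<in> U \<Longrightarrow> I (\<lambda>y. \<bar>\<epsilon> (z + y) - \<epsilon> y\<bar>) \<le> d / C"
        using L1_translate_continuous[OF \<epsilon>(1)] by metis
      have "\<bar>\<Theta> (w' + g) - \<Theta> (w + g)\<bar> \<le> d" if w': "w' + - w \<in> U" for w' g
      proof -
        have "\<bar>\<Theta> (w' + g) - \<Theta> (w + g)\<bar> \<le> I (\<lambda>y. C * \<bar>\<epsilon> (w' + y) - \<epsilon> (w + y)\<bar>)"
          unfolding \<Theta>_shift
        proof (rule I_diff_le[OF shift_int shift_int])
          show "(\<lambda>y. C * \<bar>\<epsilon> (w' + y) - \<epsilon> (w + y)\<bar>) \<in> Cc"
            by (intro Cc_cmult Cc_abs Cc_diff Cc_translate \<epsilon>)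
          fix y
          have "\<bar>\<epsilon> (w' + y) - \<epsilon> (w + y)\<bar> * \<bar>\<Phi> (- y + g)\<bar> \<le> \<bar>\<epsilon> (w' + y) - \<epsilon> (w + y)\<bar> * C"
            by (intro mult_left_mono C) simp
          then show "\<bar>\<epsilon> (w' + y) * \<Phi> (- y + g) - \<epsilon> (w + y) * \<Phi> (- y + g)\<bar> \<le> C * \<bar>\<epsilon> (w' + y) - \<epsilon> (w + y)\<bar>"
            by (simp only: abs_mult[symmetric] left_diff_distrib mult.commute[of _ C])
        qed
        also have "\<dots> = C * I (\<lambda>y. \<bar>\<epsilon> (w' + y) - \<epsilon> (w + y)\<bar>)" by simp
        also have "I (\<lambda>y. \<bar>\<epsilon> (w' + y) - \<epsilon> (w + y)\<bar>) = I (\<lambda>y. \<bar>\<epsilon> (w' + (- w + y)) - \<epsilon> (w + (- w + y))\<bar>)"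
          by (rule I_translate[symmetric])
            (intro continuous_intros continuous_on_group_compose[OF Cc_continuous[OF \<epsilon>(1)]])
        also have "\<dots> = I (\<lambda>y. \<bar>\<epsilon> (w' + - w + y) - \<epsilon> y\<bar>)" by (simp add: add.assoc[symmetric])
        also have "C * \<dots> \<le> C * (d / C)" using U(3)[OF w'] C by (intro mult_left_mono) auto
        finally show ?thesis using C by simp
      qed
      moreover have "open ((\<lambda>w'. w' + - w) -` U)" by (intro open_vimage U continuous_intros)
      ultimately show ?thesis using U(2) by (intro exI[of _ "(\<lambda>w'. w' + - w) -` U"]) auto
    qed
    have key: "\<bar>M (conv f \<Phi>) - I f * M \<Theta>\<bar> \<le> C * e"
      if f: "f \<in> Cc" and near: "\<And>z. z \<in> U1 \<inter> U2 \<Longrightarrow> I (\<lambda>y. \<bar>f (z + y) - f y\<bar>) \<le> e" for f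
    proof -
      have f\<Phi>: "(\<lambda>w. f (y + w) * \<Phi> (w + g)) \<in> Cc" for y g
        by (intro Cc_mult Cc_translate f c\<Phi> continuous_intros)
      have pt: "\<bar>conv f \<Theta> g - conv f \<Phi> g\<bar> \<le> C * e" for g
      proof -
        define G where "G y = I (\<lambda>w. f w * \<Phi> (- y + (w + g)))" for y
        have G: "G y = I (\<lambda>w. f (y + w) * \<Phi> (w + g))" for y
        proof -
          have "I (\<lambda>w. f (y + (- y + w)) * \<Phi> (- y + w + g)) = I (\<lambda>w. f (y + w) * \<Phi> (w + g))"
            by (rule I_translate) (intro Cc_continuous f\<Phi>)
          then show ?thesis by (simp add: G_def add.assoc[symmetric])
        qed
        have Gc: "continuous_on UNIV G"
          unfolding G_def by (rule I_param_continuous[OF f]) (unfold split_beta, intro c\<Phi> continuous_intros)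
        have "conv f \<Theta> g = I (\<lambda>y. \<epsilon> y * G y)"
          unfolding conv_def \<Theta>_def G_def
          by (rule I_swap[OF \<epsilon>(1) f]) (unfold split_beta, intro c\<Phi> continuous_intros)
        moreover have "conv f \<Phi> g = I (\<lambda>y. \<epsilon> y * conv f \<Phi> g)" using \<epsilon>(3) by simp
        moreover have "\<bar>I (\<lambda>y. \<epsilon> y * G y) - I (\<lambda>y. \<epsilon> y * conv f \<Phi> g)\<bar> \<le> I (\<lambda>y. (C * e) * \<epsilon> y)"
        proof (rule I_diff_le[OF Cc_mult[OF \<epsilon>(1) Gc] Cc_mult[OF \<epsilon>(1) continuous_on_const] Cc_cmult[OF \<epsilon>(1)]])
          fix y
          show "\<bar>\<epsilon> y * G y - \<epsilon> y * conv f \<Phi> g\<bar> \<le> (C * e) * \<epsilon> y"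
          proof (cases "y \<in> U1 \<inter> U2")
            case True
            have f0: "(\<lambda>w. f w * \<Phi> (w + g)) \<in> Cc" by (rule conv_integrand[OF f \<Phi>])
            have "\<bar>G y - conv f \<Phi> g\<bar> \<le> I (\<lambda>w. C * \<bar>f (y + w) - f w\<bar>)"
              unfolding G conv_def
            proof (rule I_diff_le[OF f\<Phi> f0])
              show "(\<lambda>w. C * \<bar>f (y + w) - f w\<bar>) \<in> Cc" by (intro Cc_cmult Cc_abs Cc_diff Cc_translate f)
              fix w
              have "\<bar>f (y + w) - f w\<bar> * \<bar>\<Phi> (w + g)\<bar> \<le> \<bar>f (y + w) - f w\<bar> * C"
                by (intro mult_left_mono C) simp
              then show "\<bar>f (y + w) * \<Phi> (w + g) - f w * \<Phi> (w + g)\<bar> \<le> C * \<bar>f (y + w) - f w\<bar>"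
                by (simp only: abs_mult[symmetric] left_diff_distrib mult.commute[of _ C])
            qed
            also have "\<dots> \<le> C * e" using near[OF True] C by (simp add: mult_left_mono)
            finally have "\<epsilon> y * \<bar>G y - conv f \<Phi> g\<bar> \<le> \<epsilon> y * (C * e)" by (intro mult_left_mono \<epsilon>)
            moreover have "\<bar>\<epsilon> y * G y - \<epsilon> y * conv f \<Phi> g\<bar> = \<epsilon> y * \<bar>G y - conv f \<Phi> g\<bar>"
              unfolding right_diff_distrib[symmetric] abs_mult using \<epsilon>(2)[of y] by simp
            ultimately show ?thesis by (simp only: mult.commute[of "C * e"])
          qed (simp add: \<epsilon>(4))
        qed
        ultimately show ?thesis using \<epsilon>(3) by simp
      qed
      have "M (conv f \<Theta>) = I f * M \<Theta>" by (rule M_conv_uniform[OF f \<Theta>_BC unif])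
      moreover have "\<bar>M (\<lambda>g. conv f \<Theta> g - conv f \<Phi> g)\<bar> \<le> C * e"
        by (rule M_abs_le[OF BC_diff[OF conv_BC[OF f \<Theta>_BC] conv_BC[OF f \<Phi>]] pt])
      ultimately show ?thesis
        using M_diff[OF conv_BC[OF f \<Theta>_BC] conv_BC[OF f \<Phi>]] by (simp add: abs_minus_commute)
    qed
    have "\<bar>M (conv a \<Phi>) - I a * M \<Theta>\<bar> \<le> C * e" using U1(3) by (intro key a) auto
    moreover have "\<bar>M (conv b \<Phi>) - I a * M \<Theta>\<bar> \<le> C * e" unfolding eq using U2(3) by (intro key b) auto
    ultimately show "\<bar>M (conv a \<Phi>) - M (conv b \<Phi>)\<bar> \<le> 2 * C * e" by linarith
  qed
qed

end


section \<open>Almost invariant densities\<close>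

lemma compact_sum_image:
  fixes A B :: "'a::topological_group_add set"
  assumes "compact A" "compact B"
  shows "compact ((\<lambda>(x, y). x + y) ` (A \<times> B))"
  unfolding split_beta using assms
  by (intro compact_continuous_image compact_Times continuous_intros)

locale smoothing = amenable_haar \<mu> m
  for \<mu> :: "'a::{topological_group_add,t2_space} measure" and m +
  fixes k :: "'a \<Rightarrow> real"
  assumes k: "k \<in> Cc" "\<And>y. 0 \<le> k y" "I k = 1"
begin

text \<open>
  The convolution \<open>a * \<delta>\<^sub>g * k\<close>. The outer factor \<open>a\<close> carries the behaviour under left translation, the
  inner factor \<open>k\<close> makes the dependence on \<open>g\<close> continuous.
\<close>

definition smear :: "'a \<Rightarrow> ('a \<Rightarrow> real) \<Rightarrow> 'a \<Rightarrow> real" where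
  "smear g a y = I (\<lambda>w. a w * k (- g + (- w + y)))"

lemma k_compose: "continuous_on S h \<Longrightarrow> continuous_on S (\<lambda>x. k (h x))"
  by (rule continuous_on_group_compose[OF Cc_continuous[OF k(1)]])

lemma smear_integrand: "a \<in> Cc \<Longrightarrow> (\<lambda>w. a w * k (- g + (- w + y))) \<in> Cc"
  by (rule Cc_mult) (auto intro!: k_compose continuous_intros)

lemma smear_continuous: "a \<in> Cc \<Longrightarrow> continuous_on UNIV (smear g a)"
  unfolding smear_def by (rule I_param_continuous) (auto simp: split_beta intro!: k_compose continuous_intros)

lemma smear_support:
  assumes K: "compact K" "\<And>x. x \<notin> K \<Longrightarrow> a x = 0"
  shows "\<exists>L. compact L \<and> (\<forall>y. y \<notin> L \<longrightarrow> smear g a y = 0) \<and>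
    (\<forall>w\<in>K. \<forall>y. y \<notin> L \<longrightarrow> k (- g + (- w + y)) = 0)"
proof -
  obtain Kk where Kk: "compact Kk" "\<And>x. x \<notin> Kk \<Longrightarrow> k x = 0" using k(1) Cc_support by blast
  define L where "L = (\<lambda>(x, y). x + y) ` (K \<times> ((+) g ` Kk))"
  have zero: "k (- g + (- w + y)) = 0" if "w \<in> K" "y \<notin> L" for w y
  proof (rule Kk(2), rule notI)
    assume "- g + (- w + y) \<in> Kk"
    then have "w + (g + (- g + (- w + y))) \<in> L" unfolding L_def using that(1) by force
    then show False using that(2) by (simp only: add_minus_cancel)
  qed
  show ?thesis
  proof (intro exI[of _ L] conjI allI ballI impI)
    show "compact L" unfolding L_def
      by (intro compact_sum_image K compact_continuous_image Kk continuous_intros)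
    show "smear g a y = 0" if "y \<notin> L" for y
    proof -
      have "a w * k (- g + (- w + y)) = 0" for w using zero[of w y] K(2)[of w] that by (cases "w \<in> K") auto
      then have "smear g a y = I (\<lambda>w. 0)" unfolding smear_def by presburger
      then show ?thesis by simp
    qed
  qed (rule zero)
qed

lemma smear_Cc:
  assumes "a \<in> Cc"
  shows "smear g a \<in> Cc"
proof -
  obtain K where K: "compact K" "\<And>x. x \<notin> K \<Longrightarrow> a x = 0" using assms Cc_support by blast
  obtain L where "compact L" "\<And>y. y \<notin> L \<Longrightarrow> smear g a y = 0" using smear_support[of K a g, OF K] by blast
  then show ?thesis using smear_continuous[OF assms] by (intro CcI[of _ L])
qed

lemma smear_nonneg: "(\<And>w. 0 \<le> a w) \<Longrightarrow> 0 \<le> smear g a y"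
  unfolding smear_def by (intro I_nonneg mult_nonneg_nonneg k(2))

lemma smear_diff: "a \<in> Cc \<Longrightarrow> b \<in> Cc \<Longrightarrow> smear g (\<lambda>x. a x - b x) y = smear g a y - smear g b y"
  unfolding smear_def by (simp only: left_diff_distrib) (rule I_diff[OF smear_integrand smear_integrand])

lemma smear_translate:
  assumes "a \<in> Cc"
  shows "smear g a (z + y) = smear g (\<lambda>w. a (z + w)) y"
proof -
  have "I (\<lambda>w. a (z + w) * k (- g + (- (z + w) + (z + y)))) = I (\<lambda>w. a w * k (- g + (- w + (z + y))))"
    by (rule I_translate) (rule Cc_continuous[OF smear_integrand[OF assms]])
  moreover have "- (z + w) + (z + y) = - w + y" for w
    by (simp only: minus_add add.assoc minus_add_cancel)
  ultimately show ?thesis by (simp add: smear_def)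
qed

lemma k_translate_integral: "I (\<lambda>y. k (- g + (- w + y))) = 1"
proof -
  have "I (\<lambda>y. k ((- g + - w) + y)) = I k" by (rule I_translate[OF Cc_continuous[OF k(1)]])
  then show ?thesis using k(3) by (simp only: add.assoc)
qed

lemma I_smear:
  assumes a: "a \<in> Cc"
  shows "I (smear g a) = I a"
proof -
  obtain K where K: "compact K" "\<And>x. x \<notin> K \<Longrightarrow> a x = 0" using a Cc_support by blast
  obtain L where L: "compact L" "\<And>y. y \<notin> L \<Longrightarrow> smear g a y = 0"
    "\<And>w y. w \<in> K \<Longrightarrow> y \<notin> L \<Longrightarrow> k (- g + (- w + y)) = 0"
    using smear_support[of K a g, OF K] by blast
  obtain \<rho> where \<rho>: "\<rho> \<in> Cc" "\<And>y. y \<in> L \<Longrightarrow> \<rho> y = 1" using Cc_cutoff[OF L(1)] by blast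
  have "smear g a y = \<rho> y * smear g a y" for y using \<rho>(2)[of y] L(2)[of y] by (cases "y \<in> L") auto
  then have "smear g a = (\<lambda>y. \<rho> y * I (\<lambda>w. a w * k (- g + (- w + y))))" unfolding smear_def by (rule ext)
  then have "I (smear g a) = I (\<lambda>y. \<rho> y * I (\<lambda>w. a w * k (- g + (- w + y))))" by (rule arg_cong)
  also have "\<dots> = I (\<lambda>w. a w * I (\<lambda>y. \<rho> y * k (- g + (- w + y))))"
    by (rule I_swap[symmetric, OF \<rho>(1) a]) (auto simp: split_beta intro!: k_compose continuous_intros)
  also have "\<dots> = I a"
  proof -
    have "a w * I (\<lambda>y. \<rho> y * k (- g + (- w + y))) = a w" for w
    proof (cases "w \<in> K")
      case True
      have "\<rho> y * k (- g + (- w + y)) = k (- g + (- w + y))" for y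
        using \<rho>(2)[of y] L(3)[OF True, of y] by (cases "y \<in> L") auto
      then have "I (\<lambda>y. \<rho> y * k (- g + (- w + y))) = 1"
        using k_translate_integral[of g w] by presburger
      then show ?thesis by simp
    qed (simp add: K(2))
    then have "(\<lambda>w. a w * I (\<lambda>y. \<rho> y * k (- g + (- w + y)))) = a" by (rule ext)
    then show ?thesis by (simp only:)
  qed
  finally show ?thesis .
qed

lemma I_abs_smear:
  assumes a: "a \<in> Cc"
  shows "I (\<lambda>y. \<bar>smear g a y\<bar>) \<le> I (\<lambda>w. \<bar>a w\<bar>)"
proof -
  have "I (\<lambda>y. \<bar>smear g a y\<bar>) \<le> I (smear g (\<lambda>w. \<bar>a w\<bar>))"
  proof (rule I_mono[OF Cc_abs[OF smear_Cc[OF a]] smear_Cc[OF Cc_abs[OF a]]])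
    fix y
    have "\<bar>smear g a y\<bar> \<le> I (\<lambda>w. \<bar>a w * k (- g + (- w + y))\<bar>)" unfolding smear_def by (rule I_abs)
    also have "\<dots> = smear g (\<lambda>w. \<bar>a w\<bar>) y" unfolding smear_def abs_mult using k(2) by simp
    finally show "\<bar>smear g a y\<bar> \<le> smear g (\<lambda>w. \<bar>a w\<bar>) y" .
  qed
  then show ?thesis using I_smear[OF Cc_abs[OF a]] by simp
qed

definition L1_functional :: "(('a \<Rightarrow> real) \<Rightarrow> real) \<Rightarrow> bool" where
  "L1_functional l \<longleftrightarrow> (\<forall>a\<in>Cc. \<forall>b\<in>Cc. l (\<lambda>x. a x + b x) = l a + l b) \<and>
     (\<forall>c. \<forall>a\<in>Cc. l (\<lambda>x. c * a x) = c * l a) \<and> (\<forall>a\<in>Cc. \<bar>l a\<bar> \<le> I (\<lambda>x. \<bar>a x\<bar>))"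

lemma L1_functionalD:
  assumes "L1_functional l"
  shows "a \<in> Cc \<Longrightarrow> b \<in> Cc \<Longrightarrow> l (\<lambda>x. a x + b x) = l a + l b"
    and "a \<in> Cc \<Longrightarrow> l (\<lambda>x. c * a x) = c * l a"
    and "a \<in> Cc \<Longrightarrow> \<bar>l a\<bar> \<le> I (\<lambda>x. \<bar>a x\<bar>)"
  using assms by (simp_all add: L1_functional_def)

lemma L1_functional_diff:
  assumes "L1_functional l" "a \<in> Cc" "b \<in> Cc"
  shows "l (\<lambda>x. a x - b x) = l a - l b"
  using L1_functionalD(1)[OF assms(1,2) Cc_cmult[OF assms(3), of "-1"]]
    L1_functionalD(2)[OF assms(1,3), of "-1"] by simp

lemma L1_functional_sum:
  assumes "L1_functional l" "\<And>i. i \<in> S \<Longrightarrow> f i \<in> Cc"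
  shows "l (\<lambda>x. \<Sum>i\<in>S. f i x) = (\<Sum>i\<in>S. l (f i))"
  using assms(2)
proof (induction S rule: infinite_finite_induct)
  case (insert i S)
  then show ?case using L1_functionalD(1)[OF assms(1), of "f i" "\<lambda>x. \<Sum>i\<in>S. f i x"] by (simp add: Cc_sum)
qed (use L1_functionalD(2)[OF assms(1) Cc_zero, of 0] in auto)

context
  fixes l assumes l: "L1_functional l"
begin

text \<open>
  A bounded functional on \<open>L\<^sup>1\<close> need not be represented by a bounded function when the measure is not
  \<open>\<sigma>\<close>-finite, but on the translates of \<open>k\<close> it is given by this bounded continuous function.
\<close>

definition symbol :: "'a \<Rightarrow> real" where
  "symbol g = l (\<lambda>y. k (- g + y))"

lemma k_Cc: "(\<lambda>y. k (- g + y)) \<in> Cc"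
  by (rule Cc_translate[OF k(1)])

lemma symbol_diff: "\<bar>symbol g' - symbol g\<bar> \<le> I (\<lambda>y. \<bar>k (- g' + g + y) - k y\<bar>)"
proof -
  have "symbol g' - symbol g = l (\<lambda>y. k (- g' + y) - k (- g + y))"
    unfolding symbol_def by (rule L1_functional_diff[OF l k_Cc k_Cc, symmetric])
  also have "\<bar>\<dots>\<bar> \<le> I (\<lambda>y. \<bar>k (- g' + y) - k (- g + y)\<bar>)"
    by (rule L1_functionalD(3)[OF l Cc_diff[OF k_Cc k_Cc]])
  also have "\<dots> = I (\<lambda>y. \<bar>k (- g' + (g + y)) - k (- g + (g + y))\<bar>)"
    by (rule I_translate[symmetric]) (intro continuous_intros k_compose)
  finally show ?thesis by (simp add: add.assoc[symmetric])
qed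

lemma symbol_BC: "symbol \<in> BC"
proof (rule BCI)
  fix g
  have "\<bar>symbol g\<bar> \<le> I (\<lambda>y. \<bar>k (- g + y)\<bar>)" unfolding symbol_def by (rule L1_functionalD(3)[OF l k_Cc])
  also have "\<dots> = I k" using k(2) I_translate[OF Cc_continuous[OF k(1)], of "- g"] by simp
  finally show "\<bar>symbol g\<bar> \<le> 1" using k(3) by simp
next
  have "(symbol \<longlongrightarrow> symbol g) (at g)" for g
  proof (rule tendstoI)
    fix e :: real assume "e > 0"
    then have e2: "e / 2 > 0" by simp
    obtain U where U: "open U" "(0::'a) \<in> U" "\<And>z. z \<in> U \<Longrightarrow> I (\<lambda>y. \<bar>k (z + y) - k y\<bar>) \<le> e / 2"
      using L1_translate_continuous[OF k(1) e2] by metis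
    have "open ((\<lambda>g'. - g' + g) -` U)" by (intro open_vimage U continuous_intros)
    moreover have "dist (symbol g') (symbol g) < e" if "g' \<in> (\<lambda>g'. - g' + g) -` U" for g'
    proof -
      have "\<bar>symbol g' - symbol g\<bar> \<le> e / 2" using symbol_diff[of g' g] U(3)[of "- g' + g"] that by simp
      then show ?thesis using \<open>e > 0\<close> by (simp add: dist_real_def)
    qed
    ultimately show "\<forall>\<^sub>F g' in at g. dist (symbol g') (symbol g) < e"
      unfolding eventually_at_topological using U(2) by (intro exI[of _ "(\<lambda>g'. - g' + g) -` U"]) auto
  qed
  then show "continuous_on UNIV symbol" by (simp add: continuous_on_def)
qed

text \<open>
  The functional commutes with the integral defining \<open>smear g a\<close>, since the Riemann sums converge in
  \<open>L\<^sup>1\<close>: they do so uniformly, and their supports stay in the compact set \<open>L\<close> because all nodes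
  lie in the support of \<open>a\<close>.
\<close>

lemma functional_smear:
  assumes a: "a \<in> Cc"
  shows "l (smear g a) = conv a symbol g"
proof -
  obtain K where K: "compact K" "\<And>x. x \<notin> K \<Longrightarrow> a x = 0" using a Cc_support by blast
  obtain L where L: "compact L" "\<And>y. y \<notin> L \<Longrightarrow> smear g a y = 0"
    "\<And>w y. w \<in> K \<Longrightarrow> y \<notin> L \<Longrightarrow> k (- g + (- w + y)) = 0"
    using smear_support[of K a g, OF K] by blast
  define Ia where "Ia = I (\<lambda>x. \<bar>a x\<bar>)"
  show ?thesis
  proof (rule eq_if_close[where C = "Ia * (measure \<mu> L + 1)"])
    fix e :: real assume e: "e > 0"
    obtain U0 where U0: "open U0" "(0::'a) \<in> U0" "\<And>z. z \<in> U0 \<Longrightarrow> I (\<lambda>y. \<bar>k (z + y) - k y\<bar>) \<le> e"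
      using L1_translate_continuous[OF k(1) e] by metis
    obtain U1 where U1: "open U1" "0 \<in> U1" "\<And>z y. z \<in> U1 \<Longrightarrow> \<bar>k (z + y) - k y\<bar> < e"
      using Cc_left_uniform[OF k(1) e] by metis
    define U where "U w = (\<lambda>w'. - g + (- w' + w) + g) -` (U0 \<inter> U1)" for w
    have U: "open (U w)" "w \<in> U w" for w
      unfolding U_def using U0(1,2) U1(1,2) by (auto intro!: open_vimage open_Int continuous_intros)
    obtain W c where W: "finite W" "W \<subseteq> K" and R0: "\<forall>\<phi> e. continuous_on UNIV \<phi> \<longrightarrow>
        (\<forall>w\<in>W. \<forall>y\<in>U w. \<bar>\<phi> y - \<phi> w\<bar> \<le> e) \<longrightarrow>
        \<bar>I (\<lambda>x. a x * \<phi> x) - (\<Sum>w\<in>W. c w * \<phi> w)\<bar> \<le> e * I (\<lambda>x. \<bar>a x\<bar>)"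
      using riemann_sum[where K = K and U = U, OF a K U] by blast
    note R = R0[rule_format]
    have kw: "(\<lambda>y. k (- g + (- w + y))) \<in> Cc" for w
      using Cc_translate[OF k(1), of "- g + - w"] by (simp only: add.assoc)
    define S where "S = (\<lambda>y. \<Sum>w\<in>W. c w * k (- g + (- w + y)))"
    have S: "S \<in> Cc" unfolding S_def by (intro Cc_sum Cc_cmult kw)
    have lS: "l S = (\<Sum>w\<in>W. c w * symbol (w + g))"
    proof -
      have "symbol (w + g) = l (\<lambda>y. k (- g + (- w + y)))" for w
        unfolding symbol_def by (simp only: minus_add add.assoc)
      then show ?thesis
        unfolding S_def by (subst L1_functional_sum[OF l]) (auto intro: Cc_cmult kw simp: L1_functionalD(2)[OF l kw])
    qed
    have "\<bar>l (smear g a) - l S\<bar> = \<bar>l (\<lambda>y. smear g a y - S y)\<bar>"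
      by (simp add: L1_functional_diff[OF l smear_Cc[OF a] S])
    also have "\<dots> \<le> I (\<lambda>y. \<bar>smear g a y - S y\<bar>)" by (rule L1_functionalD(3)[OF l Cc_diff[OF smear_Cc[OF a] S]])
    also have "\<dots> \<le> (e * Ia) * measure \<mu> L"
    proof (rule I_small[OF Cc_diff[OF smear_Cc[OF a] S] L(1)])
      show "smear g a y - S y = 0" if "y \<notin> L" for y
        using that L(2,3) W(2) by (auto simp: S_def intro!: sum.neutral)
      show "\<bar>smear g a y - S y\<bar> \<le> e * Ia" for y
        unfolding smear_def S_def Ia_def
      proof (rule R)
        show "continuous_on UNIV (\<lambda>w. k (- g + (- w + y)))" by (intro k_compose continuous_intros)
        fix w w' assume "w' \<in> U w"
        then have "\<bar>k (- g + (- w' + w) + g + (- g + (- w + y))) - k (- g + (- w + y))\<bar> < e"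
          by (intro U1(3)) (simp add: U_def)
        then show "\<bar>k (- g + (- w' + y)) - k (- g + (- w + y))\<bar> \<le> e"
          by (simp add: add.assoc)
      qed
    qed
    finally have 1: "\<bar>l (smear g a) - l S\<bar> \<le> e * Ia * measure \<mu> L" .
    have 2: "\<bar>conv a symbol g - l S\<bar> \<le> e * Ia"
      unfolding conv_def lS Ia_def
    proof (rule R)
      show "continuous_on UNIV (\<lambda>w. symbol (w + g))"
        by (intro continuous_on_group_compose[OF BC_continuous[OF symbol_BC]] continuous_intros)
      fix w w' assume "w' \<in> U w"
      then have "I (\<lambda>y. \<bar>k (- g + (- w' + w) + g + y) - k y\<bar>) \<le> e" by (intro U0(3)) (simp add: U_def)
      moreover have "- (w' + g) + (w + g) = - g + (- w' + w) + g" by (simp only: minus_add add.assoc)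
      ultimately show "\<bar>symbol (w' + g) - symbol (w + g)\<bar> \<le> e"
        using symbol_diff[of "w' + g" "w + g"] by simp
    qed
    have "\<bar>l (smear g a) - conv a symbol g\<bar> \<le> e * Ia * measure \<mu> L + e * Ia" using 1 2 by linarith
    then show "\<bar>l (smear g a) - conv a symbol g\<bar> \<le> Ia * (measure \<mu> L + 1) * e" by (simp add: algebra_simps)
  qed
qed

lemma M_functional_smear:
  assumes "a \<in> Cc" "b \<in> Cc" "I a = I b"
  shows "(\<lambda>g. l (smear g a)) \<in> BC" "M (\<lambda>g. l (smear g a)) = M (\<lambda>g. l (smear g b))"
  using conv_BC[OF assms(1) symbol_BC] M_conv_invariant[OF symbol_BC assms]
  by (simp_all add: functional_smear assms(1,2))

end

text \<open>
  The last condition is convex in \<open>f\<close> and holds for all \<open>smear g a\<close>. It yields equicontinuity of the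
  translates, with which the statement for finite sets of translations extends to compact ones.
\<close>

definition densities :: "('a \<Rightarrow> real) \<Rightarrow> ('a \<Rightarrow> real) set" where
  "densities a = {f \<in> Cc. (\<forall>y. 0 \<le> f y) \<and> I f = 1 \<and>
     (\<forall>z. I (\<lambda>y. \<bar>f (z + y) - f y\<bar>) \<le> I (\<lambda>y. \<bar>a (z + y) - a y\<bar>))}"

lemma smear_densities:
  assumes a: "a \<in> Cc" "\<And>y. 0 \<le> a y" "I a = 1"
  shows "smear g a \<in> densities a"
proof -
  have "I (\<lambda>y. \<bar>smear g a (z + y) - smear g a y\<bar>) \<le> I (\<lambda>y. \<bar>a (z + y) - a y\<bar>)" for z
  proof -
    have "smear g a (z + y) - smear g a y = smear g (\<lambda>y. a (z + y) - a y) y" for y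
      by (simp add: smear_translate[OF a(1)] smear_diff[OF Cc_translate[OF a(1)] a(1)])
    then show ?thesis using I_abs_smear[OF Cc_diff[OF Cc_translate[OF a(1), of z] a(1)], of g] by simp
  qed
  then show ?thesis using a smear_Cc[OF a(1)] smear_nonneg[of a] I_smear[OF a(1)] by (simp add: densities_def)
qed

lemma densities_convex:
  assumes f: "f \<in> densities a" and g: "g \<in> densities a" and t: "0 \<le> t" "t \<le> 1"
  shows "(\<lambda>y. t * f y + (1 - t) * g y) \<in> densities a"
proof -
  have fC: "f \<in> Cc" and gC: "g \<in> Cc" using f g by (auto simp: densities_def)
  have "I (\<lambda>y. \<bar>t * f (z + y) + (1 - t) * g (z + y) - (t * f y + (1 - t) * g y)\<bar>)
      \<le> I (\<lambda>y. \<bar>a (z + y) - a y\<bar>)" for z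
  proof -
    have F: "(\<lambda>y. f (z + y) - f y) \<in> Cc" "(\<lambda>y. g (z + y) - g y) \<in> Cc"
      by (intro Cc_diff Cc_translate fC gC)+
    have "I (\<lambda>y. \<bar>t * (f (z + y) - f y) + (1 - t) * (g (z + y) - g y)\<bar>)
        \<le> I (\<lambda>y. \<bar>t * (f (z + y) - f y)\<bar>) + I (\<lambda>y. \<bar>(1 - t) * (g (z + y) - g y)\<bar>)"
      by (intro I_abs_triangle Cc_cmult F)
    also have "\<dots> = t * I (\<lambda>y. \<bar>f (z + y) - f y\<bar>) + (1 - t) * I (\<lambda>y. \<bar>g (z + y) - g y\<bar>)"
      using t by (simp add: abs_mult)
    also have "\<dots> \<le> t * I (\<lambda>y. \<bar>a (z + y) - a y\<bar>) + (1 - t) * I (\<lambda>y. \<bar>a (z + y) - a y\<bar>)"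
      using f g t by (intro add_mono mult_left_mono) (auto simp: densities_def)
    also have "\<dots> = I (\<lambda>y. \<bar>a (z + y) - a y\<bar>)" by (simp add: algebra_simps)
    finally show ?thesis by (simp add: algebra_simps)
  qed
  moreover have "I (\<lambda>y. t * f y + (1 - t) * g y) = 1"
    using f g by (subst I_add) (auto simp: densities_def intro!: Cc_cmult)
  ultimately show ?thesis
    using f g t fC gC by (auto simp: densities_def intro!: Cc_add Cc_cmult)
qed

text \<open>
  The tuples of differences between translates of \<open>f\<close> and \<open>f\<close>, for \<open>f\<close> among the densities, form a convex set. If it
  had positive distance \<open>e\<close> from the origin, a functional \<open>L\<close> would be at least \<open>e\<close> on it. Evaluated at
  \<open>f = smear g a\<close> and as a function of \<open>g\<close>, every component of \<open>L\<close> has mean \<open>0\<close>, since translating \<open>a\<close> does not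
  change its integral. So the constant lower bound \<open>e\<close> has nonpositive mean.
\<close>

lemma reiter_finite:
  assumes a: "a \<in> Cc" "\<And>y. 0 \<le> a y" "I a = 1" and Z: "finite Z" and e: "e > 0"
  shows "\<exists>f\<in>densities a. \<forall>z\<in>Z. I (\<lambda>y. \<bar>f (z + y) - f y\<bar>) < e"
proof (rule ccontr)
  assume no: "\<not> ?thesis"
  define sc :: "real \<Rightarrow> ('a \<Rightarrow> 'a \<Rightarrow> real) \<Rightarrow> 'a \<Rightarrow> 'a \<Rightarrow> real" where "sc = (\<lambda>t F z y. t * F z y)"
  define S where "S = {F :: 'a \<Rightarrow> 'a \<Rightarrow> real. \<forall>z\<in>Z. F z \<in> Cc}"
  define N where "N F = (\<Sum>z\<in>Z. I (\<lambda>y. \<bar>F z y\<bar>))" for F :: "'a \<Rightarrow> 'a \<Rightarrow> real"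
  define D where "D f = (\<lambda>z y. if z \<in> Z then f (z + y) - f y else 0)" for f :: "'a \<Rightarrow> real"
  have DS: "D f \<in> S" if "f \<in> densities a" for f
    using that by (auto simp: D_def S_def densities_def intro!: Cc_diff Cc_translate)
  interpret X: real_subspace sc S
  proof
    show "module.subspace sc S"
    proof -
      interpret vector_space sc by unfold_locales (auto simp: sc_def fun_eq_iff algebra_simps)
      show ?thesis
        unfolding subspace_def
        by (auto simp: S_def sc_def plus_fun_def zero_fun_def intro: Cc_add Cc_cmult Cc_zero)
    qed
  qed (auto simp: sc_def fun_eq_iff algebra_simps)
  have subN: "sublinear_on sc S N"
    unfolding sublinear_on_def
  proof (intro conjI ballI allI impI)
    fix v w assume "v \<in> S" "w \<in> S"
    then show "N (v + w) \<le> N v + N w"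
      by (auto simp: N_def S_def sum.distrib[symmetric] intro!: sum_mono I_abs_triangle)
  next
    fix t :: real and v assume "0 \<le> t" "v \<in> S"
    then show "N (sc t v) = t * N v" by (simp add: N_def sc_def abs_mult sum_distrib_left)
  qed
  have big: "e \<le> N (D f)" if f: "f \<in> densities a" for f
  proof (rule ccontr)
    assume less: "\<not> e \<le> N (D f)"
    have "I (\<lambda>y. \<bar>f (z + y) - f y\<bar>) < e" if z: "z \<in> Z" for z
    proof -
      have "I (\<lambda>y. \<bar>D f z y\<bar>) \<le> N (D f)"
        unfolding N_def by (rule member_le_sum[OF z _ Z]) (auto intro: I_nonneg)
      then show ?thesis using less z by (simp add: D_def)
    qed
    then show False using no f by blast
  qed
  obtain L where L: "\<And>v w. v \<in> S \<Longrightarrow> w \<in> S \<Longrightarrow> L (v + w) = L v + L w"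
    "\<And>t v. v \<in> S \<Longrightarrow> L (sc t v) = t * L v" "\<And>v. v \<in> S \<Longrightarrow> L v \<le> N v" "\<And>c. c \<in> D ` densities a \<Longrightarrow> e \<le> L c"
  proof (rule X.separating_functional[OF subN, of "D ` densities a" e])
    show "D ` densities a \<subseteq> S" using DS by auto
    show "D ` densities a \<noteq> {}" using smear_densities[OF a] by blast
    show "e \<le> N c" if "c \<in> D ` densities a" for c using that big by auto
    show "sc t c + sc (1 - t) c' \<in> D ` densities a"
      if c: "c \<in> D ` densities a" and c': "c' \<in> D ` densities a" and t: "0 \<le> t" "t \<le> 1" for c c' t
    proof -
      obtain f g where fg: "f \<in> densities a" "g \<in> densities a" "c = D f" "c' = D g" using c c' by auto
      have "sc t c + sc (1 - t) c' = D (\<lambda>y. t * f y + (1 - t) * g y)"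
        by (auto simp: fg D_def sc_def fun_eq_iff algebra_simps)
      then show ?thesis using densities_convex[OF fg(1,2) t] by auto
    qed
  qed blast
  define single where "single z b = (\<lambda>z' y. if z' = z then b y else 0)" for z :: 'a and b :: "'a \<Rightarrow> real"
  have singleS: "single z b \<in> S" if "b \<in> Cc" for z b
  proof -
    have "(\<lambda>y. if z' = z then b y else 0) \<in> Cc" for z'
      using that by (cases "z' = z") (simp_all add: Cc_zero)
    then show ?thesis by (simp add: single_def S_def)
  qed
  have Nsingle: "N (single z b) \<le> I (\<lambda>y. \<bar>b y\<bar>)" for z b
  proof -
    have "N (single z b) = (\<Sum>z'\<in>Z. if z' = z then I (\<lambda>y. \<bar>b y\<bar>) else 0)"
      unfolding N_def single_def by (intro sum.cong) auto
    also have "\<dots> \<le> I (\<lambda>y. \<bar>b y\<bar>)" using Z by (simp add: I_nonneg)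
    finally show ?thesis .
  qed
  have l: "L1_functional (\<lambda>b. L (single z b))" for z
    unfolding L1_functional_def
  proof (intro conjI ballI allI)
    fix b c :: "'a \<Rightarrow> real" assume bc: "b \<in> Cc" "c \<in> Cc"
    have "single z (\<lambda>x. b x + c x) = single z b + single z c" by (auto simp: single_def fun_eq_iff)
    then show "L (single z (\<lambda>x. b x + c x)) = L (single z b) + L (single z c)"
      using L(1)[OF singleS singleS] bc by simp
  next
    fix t and b :: "'a \<Rightarrow> real" assume b: "b \<in> Cc"
    have "single z (\<lambda>x. t * b x) = sc t (single z b)" by (auto simp: single_def sc_def fun_eq_iff)
    then show "L (single z (\<lambda>x. t * b x)) = t * L (single z b)" using L(2)[OF singleS[OF b]] by simp
  next
    fix b :: "'a \<Rightarrow> real" assume b: "b \<in> Cc"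
    have m1: "single z (\<lambda>x. - b x) = sc (- 1) (single z b)" by (auto simp: single_def sc_def fun_eq_iff)
    have "L (single z (\<lambda>x. - b x)) \<le> I (\<lambda>y. \<bar>- b y\<bar>)"
      using L(3)[OF singleS, of "\<lambda>x. - b x" z] Nsingle[of z "\<lambda>x. - b x"] Cc_cmult[OF b, of "-1"] by simp
    moreover have "L (single z b) \<le> I (\<lambda>y. \<bar>b y\<bar>)"
      using L(3)[OF singleS[OF b]] Nsingle order_trans by blast
    ultimately show "\<bar>L (single z b)\<bar> \<le> I (\<lambda>x. \<bar>b x\<bar>)"
      unfolding m1 L(2)[OF singleS[OF b]] by simp
  qed
  define d where "d z g = L (single z (smear g (\<lambda>y. a (z + y)))) - L (single z (smear g a))" for z g
  have LD: "L (D (smear g a)) = (\<Sum>z\<in>Z. d z g)" for g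
  proof -
    have TC: "smear g a \<in> Cc" by (rule smear_Cc[OF a(1)])
    have tC: "(\<lambda>y. smear g a (z + y)) \<in> Cc" for z by (rule Cc_translate[OF TC])
    have "L (\<lambda>z y. if z \<in> Y then smear g a (z + y) - smear g a y else 0) = (\<Sum>z\<in>Y. d z g)" if "finite Y" "Y \<subseteq> Z" for Y
      using that
    proof (induction Y rule: finite_induct)
      case empty
      have "L (sc 0 0) = 0 * L 0" by (rule L(2)) (rule X.S_closed)
      then show ?case by (simp add: zero_fun_def sc_def)
    next
      case (insert z Y)
      let ?R = "\<lambda>z y. if z \<in> Y then smear g a (z + y) - smear g a y else 0"
      have "?R z \<in> Cc" for z using Cc_diff[OF tC TC, of z] by (cases "z \<in> Y") (simp_all add: Cc_zero)
      then have RS: "?R \<in> S" by (simp add: S_def)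
      have "(\<lambda>z' y. if z' \<in> insert z Y then smear g a (z' + y) - smear g a y else 0)
          = single z (\<lambda>y. smear g a (z + y) - smear g a y) + ?R"
        using insert.hyps by (auto simp: single_def fun_eq_iff)
      then have "L (\<lambda>z' y. if z' \<in> insert z Y then smear g a (z' + y) - smear g a y else 0)
          = L (single z (\<lambda>y. smear g a (z + y) - smear g a y)) + (\<Sum>z\<in>Y. d z g)"
        using L(1)[OF singleS[OF Cc_diff[OF tC TC]] RS] insert by simp
      also have "L (single z (\<lambda>y. smear g a (z + y) - smear g a y)) = d z g"
        unfolding L1_functional_diff[OF l tC TC] d_def by (simp only: smear_translate[OF a(1)])
      finally show ?case using insert.hyps by simp
    qed
    from this[OF Z] show ?thesis by (simp add: D_def)
  qed
  have dB: "(\<lambda>g. d z g) \<in> BC" and dM: "M (\<lambda>g. d z g) = 0" for z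
  proof -
    have az: "(\<lambda>y. a (z + y)) \<in> Cc" "I (\<lambda>y. a (z + y)) = I a"
      using Cc_translate[OF a(1)] I_translate[OF Cc_continuous[OF a(1)]] by auto
    note F = M_functional_smear[OF l, OF az(1) a(1) az(2), of z] M_functional_smear[OF l, OF a(1) a(1) refl, of z]
    show "(\<lambda>g. d z g) \<in> BC" unfolding d_def by (intro BC_diff F(1,3))
    show "M (\<lambda>g. d z g) = 0" unfolding d_def using M_diff[OF F(1,3)] F(2) by simp
  qed
  have "e \<le> M (\<lambda>g. \<Sum>z\<in>Z. d z g)"
  proof (rule M_ge)
    show "(\<lambda>g. \<Sum>z\<in>Z. d z g) \<in> BC" by (rule BC_sum[OF dB])
    show "e \<le> (\<Sum>z\<in>Z. d z g)" for g
      unfolding LD[symmetric] by (intro L(4) imageI smear_densities a)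
  qed
  also have "\<dots> = 0" by (subst M_sum[OF dB]) (simp add: dM)
  finally show False using e by simp
qed

end

context amenable_haar
begin

theorem reiter_compact:
  assumes K: "compact (K :: 'a set)" and e: "e > 0"
  obtains f where "f \<in> Cc" "\<And>y. 0 \<le> f y" "I f = 1"
    "\<And>z. z \<in> K \<Longrightarrow> I (\<lambda>y. \<bar>f (z + y) - f y\<bar>) \<le> e"
proof -
  obtain k :: "'a \<Rightarrow> real" where k: "k \<in> Cc" "\<And>y. 0 \<le> k y" "I k = 1"
    using Cc_narrow[OF open_UNIV UNIV_I] by metis
  interpret smoothing \<mu> m k by unfold_locales (rule k)+
  have e2: "e / 2 > 0" using e by simp
  obtain U where U: "open U" "(0::'a) \<in> U" "\<And>z. z \<in> U \<Longrightarrow> I (\<lambda>y. \<bar>k (z + y) - k y\<bar>) \<le> e / 2"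
    using L1_translate_continuous[OF k(1) e2] by metis
  obtain Z where Z: "finite Z" "K \<subseteq> (\<Union>x\<in>Z. (\<lambda>z. z + - x) -` U)"
  proof (rule compactE_image[OF K, of K "\<lambda>x. (\<lambda>z. z + - x) -` U"])
    show "open ((\<lambda>z. z + - x) -` U)" for x by (intro open_vimage U continuous_intros)
    show "K \<subseteq> (\<Union>x\<in>K. (\<lambda>z. z + - x) -` U)" using U(2) by auto
  qed
  obtain f where f: "f \<in> densities k" "\<And>z. z \<in> Z \<Longrightarrow> I (\<lambda>y. \<bar>f (z + y) - f y\<bar>) < e / 2"
    using reiter_finite[OF k Z(1) e2] by blast
  have fC: "f \<in> Cc" using f(1) by (simp add: densities_def)
  show ?thesis
  proof
    show "f \<in> Cc" "\<And>y. 0 \<le> f y" "I f = 1" using f(1) by (auto simp: densities_def)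
    fix z assume "z \<in> K"
    then obtain x where x: "x \<in> Z" "z + - x \<in> U" using Z(2) by auto
    define u where "u = z + - x"
    have z: "z = u + x" by (simp add: u_def add.assoc)
    have "I (\<lambda>y. \<bar>f (z + y) - f y\<bar>) = I (\<lambda>y. \<bar>(f (u + (x + y)) - f (x + y)) + (f (x + y) - f y)\<bar>)"
      by (simp add: z add.assoc)
    also have "\<dots> \<le> I (\<lambda>y. \<bar>f (u + (x + y)) - f (x + y)\<bar>) + I (\<lambda>y. \<bar>f (x + y) - f y\<bar>)"
    proof (rule I_abs_triangle)
      show "(\<lambda>y. f (u + (x + y)) - f (x + y)) \<in> Cc"
        by (rule Cc_translate[OF Cc_diff[OF Cc_translate[OF fC] fC]])
      show "(\<lambda>y. f (x + y) - f y) \<in> Cc" by (intro Cc_diff Cc_translate fC)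
    qed
    also have "I (\<lambda>y. \<bar>f (u + (x + y)) - f (x + y)\<bar>) = I (\<lambda>y. \<bar>f (u + y) - f y\<bar>)"
      by (rule I_translate) (intro Cc_continuous Cc_abs Cc_diff Cc_translate fC)
    also have "\<dots> \<le> I (\<lambda>y. \<bar>k (u + y) - k y\<bar>)" using f(1) by (simp add: densities_def)
    also have "\<dots> \<le> e / 2" by (rule U(3)) (use x(2) in \<open>simp add: u_def\<close>)
    finally show "I (\<lambda>y. \<bar>f (z + y) - f y\<bar>) \<le> e" using f(2)[OF x(1)] by simp
  qed
qed

end


section \<open>Compactly supported positive definite functions\<close>

context haar_measure
begin

lemma pd_kernel_integral:
  assumes h: "\<And>x. h x \<in> Cc"
  shows "pd_kernel (\<lambda>x y. complex_of_real (I (\<lambda>t. h x t * h y t)))"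
proof (rule pd_kernelI)
  fix x y
  show "complex_of_real (I (\<lambda>t. h y t * h x t)) = cnj (complex_of_real (I (\<lambda>t. h x t * h y t)))"
    by (simp add: mult.commute)
next
  fix c :: "'b \<Rightarrow> complex" assume c: "c \<in> finsupp"
  have hh: "(\<lambda>t. h x t * h y t) \<in> Cc" for x y by (intro Cc_mult h Cc_continuous)
  define S where "S = {x. c x \<noteq> 0}"
  have sq: "(\<Sum>x\<in>S. \<Sum>y\<in>S. \<alpha> x * \<alpha> y * I (\<lambda>t. h x t * h y t)) = I (\<lambda>t. (\<Sum>x\<in>S. \<alpha> x * h x t)\<^sup>2)"
    for \<alpha> :: "'b \<Rightarrow> real"
  proof -
    have "(\<Sum>x\<in>S. \<alpha> x * h x t)\<^sup>2 = (\<Sum>x\<in>S. \<Sum>y\<in>S. (\<alpha> x * \<alpha> y) * (h x t * h y t))" for t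
      unfolding power2_eq_square sum_product by (intro sum.cong refl) (simp add: mult_ac)
    then have "I (\<lambda>t. (\<Sum>x\<in>S. \<alpha> x * h x t)\<^sup>2) = I (\<lambda>t. \<Sum>x\<in>S. \<Sum>y\<in>S. (\<alpha> x * \<alpha> y) * (h x t * h y t))"
      by presburger
    also have "\<dots> = (\<Sum>x\<in>S. I (\<lambda>t. \<Sum>y\<in>S. (\<alpha> x * \<alpha> y) * (h x t * h y t)))"
      by (rule I_sum) (intro Cc_sum Cc_cmult hh)
    also have "\<dots> = (\<Sum>x\<in>S. \<Sum>y\<in>S. I (\<lambda>t. (\<alpha> x * \<alpha> y) * (h x t * h y t)))"
      by (intro sum.cong refl I_sum Cc_cmult hh)
    finally show ?thesis by simp
  qed
  have "Re (fin_ip (\<lambda>x y. complex_of_real (I (\<lambda>t. h x t * h y t))) c c)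
      = (\<Sum>x\<in>S. \<Sum>y\<in>S. Re (c x) * Re (c y) * I (\<lambda>t. h x t * h y t))
      + (\<Sum>x\<in>S. \<Sum>y\<in>S. Im (c x) * Im (c y) * I (\<lambda>t. h x t * h y t))"
    unfolding fin_ip_def S_def by (simp add: sum.distrib[symmetric] distrib_right)
  also have "\<dots> \<ge> 0" unfolding sq by (intro add_nonneg_nonneg I_nonneg) auto
  finally show "0 \<le> Re (fin_ip (\<lambda>x y. complex_of_real (I (\<lambda>t. h x t * h y t))) c c)" .
qed

text \<open>
  The diagonal coefficient of the left regular representation at the unit vector \<open>\<surd>f\<close> of \<open>L\<^sup>2\<close>.
\<close>

definition corr :: "('a \<Rightarrow> real) \<Rightarrow> 'a \<Rightarrow> real" where
  "corr f x = I (\<lambda>y. sqrt (f y) * sqrt (f (- x + y)))"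

context
  fixes f :: "'a \<Rightarrow> real"
  assumes f: "f \<in> Cc" "\<And>y. 0 \<le> f y" "I f = 1"
begin

lemma sqrt_Cc: "(\<lambda>y. sqrt (f y)) \<in> Cc"
  by (rule Cc_comp[OF f(1)]) (auto intro!: continuous_intros)

lemma sqrt_compose: "continuous_on S h \<Longrightarrow> continuous_on S (\<lambda>x. sqrt (f (h x)))"
  by (rule continuous_on_group_compose[OF Cc_continuous[OF sqrt_Cc]])

lemma corr_continuous: "continuous_on UNIV (corr f)"
  unfolding corr_def
  by (rule I_param_continuous[OF sqrt_Cc]) (unfold split_beta, intro sqrt_compose continuous_intros)

lemma corr_zero: "corr f 0 = 1"
  using f(2,3) by (simp add: corr_def)

lemma corr_pd: "pd_kernel (\<lambda>x y. complex_of_real (corr f (- y + x)))"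
proof -
  have "corr f (- y + x) = I (\<lambda>t. sqrt (f (- x + t)) * sqrt (f (- y + t)))" for x y
  proof -
    have "I (\<lambda>t. sqrt (f (- y + t)) * sqrt (f (- (- y + x) + (- y + t))))
        = I (\<lambda>t. sqrt (f t) * sqrt (f (- (- y + x) + t)))"
      by (rule I_translate) (intro continuous_intros sqrt_compose)
    moreover have "- (- y + x) + (- y + t) = - x + t" for t
      by (simp only: minus_add minus_minus add.assoc add_minus_cancel)
    ultimately show ?thesis by (simp add: corr_def mult.commute)
  qed
  moreover have "pd_kernel (\<lambda>x y. complex_of_real (I (\<lambda>t. sqrt (f (- x + t)) * sqrt (f (- y + t)))))"
    by (rule pd_kernel_integral) (rule Cc_translate[OF sqrt_Cc])
  ultimately show ?thesis by simp
qed

text \<open>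
  For the unit vector \<open>s = \<surd>f\<close> one has \<open>2 - 2 \<langle>\<lambda>(z)s, s\<rangle> = \<parallel>s - \<lambda>(z)s\<parallel>\<^sup>2\<close>, and \<open>(\<surd>a - \<surd>b)\<^sup>2 \<le> \<bar>a - b\<bar>\<close> bounds the
  \<open>L\<^sup>2\<close> distance of the square roots by the \<open>L\<^sup>1\<close> distance of the densities.
\<close>

lemma corr_near_one: "cmod (complex_of_real (corr f z) - 1) \<le> I (\<lambda>y. \<bar>f (- z + y) - f y\<bar>)"
proof -
  have tr: "(\<lambda>y. f (- z + y)) \<in> Cc" by (rule Cc_translate[OF f(1)])
  have prod: "(\<lambda>y. sqrt (f y) * sqrt (f (- z + y))) \<in> Cc"
    by (rule Cc_mult[OF sqrt_Cc]) (intro sqrt_compose continuous_intros)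
  have "I (\<lambda>y. (sqrt (f y) - sqrt (f (- z + y)))\<^sup>2) = I (\<lambda>y. (f y + f (- z + y)) - 2 * (sqrt (f y) * sqrt (f (- z + y))))"
    using f(2) by (simp add: power2_diff mult.assoc)
  also have "\<dots> = I (\<lambda>y. f y + f (- z + y)) - I (\<lambda>y. 2 * (sqrt (f y) * sqrt (f (- z + y))))"
    by (intro I_diff Cc_add Cc_cmult f tr prod)
  also have "I (\<lambda>y. f y + f (- z + y)) = 2"
    using I_add[OF f(1) tr] I_translate[OF Cc_continuous[OF f(1)], of "- z"] f(3) by simp
  finally have eq: "I (\<lambda>y. (sqrt (f y) - sqrt (f (- z + y)))\<^sup>2) = 2 - 2 * corr f z" by (simp add: corr_def)
  have "I (\<lambda>y. (sqrt (f y) - sqrt (f (- z + y)))\<^sup>2) \<le> I (\<lambda>y. \<bar>f (- z + y) - f y\<bar>)"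
  proof (rule I_mono)
    have "(\<lambda>y. sqrt (f y) - sqrt (f (- z + y))) \<in> Cc"
      by (intro Cc_diff sqrt_Cc Cc_translate[OF sqrt_Cc])
    then show "(\<lambda>y. (sqrt (f y) - sqrt (f (- z + y)))\<^sup>2) \<in> Cc"
      by (rule Cc_comp[where h = "\<lambda>t. t\<^sup>2"]) (auto intro!: continuous_intros)
    show "(\<lambda>y. \<bar>f (- z + y) - f y\<bar>) \<in> Cc" by (intro Cc_abs Cc_diff tr f)
    fix y
    define a where "a = sqrt (f y)"
    define b where "b = sqrt (f (- z + y))"
    have ab: "a \<ge> 0" "b \<ge> 0" "f y = a\<^sup>2" "f (- z + y) = b\<^sup>2" using f(2) by (auto simp: a_def b_def)
    have "(a - b)\<^sup>2 = \<bar>a - b\<bar> * \<bar>a - b\<bar>" by (simp add: power2_eq_square)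
    also have "\<dots> \<le> \<bar>a - b\<bar> * (a + b)" using ab by (intro mult_left_mono) auto
    also have "\<dots> = \<bar>(a - b) * (a + b)\<bar>" using ab by (simp add: abs_mult)
    also have "\<dots> = \<bar>b\<^sup>2 - a\<^sup>2\<bar>" by (simp add: power2_eq_square algebra_simps abs_minus_commute)
    finally show "(sqrt (f y) - sqrt (f (- z + y)))\<^sup>2 \<le> \<bar>f (- z + y) - f y\<bar>"
      unfolding a_def[symmetric] b_def[symmetric] unfolding ab(3,4) .
  qed
  moreover have "0 \<le> I (\<lambda>y. (sqrt (f y) - sqrt (f (- z + y)))\<^sup>2)" by (rule I_nonneg) simp
  ultimately have "\<bar>corr f z - 1\<bar> \<le> I (\<lambda>y. \<bar>f (- z + y) - f y\<bar>)" unfolding eq by linarith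
  then show ?thesis by (metis norm_of_real of_real_1 of_real_diff)
qed

lemma corr_support:
  obtains K where "compact K" "\<And>x. x \<notin> K \<Longrightarrow> corr f x = 0"
proof -
  obtain K where K: "compact K" "\<And>x. x \<notin> K \<Longrightarrow> f x = 0" using f(1) Cc_support by blast
  have "corr f x = 0" if x: "x \<notin> (\<lambda>(x, y). x + y) ` (K \<times> uminus ` K)" for x
  proof -
    have "sqrt (f y) * sqrt (f (- x + y)) = 0" for y
    proof (rule ccontr)
      assume "sqrt (f y) * sqrt (f (- x + y)) \<noteq> 0"
      then have "y \<in> K" "- x + y \<in> K" using K(2) by force+
      then have "y + - (- x + y) \<in> (\<lambda>(x, y). x + y) ` (K \<times> uminus ` K)" by force
      moreover have "y + - (- x + y) = x" by (simp only: minus_add minus_minus add_minus_cancel)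
      ultimately show False using x by simp
    qed
    then have "corr f x = I (\<lambda>y. 0)" unfolding corr_def by presburger
    then show ?thesis by simp
  qed
  moreover have "compact ((\<lambda>(x, y). x + y) ` (K \<times> uminus ` K))"
    by (intro compact_sum_image compact_continuous_image K(1) continuous_intros)
  ultimately show ?thesis by (rule that[rotated])
qed

end

end

context pd_function
begin

lemma B_translate_left:
  assumes "c \<in> finsupp" "d \<in> finsupp"
  shows "B (translate x c) d = (\<Sum>a | c a \<noteq> 0. \<Sum>b | d b \<noteq> 0. c a * cnj (d b) * \<phi> (- b + x + a))"
  unfolding fin_ip_def translate_support
  by (subst sum.reindex) (auto simp: translate_apply add.assoc[symmetric])

definition prob_vectors :: "'a set \<Rightarrow> ('a \<Rightarrow> complex) set" where
  "prob_vectors H = {c \<in> finsupp. (\<forall>x. c x = of_real (Re (c x)) \<and> 0 \<le> Re (c x)) \<and>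
     (\<forall>x. x \<notin> H \<longrightarrow> c x = 0) \<and> fin_lin (\<lambda>_. 1) c = 1}"

lemma prob_vectors_translate:
  assumes H: "is_subgroup H" "h \<in> H" and c: "c \<in> prob_vectors H"
  shows "translate h c \<in> prob_vectors H"
proof -
  have "- h + x \<notin> H" if "x \<notin> H" for x
  proof
    assume "- h + x \<in> H"
    then have "h + (- h + x) \<in> H" using H unfolding is_subgroup_def by blast
    then show False using that by (simp only: add_minus_cancel)
  qed
  then show ?thesis
    using c by (auto simp: prob_vectors_def translate_finsupp translate_apply fin_lin_translate)
qed

lemma prob_vectors_midpoint:
  assumes c: "c \<in> prob_vectors H" and d: "d \<in> prob_vectors H"
  shows "cscale (1/2) (c + d) \<in> prob_vectors H"
proof -
  have fs: "c \<in> finsupp" "d \<in> finsupp" using c d by (auto simp: prob_vectors_def)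
  have "fin_lin (\<lambda>_. 1) (cscale (1/2) (c + d)) = 1"
    using c d by (simp add: fin_lin_scale fin_lin_add finsupp_add prob_vectors_def)
  moreover have "c x = of_real (Re (c x))" "d x = of_real (Re (d x))" "0 \<le> Re (c x)" "0 \<le> Re (d x)" for x
    using c d by (auto simp: prob_vectors_def)
  ultimately show ?thesis
    using c d fs by (auto simp: prob_vectors_def finsupp_add finsupp_scale complex_eq_iff)
qed

lemma prob_vectors_average:
  assumes H: "is_subgroup H" and c: "c \<in> prob_vectors H"
    and near: "\<And>z. z \<in> double_coset H x \<Longrightarrow> cmod (\<phi> z - t) \<le> e"
  shows "cmod (B (translate x c) c - t) \<le> e"
proof -
  define S where "S = {a. c a \<noteq> 0}"
  have fs: "c \<in> finsupp" and S: "finite S" using c by (auto simp: prob_vectors_def finsupp_iff S_def)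
  have re: "c a = of_real (Re (c a))" "0 \<le> Re (c a)" for a using c by (auto simp: prob_vectors_def)
  have nrm: "cmod (c a) = Re (c a)" for a
    by (subst re(1), subst norm_of_real) (simp add: re(2))
  have one: "(\<Sum>a\<in>S. c a) = 1" using c by (simp add: prob_vectors_def fin_lin_def S_def)
  have one': "(\<Sum>a\<in>S. Re (c a)) = 1" using one by (metis Re_sum one_complex.sel(1))
  have cn: "cnj (c b) = c b" for b by (subst (1 2) re(1)) simp
  have "(\<Sum>a\<in>S. \<Sum>b\<in>S. c a * cnj (c b) * t) = t"
    unfolding cn sum_distrib_right[symmetric] sum_distrib_left[symmetric] one by simp
  then have "B (translate x c) c - t = (\<Sum>a\<in>S. \<Sum>b\<in>S. c a * cnj (c b) * (\<phi> (- b + x + a) - t))"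
    unfolding B_translate_left[OF fs fs] S_def[symmetric]
    by (simp add: right_diff_distrib sum_subtractf)
  also have "cmod \<dots> \<le> (\<Sum>a\<in>S. \<Sum>b\<in>S. cmod (c a * cnj (c b) * (\<phi> (- b + x + a) - t)))"
    by (intro order_trans[OF norm_sum] sum_mono norm_sum)
  also have "\<dots> \<le> (\<Sum>a\<in>S. \<Sum>b\<in>S. Re (c a) * Re (c b) * e)"
  proof (intro sum_mono)
    fix a b assume ab: "a \<in> S" "b \<in> S"
    have "a \<in> H" "b \<in> H" using ab c by (auto simp: S_def prob_vectors_def)
    then have "- b + x + a \<in> double_coset H x" using H by (force simp: double_coset_def is_subgroup_def)
    then show "cmod (c a * cnj (c b) * (\<phi> (- b + x + a) - t)) \<le> Re (c a) * Re (c b) * e"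
      using near re(2) by (simp add: norm_mult nrm mult_left_mono)
  qed
  also have "\<dots> = e"
    unfolding sum_distrib_right[symmetric] sum_distrib_left[symmetric] one' by simp
  finally show ?thesis .
qed

text \<open>
  The sequence \<open>X\<close> minimizes the norm among convex combinations of points of \<open>H\<close>, that is, in the convex hull of
  the \<open>H\<close>-orbit of the cyclic vector. A translate of \<open>X\<close> by \<open>h \<in> H\<close> minimizes as well, hence is
  asymptotically equal to \<open>X\<close>, and the limiting coefficient is invariant under \<open>H\<close>. The coefficients
  converge uniformly on \<open>G\<close>, so that continuity survives. Every approximating coefficient at \<open>x\<close> is an average
  of values of \<open>\<phi>\<close> on the double coset of \<open>x\<close>; this is the last claim, which serves both for \<open>t = 1\<close> and,
  to control the support, for \<open>t = 0\<close>.
\<close>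

theorem biinvariant_average:
  assumes cont: "continuous_on UNIV \<phi>" and H: "is_subgroup H"
  obtains \<psi> where "\<psi> \<in> B_double H" "B_norm \<psi> \<le> Re (\<phi> 0)"
    "\<And>x t e. (\<And>z. z \<in> double_coset H x \<Longrightarrow> cmod (\<phi> z - t) \<le> e) \<Longrightarrow> cmod (\<psi> x - t) \<le> e"
proof -
  let ?P = "prob_vectors H"
  have P0: "point 0 \<in> ?P"
    using H by (auto simp: prob_vectors_def point_finsupp fin_lin_point) (auto simp: point_def is_subgroup_def)
  have PE: "?P \<subseteq> finsupp" by (auto simp: prob_vectors_def)
  obtain X d where X: "\<And>n::nat. X n \<in> ?P" and Jlim: "(\<lambda>n. Re (B (X n) (X n))) \<longlonglongrightarrow> d"
    and Jmin: "\<And>v. v \<in> ?P \<Longrightarrow> d \<le> Re (B v v)"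
  proof (rule E.minimizing_sequence_exists[of ?P 0 "\<lambda>v. Re (B v v)"])
    show "0 \<le> Re (B v v)" if "v \<in> ?P" for v using that PE by (intro E.ip_nonneg) auto
  qed (use P0 in auto)
  have fs: "X n \<in> finsupp" for n using X PE by blast
  have cau: "E.cauchy_seq X"
    by (rule E.minimizing_cauchy[where C = ?P and l = "\<lambda>_. 0" and d = d])
      (use PE prob_vectors_midpoint X Jlim Jmin in auto)
  obtain C where C: "C > 0" "\<And>n. E.nrm (X n) \<le> C" using E.cauchy_seq_bounded[OF fs cau] by blast
  have tfs: "translate x (X n) \<in> finsupp" for x n using fs by (rule translate_finsupp)
  define \<psi> where "\<psi> x = lim (\<lambda>n. B (translate x (X n)) (X n))" for x
  have "convergent (\<lambda>n. B (translate x (X n)) (X n))" for x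
  proof (rule E.ip_convergent[OF tfs fs _ cau])
    show "E.cauchy_seq (\<lambda>n. translate x (X n))"
      using cau by (simp add: E.cauchy_seq_def translate_diff[symmetric] nrm_translate)
  qed
  then have lim: "(\<lambda>n. B (translate x (X n)) (X n)) \<longlonglongrightarrow> \<psi> x" for x
    unfolding \<psi>_def by (simp add: convergent_LIMSEQ_iff)
  have cs: "cmod (B (translate x c) c') \<le> E.nrm c * E.nrm c'" if "c \<in> finsupp" "c' \<in> finsupp" for x c c'
    using E.cauchy_schwarz[OF translate_finsupp[OF that(1)] that(2)] by (simp only: nrm_translate)
  have fsd: "X m - X n \<in> finsupp" for m n by (rule E.V_closed(5)[OF fs fs])
  have diff: "cmod (B (translate x (X m)) (X m) - B (translate x (X n)) (X n)) \<le> 2 * C * E.nrm (X m - X n)"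
    for x m n
  proof -
    have eq: "B (translate x (X m)) (X m) - B (translate x (X n)) (X n)
        = B (translate x (X m - X n)) (X m) + B (translate x (X n)) (X m - X n)"
      using fs tfs by (simp add: translate_diff E.ip_diff_left E.ip_diff_right)
    have "cmod (B (translate x (X m)) (X m) - B (translate x (X n)) (X n))
        \<le> cmod (B (translate x (X m - X n)) (X m)) + cmod (B (translate x (X n)) (X m - X n))"
      unfolding eq by (rule norm_triangle_ineq)
    also have "\<dots> \<le> E.nrm (X m - X n) * E.nrm (X m) + E.nrm (X n) * E.nrm (X m - X n)"
      by (intro add_mono cs fs fsd)
    also have "\<dots> \<le> E.nrm (X m - X n) * C + C * E.nrm (X m - X n)"
      using C fs by (intro add_mono mult_left_mono mult_right_mono) auto
    finally show ?thesis by (simp add: mult_ac)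
  qed
  have unif: "uniform_limit UNIV (\<lambda>n x. B (translate x (X n)) (X n)) \<psi> sequentially"
  proof (rule uniform_limitI)
    fix e :: real assume e: "e > 0"
    then have "e / (4 * C) > 0" using C by simp
    then obtain N where N: "\<And>m n. m \<ge> N \<Longrightarrow> n \<ge> N \<Longrightarrow> E.nrm (X m - X n) < e / (4 * C)"
      using cau unfolding E.cauchy_seq_def by meson
    have "dist (B (translate x (X n)) (X n)) (\<psi> x) < e" if n: "n \<ge> N" for n x
    proof -
      have "(\<lambda>m. cmod (B (translate x (X n)) (X n) - B (translate x (X m)) (X m)))
          \<longlonglongrightarrow> cmod (B (translate x (X n)) (X n) - \<psi> x)"
        by (intro tendsto_intros lim)
      moreover have "\<forall>\<^sub>F m in sequentially. cmod (B (translate x (X n)) (X n) - B (translate x (X m)) (X m)) \<le> e / 2"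
      proof (rule eventually_sequentiallyI)
        fix m assume "m \<ge> N"
        then have "2 * C * E.nrm (X n - X m) \<le> 2 * C * (e / (4 * C))"
          using N[OF n, of m] C by (intro mult_left_mono) auto
        also have "\<dots> = e / 2" using C by simp
        finally show "cmod (B (translate x (X n)) (X n) - B (translate x (X m)) (X m)) \<le> e / 2"
          using diff[of x n m] by linarith
      qed
      ultimately have "cmod (B (translate x (X n)) (X n) - \<psi> x) \<le> e / 2"
        by (intro tendsto_upperbound) auto
      then show ?thesis using e by (simp add: dist_norm)
    qed
    then show "\<forall>\<^sub>F n in sequentially. \<forall>x\<in>UNIV. dist (B (translate x (X n)) (X n)) (\<psi> x) < e"
      by (intro eventually_sequentiallyI[of N]) auto
  qed
  have cont\<psi>: "continuous_on UNIV \<psi>"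
  proof (rule uniform_limit_theorem[OF _ unif])
    show "\<forall>\<^sub>F n in sequentially. continuous_on UNIV (\<lambda>x. B (translate x (X n)) (X n))"
      unfolding B_translate_left[OF fs fs]
      by (intro always_eventually allI continuous_intros continuous_on_compose2[OF cont]) auto
  qed simp
  have pd\<psi>: "pd_kernel (\<lambda>x y. \<psi> (- y + x))"
  proof (rule pd_kernel_limit[OF sequentially_bot always_eventually lim], rule allI)
    fix n
    have "B (translate (- y + x) (X n)) (X n) = B (translate x (X n)) (translate y (X n))" for x y
      using B_translate[of y "translate (- y + x) (X n)" "X n"]
      by (simp add: translate_plus[symmetric] add.assoc[symmetric])
    then show "pd_kernel (\<lambda>x y. B (translate (- y + x) (X n)) (X n))"
      using E.pd_kernel_gram[of "\<lambda>x. translate x (X n)"] tfs by simp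
  qed
  have "Re (\<psi> 0) = d"
    using LIMSEQ_unique[OF tendsto_Re[OF lim[of 0]]] Jlim by (simp add: translate_zero)
  then have \<psi>0: "Re (\<psi> 0) \<le> Re (\<phi> 0)" using Jmin[OF P0] by (simp add: fin_ip_points)
  have B\<psi>: "\<psi> \<in> B_alg \<and> B_norm \<psi> \<le> Re (\<phi> 0)"
    by (rule B_algI[OF cont\<psi> pd_function_dominates_itself[OF pd\<psi> \<psi>0]])
  have fixed: "(\<lambda>n. E.nrm (translate h (X n) - X n)) \<longlonglongrightarrow> 0" if h: "h \<in> H" for h
  proof -
    have sq: "(E.nrm (translate h (X n) - X n))\<^sup>2 \<le> 4 * (Re (B (X n) (X n)) - d)" for n
    proof -
      have "(E.nrm (translate h (X n) - X n))\<^sup>2 \<le>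
        2 * (Re (B (translate h (X n)) (translate h (X n))) - 2 * 0 - d) + 2 * (Re (B (X n) (X n)) - 2 * 0 - d)"
        by (rule E.near_minimizers_close[where C = ?P and l = "\<lambda>_. 0"])
          (use PE prob_vectors_midpoint prob_vectors_translate[OF H h] X Jmin in auto)
      then show ?thesis by (simp add: B_translate)
    qed
    have "(\<lambda>n. sqrt (4 * (Re (B (X n) (X n)) - d))) \<longlonglongrightarrow> sqrt (4 * (d - d))"
      by (intro tendsto_intros Jlim)
    then have z: "(\<lambda>n. sqrt (4 * (Re (B (X n) (X n)) - d))) \<longlonglongrightarrow> 0" by simp
    show ?thesis
      by (rule Lim_null_comparison[OF _ z])
        (use sq fs tfs in \<open>auto intro!: always_eventually real_le_rsqrt\<close>)
  qed
  have right: "\<psi> (x + h) = \<psi> x" if h: "h \<in> H" for x h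
  proof (rule LIMSEQ_unique[OF lim])
    have "(\<lambda>n. B (translate (x + h) (X n)) (X n) - B (translate x (X n)) (X n)) \<longlonglongrightarrow> 0"
    proof (rule Lim_null_comparison)
      show "\<forall>\<^sub>F n in sequentially. norm (B (translate (x + h) (X n)) (X n) - B (translate x (X n)) (X n))
          \<le> E.nrm (translate h (X n) - X n) * C"
      proof (rule always_eventually, rule allI)
        fix n
        have eq: "B (translate (x + h) (X n)) (X n) - B (translate x (X n)) (X n)
            = B (translate x (translate h (X n) - X n)) (X n)"
          using fs tfs by (simp add: translate_diff translate_plus E.ip_diff_left translate_finsupp)
        have "cmod (B (translate (x + h) (X n)) (X n) - B (translate x (X n)) (X n))
            \<le> E.nrm (translate h (X n) - X n) * E.nrm (X n)"
          unfolding eq by (intro cs E.V_closed(5) fs tfs)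
        also have "\<dots> \<le> E.nrm (translate h (X n) - X n) * C"
          using C fs tfs by (intro mult_left_mono) auto
        finally show "norm (B (translate (x + h) (X n)) (X n) - B (translate x (X n)) (X n))
          \<le> E.nrm (translate h (X n) - X n) * C" .
      qed
      show "(\<lambda>n. E.nrm (translate h (X n) - X n) * C) \<longlonglongrightarrow> 0"
        by (rule tendsto_mult_left_zero[OF fixed[OF h]])
    qed
    from tendsto_add[OF this lim[of x]] show "(\<lambda>n. B (translate (x + h) (X n)) (X n)) \<longlonglongrightarrow> \<psi> x" by simp
  qed
  \<comment> \<open>The left invariance follows from the right invariance because \<open>\<psi> (- x) = cnj (\<psi> x)\<close>.\<close>
  have sym: "\<psi> (- x) = cnj (\<psi> x)" for x
    using pd_function_hermitian[OF pd\<psi>, of x 0] by simp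
  have left: "\<psi> (h + x) = \<psi> x" if h: "h \<in> H" for x h
  proof -
    have "- h \<in> H" using H h by (simp add: is_subgroup_def)
    then have "\<psi> (- x + - h) = \<psi> (- x)" by (rule right)
    then have "\<psi> (- (h + x)) = \<psi> (- x)" by (simp only: minus_add)
    then show ?thesis unfolding sym by simp
  qed
  show ?thesis
  proof
    show "\<psi> \<in> B_double H" using B\<psi> left right by (simp add: B_double_def add.assoc)
    show "B_norm \<psi> \<le> Re (\<phi> 0)" using B\<psi> by simp
    fix x t e assume near: "\<And>z. z \<in> double_coset H x \<Longrightarrow> cmod (\<phi> z - t) \<le> e"
    have "(\<lambda>n. cmod (B (translate x (X n)) (X n) - t)) \<longlonglongrightarrow> cmod (\<psi> x - t)" by (intro tendsto_intros lim)
    then show "cmod (\<psi> x - t) \<le> e"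
      by (rule LIMSEQ_le_const2) (use prob_vectors_average[OF H X near] in auto)
  qed
qed

end


section \<open>The algebras of a double coset space\<close>

lemma double_coset_self: "is_subgroup H \<Longrightarrow> x \<in> double_coset H x"
  unfolding double_coset_def is_subgroup_def by (metis (mono_tags, lifting) add.left_neutral add.right_neutral mem_Collect_eq)

lemma compact_double_coset:
  fixes H :: "'a::topological_group_add set"
  assumes "compact H" "compact K"
  shows "compact (\<Union>x\<in>K. double_coset H x)"
proof -
  have "(\<Union>x\<in>K. double_coset H x) = (\<lambda>((k, x), h). k + x + h) ` ((H \<times> K) \<times> H)"
    unfolding double_coset_def by (force simp: image_iff)
  moreover have "compact ((\<lambda>((k, x), h). k + x + h) ` ((H \<times> K) \<times> H))"
    unfolding split_beta using assms by (intro compact_continuous_image compact_Times continuous_intros)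
  ultimately show ?thesis by simp
qed

lemma double_coset_swap:
  assumes "is_subgroup H" "z \<in> double_coset H x"
  shows "x \<in> double_coset H z"
proof -
  obtain k h where kh: "k \<in> H" "h \<in> H" "z = k + x + h" using assms(2) by (auto simp: double_coset_def)
  have "x = - k + z + - h" unfolding kh(3) by (simp add: add.assoc)
  moreover have "- k \<in> H" "- h \<in> H" using assms kh by (auto simp: is_subgroup_def)
  ultimately show ?thesis unfolding double_coset_def by blast
qed

definition biinvariant :: "'a::group_add set \<Rightarrow> ('a \<Rightarrow> complex) \<Rightarrow> bool" where
  "biinvariant H u \<longleftrightarrow> (\<forall>x. \<forall>k\<in>H. \<forall>h\<in>H. u (k + x + h) = u x)"

lemma B_double_iff: "u \<in> B_double H \<longleftrightarrow> u \<in> B_alg \<and> biinvariant H u"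
  by (simp add: B_double_def biinvariant_def)

lemma biinvariant_pointwise:
  assumes "biinvariant H u" "biinvariant H v"
  shows "biinvariant H (u + v)" "biinvariant H (u * v)"
  using assms by (simp_all add: biinvariant_def)

definition cocompact_support :: "'a::topological_group_add set \<Rightarrow> ('a \<Rightarrow> complex) \<Rightarrow> bool" where
  "cocompact_support H u \<longleftrightarrow> compactin (double_coset_topology H) (double_coset H ` supp u)"

lemma A_double_iff:
  "u \<in> A_double H \<longleftrightarrow> u \<in> B_alg \<and> (\<forall>e>0. \<exists>v\<in>B_double H. cocompact_support H v \<and> B_norm (u - v) < e)"
  by (simp add: A_double_def cocompact_support_def)

lemma cocompact_if_compact: "compact (supp u) \<Longrightarrow> cocompact_support H u"
  unfolding cocompact_support_def
  by (rule image_compactin[OF _ quotient_imp_continuous_map[OF quotient_map_double_coset]])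
    (simp add: compactin_euclidean_iff)

lemma double_coset_eq:
  assumes "is_subgroup H" "double_coset H y = double_coset H x"
  obtains k h where "k \<in> H" "h \<in> H" "y = k + x + h"
proof -
  have "y \<in> double_coset H x" using double_coset_self[OF assms(1), of y] assms(2) by simp
  then show thesis using that by (auto simp: double_coset_def)
qed

text \<open>
  The support of a bi-invariant function is a union of double cosets, because bi-translations are
  homeomorphisms; so its image is closed in the quotient.
\<close>

lemma closedin_quotient_support:
  assumes H: "is_subgroup H" and u: "biinvariant H u"
  shows "closedin (double_coset_topology H) (double_coset H ` supp u)"
proof -
  have invariant: "k + x + h \<in> supp u" if "x \<in> supp u" "k \<in> H" "h \<in> H" for x k h
  proof -
    have "(\<lambda>x. k + x + h) ` closure {x. u x \<noteq> 0} \<subseteq> closure {x. u x \<noteq> 0}"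
    proof (rule image_closure_subset)
      show "continuous_on (closure {x. u x \<noteq> 0}) (\<lambda>x. k + x + h)" by (intro continuous_intros)
      show "(\<lambda>x. k + x + h) ` {x. u x \<noteq> 0} \<subseteq> closure {x. u x \<noteq> 0}"
        using u that by (intro order_trans[OF _ closure_subset]) (auto simp: biinvariant_def)
    qed simp
    then show ?thesis using that by (auto simp: supp_def)
  qed
  have "double_coset H -` (range (double_coset H) - double_coset H ` supp u) = - supp u"
  proof (intro set_eqI iffI)
    fix y assume y: "y \<in> - supp u"
    have "double_coset H y \<notin> double_coset H ` supp u"
    proof
      assume "double_coset H y \<in> double_coset H ` supp u"
      then obtain x where x: "x \<in> supp u" "double_coset H y = double_coset H x" by auto
      then obtain k h where "k \<in> H" "h \<in> H" "y = k + x + h" using double_coset_eq[OF H] by blast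
      then show False using invariant[OF x(1)] y by simp
    qed
    then show "y \<in> double_coset H -` (range (double_coset H) - double_coset H ` supp u)" by auto
  qed auto
  then have "openin (double_coset_topology H) (range (double_coset H) - double_coset H ` supp u)"
    unfolding openin_double_coset_topology by (simp add: supp_def open_Compl)
  moreover have "topspace (double_coset_topology H) = range (double_coset H)"
    using quotient_map_double_coset[of H] by (simp add: quotient_map_def)
  ultimately show ?thesis unfolding closedin_def by auto
qed

lemma cocompact_subset:
  assumes "is_subgroup H" "biinvariant H u" "compactin (double_coset_topology H) K"
    and "double_coset H ` supp u \<subseteq> K"
  shows "cocompact_support H u"
  unfolding cocompact_support_def
  using closed_compactin[OF assms(3,4) closedin_quotient_support[OF assms(1,2)]] .

lemma supp_mono: "(\<And>x. u x \<noteq> 0 \<Longrightarrow> v x \<noteq> 0) \<Longrightarrow> supp u \<subseteq> supp v"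
  unfolding supp_def by (intro closure_mono) auto

lemma cocompact_mult:
  assumes "is_subgroup H" "biinvariant H (u * v)" "cocompact_support H v"
  shows "cocompact_support H (u * v)"
  using assms(3) unfolding cocompact_support_def[of H v]
  by (rule cocompact_subset[OF assms(1,2)]) (intro image_mono supp_mono, simp)

lemma cocompact_add:
  assumes "is_subgroup H" "biinvariant H (u + v)" "cocompact_support H u" "cocompact_support H v"
  shows "cocompact_support H (u + v)"
proof (rule cocompact_subset[OF assms(1,2)])
  show "compactin (double_coset_topology H) (double_coset H ` supp u \<union> double_coset H ` supp v)"
    using assms(3,4) unfolding cocompact_support_def by (rule compactin_Un)
  have "supp (u + v) \<subseteq> supp u \<union> supp v"
    unfolding supp_def closure_Un[symmetric] by (intro closure_mono) auto
  then show "double_coset H ` supp (u + v) \<subseteq> double_coset H ` supp u \<union> double_coset H ` supp v" by auto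
qed

lemma B_norm_triangle:
  assumes "u \<in> B_alg" "v \<in> B_alg" "w \<in> B_alg"
  shows "B_norm (u - w) \<le> B_norm (u - v) + B_norm (v - w)"
  using B_alg_add[of "u - v" "v - w"] B_alg_diff assms by (metis (no_types) diff_add_cancel diff_add_eq add_diff_eq)

lemma B_norm_commute: "u \<in> B_alg \<Longrightarrow> v \<in> B_alg \<Longrightarrow> B_norm (u - v) = B_norm (v - u)"
  using B_alg_minus[of "u - v"] B_alg_diff by (metis minus_diff_eq)

lemma B_norm_eq_0:
  assumes "u \<in> B_alg" "B_norm u = 0"
  shows "u = 0"
proof
  show "u x = 0 x" for x using B_norm_bound[OF assms(1), of x] assms(2) by simp
qed

locale double_coset_algebra =
  fixes H :: "'a::{topological_group_add,t2_space} set"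
  assumes H: "is_subgroup H"
begin

abbreviation A :: "('a \<Rightarrow> complex) set" where "A \<equiv> A_double H"

lemma A_B: "u \<in> A \<Longrightarrow> u \<in> B_alg"
  by (simp add: A_double_iff)

lemma A_biinvariant:
  assumes u: "u \<in> A"
  shows "biinvariant H u"
  unfolding biinvariant_def
proof (intro allI ballI)
  fix x k h assume kh: "k \<in> H" "h \<in> H"
  have "cmod (u (k + x + h) - u x) \<le> 0 + e" if e: "e > 0" for e
  proof -
    have "e / 2 > 0" using e by simp
    then obtain v where v: "v \<in> B_double H" "B_norm (u - v) < e / 2"
      using u unfolding A_double_iff by blast
    then have uv: "u - v \<in> B_alg" using B_alg_diff A_B[OF u] by (auto simp: B_double_iff)
    have "v (k + x + h) = v x" using v kh by (simp add: B_double_iff biinvariant_def)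
    then have "u (k + x + h) - u x = (u - v) (k + x + h) - (u - v) x" by simp
    also have "cmod \<dots> \<le> cmod ((u - v) (k + x + h)) + cmod ((u - v) x)" by (rule norm_triangle_ineq4)
    also have "\<dots> \<le> B_norm (u - v) + B_norm (u - v)" by (intro add_mono B_norm_bound uv)
    finally show ?thesis using v by simp
  qed
  then have "cmod (u (k + x + h) - u x) \<le> 0" by (rule field_le_epsilon)
  then show "u (k + x + h) = u x" by simp
qed

lemma cocompact_A: "v \<in> B_double H \<Longrightarrow> cocompact_support H v \<Longrightarrow> v \<in> A"
  unfolding A_double_iff by (auto simp: B_double_iff B_alg_zero intro!: bexI[of _ v])

lemma A_zero: "0 \<in> A"
proof (rule cocompact_A)
  show "0 \<in> B_double H" by (simp add: B_double_iff B_alg_zero biinvariant_def)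
  show "cocompact_support H 0" by (rule cocompact_if_compact) (simp add: supp_def)
qed

lemma A_mult:
  assumes u: "u \<in> B_double H" and v: "v \<in> A"
  shows "u * v \<in> A"
  unfolding A_double_iff
proof (intro conjI allI impI)
  have uB: "u \<in> B_alg" and vB: "v \<in> B_alg" using u v by (auto simp: B_double_iff A_B)
  show "u * v \<in> B_alg" using B_alg_mult[OF uB vB] by simp
  fix e :: real assume e: "e > 0"
  have p: "B_norm u + 1 > 0" using B_norm_nonneg[OF uB] by simp
  then have "e / (B_norm u + 1) > 0" using e by simp
  then obtain w where w: "w \<in> B_double H" "cocompact_support H w" "B_norm (v - w) < e / (B_norm u + 1)"
    using v unfolding A_double_iff by blast
  have wB: "w \<in> B_alg" using w by (simp add: B_double_iff)
  have inv: "biinvariant H (u * w)" using u w by (intro biinvariant_pointwise) (auto simp: B_double_iff)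
  have vw: "v - w \<in> B_alg" using B_alg_diff[OF vB wB] by simp
  have "u * v - u * w = u * (v - w)" by (simp add: right_diff_distrib)
  then have "B_norm (u * v - u * w) \<le> B_norm u * B_norm (v - w)"
    using B_alg_mult[OF uB vw] by simp
  also have "\<dots> \<le> (B_norm u + 1) * B_norm (v - w)"
    using B_norm_nonneg[OF vw] by (intro mult_right_mono) auto
  also have "\<dots> < (B_norm u + 1) * (e / (B_norm u + 1))" using w(3) p by (intro mult_strict_left_mono)
  also have "\<dots> = e" using p by simp
  finally have "B_norm (u * v - u * w) < e" .
  moreover have "u * w \<in> B_double H" using B_alg_mult[OF uB wB] inv by (simp add: B_double_iff)
  ultimately show "\<exists>w\<in>B_double H. cocompact_support H w \<and> B_norm (u * v - w) < e"
    using cocompact_mult[OF H inv w(2)] by blast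
qed

lemma A_scale:
  assumes "v \<in> A"
  shows "(\<lambda>x. a * v x) \<in> A"
proof -
  have "pd_kernel (\<lambda>x y. 1 * cnj (1 :: complex))"
    by (rule pd_kernelI) (simp, simp only: fin_ip_rank_one, simp add: complex_mult_cnj)
  then have "dominated 1 (\<lambda>x::'a. 1) (\<lambda>x. 1 :: complex)"
    by (intro pd_function_dominates_itself) simp_all
  then have "dominated (cmod a * 1) (\<lambda>x::'a. of_real (cmod a) * 1) (\<lambda>x. a * 1)" by (rule dominated_scale)
  then have "dominated (cmod a) (\<lambda>x::'a. of_real (cmod a)) (\<lambda>x. a)" by simp
  from B_algI[OF continuous_on_const this] have "(\<lambda>x::'a. a) \<in> B_alg" by (rule conjunct1)
  then have "(\<lambda>x. a) \<in> B_double H" by (simp add: B_double_iff biinvariant_def)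
  from A_mult[OF this assms] show ?thesis by (simp add: times_fun_def)
qed

lemma A_add:
  assumes "u \<in> A" "v \<in> A"
  shows "u + v \<in> A"
  unfolding A_double_iff
proof (intro conjI allI impI)
  show "u + v \<in> B_alg" using B_alg_add A_B assms by blast
  fix e :: real assume "e > 0"
  then have e2: "e / 2 > 0" by simp
  obtain u' where u': "u' \<in> B_double H" "cocompact_support H u'" "B_norm (u - u') < e / 2"
    using assms e2 unfolding A_double_iff by blast
  obtain v' where v': "v' \<in> B_double H" "cocompact_support H v'" "B_norm (v - v') < e / 2"
    using assms e2 unfolding A_double_iff by blast
  have B: "u - u' \<in> B_alg" "v - v' \<in> B_alg" "u' + v' \<in> B_alg"
    using B_alg_diff[of u u'] B_alg_diff[of v v'] B_alg_add[of u' v'] assms[THEN A_B] u'(1) v'(1)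
    by (simp_all add: B_double_iff)
  have inv: "biinvariant H (u' + v')" using u' v' by (intro biinvariant_pointwise) (auto simp: B_double_iff)
  have split: "u + v - (u' + v') = (u - u') + (v - v')" by simp
  have "B_norm (u + v - (u' + v')) < e"
    unfolding split using B_alg_add[OF B(1,2)] u'(3) v'(3) by linarith
  then show "\<exists>w\<in>B_double H. cocompact_support H w \<and> B_norm (u + v - w) < e"
    using B inv cocompact_add[OF H inv u'(2) v'(2)] by (auto simp: B_double_iff)
qed

lemma A_closed:
  assumes u: "u \<in> B_alg" and approx: "\<And>e. e > 0 \<Longrightarrow> \<exists>v\<in>A. B_norm (u - v) < e"
  shows "u \<in> A"
  unfolding A_double_iff
proof (intro conjI u allI impI)
  fix e :: real assume "e > 0"
  then have e2: "e / 2 > 0" by simp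
  obtain v where v: "v \<in> A" "B_norm (u - v) < e / 2" using approx[OF e2] by blast
  obtain w where w: "w \<in> B_double H" "cocompact_support H w" "B_norm (v - w) < e / 2"
    using v(1) e2 unfolding A_double_iff by blast
  have "B_norm (u - w) \<le> B_norm (u - v) + B_norm (v - w)"
    using u A_B[OF v(1)] w(1) by (intro B_norm_triangle) (auto simp: B_double_iff)
  then have "B_norm (u - w) < e" using v w by simp
  then show "\<exists>w\<in>B_double H. cocompact_support H w \<and> B_norm (u - w) < e" using w by blast
qed

text \<open>
  The value \<open>0\<close> outside \<open>A\<close> provides the nonnegativity and symmetry that a metric on a carrier is
  required to have everywhere.
\<close>

definition dA :: "('a \<Rightarrow> complex) \<Rightarrow> ('a \<Rightarrow> complex) \<Rightarrow> real" where
  "dA u v = (if u \<in> A \<and> v \<in> A then B_norm (u - v) else 0)"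

sublocale MA: Metric_space A dA
proof
  show "0 \<le> dA u v" for u v using B_norm_nonneg B_alg_diff A_B by (auto simp: dA_def)
  show "dA u v = dA v u" for u v using B_norm_commute A_B by (auto simp: dA_def)
  show "dA u v = 0 \<longleftrightarrow> u = v" if "u \<in> A" "v \<in> A" for u v
    using that B_norm_eq_0[of "u - v"] B_alg_diff A_B B_alg_zero by (auto simp: dA_def)
  show "dA u w \<le> dA u v + dA v w" if "u \<in> A" "v \<in> A" "w \<in> A" for u v w
    using that B_norm_triangle A_B by (auto simp: dA_def)
qed

lemma limitin_A_pointwise:
  assumes \<sigma>: "range \<sigma> \<subseteq> A" and lim: "limitin MA.mtopology \<sigma> l sequentially"
  shows "l \<in> A" "(\<lambda>n. \<sigma> n x) \<longlonglongrightarrow> l x"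
proof -
  show l: "l \<in> A" using lim by (simp add: MA.limit_metric_sequentially)
  show "(\<lambda>n. \<sigma> n x) \<longlonglongrightarrow> l x"
  proof (rule LIMSEQ_I)
    fix e :: real assume "e > 0"
    then obtain N where N: "\<And>n. n \<ge> N \<Longrightarrow> dA (\<sigma> n) l < e"
      using lim unfolding MA.limit_metric_sequentially by blast
    have "norm (\<sigma> n x - l x) < e" if "n \<ge> N" for n
    proof -
      have s: "\<sigma> n \<in> A" using \<sigma> by auto
      have "\<sigma> n - l \<in> B_alg" using B_alg_diff[OF A_B[OF s] A_B[OF l]] by blast
      then have "cmod ((\<sigma> n - l) x) \<le> B_norm (\<sigma> n - l)" by (rule B_norm_bound)
      then show ?thesis using N[OF that] s l by (simp add: dA_def)
    qed
    then show "\<exists>N. \<forall>n\<ge>N. norm (\<sigma> n x - l x) < e" by blast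
  qed
qed

text \<open>
  The norm dominates the supremum norm, so a Cauchy sequence converges uniformly to a continuous
  function; that the convergence also holds in norm is the semicontinuity of the norm under pointwise
  limits.
\<close>

lemma A_complete: "MA.mcomplete"
  unfolding MA.mcomplete_def
proof (intro allI impI)
  fix \<sigma> :: "nat \<Rightarrow> 'a \<Rightarrow> complex" assume cau: "MA.MCauchy \<sigma>"
  then have \<sigma>: "\<sigma> n \<in> A" for n by (auto simp: MA.MCauchy_def)
  have cau': "\<exists>N. \<forall>m\<ge>N. \<forall>n\<ge>N. B_norm (\<sigma> m - \<sigma> n) < e" if "e > 0" for e
    using cau that \<sigma> unfolding MA.MCauchy_def dA_def by auto
  have dB: "\<sigma> m - \<sigma> n \<in> B_alg" for m n using B_alg_diff A_B \<sigma> by blast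
  have pt: "cmod (\<sigma> m x - \<sigma> n x) \<le> B_norm (\<sigma> m - \<sigma> n)" for m n x
    using B_norm_bound[OF dB, of m n x] by simp
  have "uniformly_Cauchy_on UNIV \<sigma>"
    unfolding uniformly_Cauchy_on_def
  proof (intro allI impI)
    fix e :: real assume "e > 0"
    then obtain N where "\<forall>m\<ge>N. \<forall>n\<ge>N. B_norm (\<sigma> m - \<sigma> n) < e" using cau' by blast
    then have "dist (\<sigma> m x) (\<sigma> n x) < e" if "m \<ge> N" "n \<ge> N" for m n x
      using le_less_trans[OF pt[of m x n]] that by (simp add: dist_norm)
    then show "\<exists>M. \<forall>x\<in>UNIV. \<forall>m\<ge>M. \<forall>n\<ge>M. dist (\<sigma> m x) (\<sigma> n x) < e" by blast
  qed
  then obtain u where unif: "uniform_limit UNIV \<sigma> u sequentially"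
    using Cauchy_uniformly_convergent uniformly_convergent_on_def by blast
  have lim: "(\<lambda>n. \<sigma> n x) \<longlonglongrightarrow> u x" for x by (rule tendsto_uniform_limitI[OF unif]) simp
  have cont\<sigma>: "continuous_on UNIV (\<sigma> n)" for n by (rule B_alg_dominated(2)[OF A_B[OF \<sigma>]])
  have cont: "continuous_on UNIV u"
    by (rule uniform_limit_theorem[OF always_eventually unif]) (simp_all add: cont\<sigma>)
  have near: "\<sigma> n - u \<in> B_alg \<and> B_norm (\<sigma> n - u) \<le> e"
    if N: "\<forall>m\<ge>N. \<forall>n\<ge>N. B_norm (\<sigma> m - \<sigma> n) < e" and n: "n \<ge> N" for n N e
  proof (rule B_alg_limit[of sequentially "\<lambda>m. \<sigma> n - \<sigma> m"])
    show "\<forall>\<^sub>F m in sequentially. \<sigma> n - \<sigma> m \<in> B_alg \<and> B_norm (\<sigma> n - \<sigma> m) \<le> e"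
      using N n dB by (intro eventually_sequentiallyI[of N]) (auto intro: less_imp_le)
    show "(\<lambda>m. (\<sigma> n - \<sigma> m) x) \<longlonglongrightarrow> (\<sigma> n - u) x" for x
      using tendsto_diff[OF tendsto_const lim] by simp
    show "continuous_on UNIV (\<sigma> n - u)"
      using continuous_on_diff[OF cont\<sigma> cont] by (simp add: fun_diff_def)
  qed simp
  obtain N0 where "\<forall>m\<ge>N0. \<forall>n\<ge>N0. B_norm (\<sigma> m - \<sigma> n) < 1" using cau'[of 1] by auto
  from near[OF this order_refl] have "\<sigma> N0 - (\<sigma> N0 - u) \<in> B_alg"
    using B_alg_diff[OF A_B[OF \<sigma>]] by blast
  then have uB: "u \<in> B_alg" by simp
  have small: "\<exists>N. \<forall>n\<ge>N. B_norm (\<sigma> n - u) < e" if "e > 0" for e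
  proof -
    have e2: "e / 2 > 0" using that by simp
    obtain N where N: "\<forall>m\<ge>N. \<forall>n\<ge>N. B_norm (\<sigma> m - \<sigma> n) < e / 2" using cau'[OF e2] by blast
    have "B_norm (\<sigma> n - u) < e" if "n \<ge> N" for n
      using near[OF N that] e2 by linarith
    then show ?thesis by blast
  qed
  have uA: "u \<in> A"
  proof (rule A_closed[OF uB])
    fix e :: real assume "e > 0"
    then obtain N where "B_norm (\<sigma> N - u) < e" using small by blast
    then show "\<exists>v\<in>A. B_norm (u - v) < e"
      using \<sigma> B_norm_commute[OF uB A_B[OF \<sigma>]] by (metis)
  qed
  have "limitin MA.mtopology \<sigma> u sequentially"
    unfolding MA.limit_metric_sequentially
    using uA \<sigma> small by (auto simp: dA_def)
  then show "\<exists>x. limitin MA.mtopology \<sigma> x sequentially" by blast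
qed

section \<open>Multipliers\<close>

text \<open>
  The sets \<open>G n\<close> are closed by semicontinuity of the norm and cover the complete space \<open>A\<close>, so one of them
  contains a ball.
\<close>

theorem multiplier_bounded:
  assumes u: "u \<in> multiplier_algebra A"
  shows "\<exists>C. \<forall>v\<in>A. B_norm v \<le> 1 \<longrightarrow> B_norm (u * v) \<le> C"
proof -
  have uA: "u * v \<in> A" if "v \<in> A" for v using u that by (simp add: multiplier_algebra_def)
  define G where "G n = {v \<in> A. B_norm (u * v) \<le> real n}" for n
  have closed: "closedin MA.mtopology (G n)" for n
    unfolding MA.metric_closedin_iff_sequentially_closed
  proof (intro conjI allI impI)
    show "G n \<subseteq> A" by (auto simp: G_def)
    fix \<sigma> l assume *: "range \<sigma> \<subseteq> G n \<and> limitin MA.mtopology \<sigma> l sequentially"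
    then have \<sigma>: "range \<sigma> \<subseteq> A" by (auto simp: G_def)
    note L = limitin_A_pointwise[OF \<sigma> conjunct2[OF *]]
    have \<sigma>G: "\<sigma> i \<in> A" "B_norm (u * \<sigma> i) \<le> real n" for i
      using subsetD[OF conjunct1[OF *] rangeI, of i] by (simp_all add: G_def)
    have "u * l \<in> B_alg \<and> B_norm (u * l) \<le> real n"
    proof (rule B_alg_limit[of sequentially "\<lambda>n. u * \<sigma> n"])
      show "\<forall>\<^sub>F i in sequentially. u * \<sigma> i \<in> B_alg \<and> B_norm (u * \<sigma> i) \<le> real n"
        using \<sigma>G uA A_B by (intro always_eventually) blast
      show "(\<lambda>i. (u * \<sigma> i) x) \<longlonglongrightarrow> (u * l) x" for x
        using tendsto_mult[OF tendsto_const L(2)] by simp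
      show "continuous_on UNIV (u * l)" by (rule B_alg_dominated(2)[OF A_B[OF uA[OF L(1)]]])
    qed simp
    then show "l \<in> G n" using L(1) by (simp add: G_def)
  qed
  have cover: "\<Union>(range G) = A"
  proof (intro set_eqI iffI)
    fix v assume "v \<in> A"
    then show "v \<in> \<Union>(range G)" using real_arch_simple[of "B_norm (u * v)"] by (auto simp: G_def)
  qed (auto simp: G_def)
  have "\<exists>n. MA.mtopology interior_of G n \<noteq> {}"
  proof (rule ccontr)
    assume "\<not> ?thesis"
    then have "MA.mtopology interior_of \<Union>(range G) = {}"
      using closed by (intro MA.metric_Baire_category_alt[OF A_complete]) auto
    moreover have "MA.mtopology interior_of A = A"
      using interior_of_topspace[of MA.mtopology] by simp
    ultimately show False using A_zero cover by auto
  qed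
  then obtain n v0 where "v0 \<in> MA.mtopology interior_of G n" by blast
  then obtain T where T: "openin MA.mtopology T" "v0 \<in> T" "T \<subseteq> G n" by (auto simp: interior_of_def)
  then obtain r where r: "r > 0" "MA.mball v0 r \<subseteq> T" unfolding MA.openin_mtopology by blast
  have v0: "v0 \<in> A" using T by (auto simp: G_def)
  have v0n: "B_norm (u * v0) \<le> real n" using T by (auto simp: G_def)
  have "B_norm (u * v) \<le> 4 * real n / r" if v: "v \<in> A" "B_norm v \<le> 1" for v
  proof -
    define s where "s = (\<lambda>x. complex_of_real (r / 2) * v x)"
    have sA: "s \<in> A" unfolding s_def by (rule A_scale[OF v(1)])
    have wA: "v0 + s \<in> A" by (rule A_add[OF v0 sA])
    have "B_norm s \<le> r / 2 * B_norm v" using B_alg_scale[OF A_B[OF v(1)], of "of_real (r / 2)"] r by (simp add: s_def)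
    also have "\<dots> < r" using v r B_norm_nonneg[OF A_B[OF v(1)]] mult_left_mono[of "B_norm v" 1 "r / 2"] by linarith
    finally have "B_norm s < r" .
    moreover have "B_norm (v0 - (v0 + s)) = B_norm s" using B_alg_minus[OF A_B[OF sA]] by simp
    ultimately have "v0 + s \<in> MA.mball v0 r" using v0 wA by (simp add: MA.in_mball dA_def)
    then have wn: "B_norm (u * (v0 + s)) \<le> real n" using r T by (auto simp: G_def)
    have uv: "u * v = (\<lambda>x. complex_of_real (2 / r) * (u * (v0 + s) - u * v0) x)"
      using r by (simp add: fun_eq_iff s_def field_simps)
    have D: "u * (v0 + s) - u * v0 \<in> B_alg \<and> B_norm (u * (v0 + s) - u * v0) \<le> B_norm (u * (v0 + s)) + B_norm (u * v0)"
      by (intro B_alg_diff A_B uA wA v0)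
    have nr: "cmod (complex_of_real (2 / r)) = 2 / r" unfolding norm_of_real using r by simp
    have "B_norm (u * v) \<le> 2 / r * B_norm (u * (v0 + s) - u * v0)"
      using B_alg_scale[OF conjunct1[OF D], of "complex_of_real (2 / r)"] unfolding uv[symmetric] nr by blast
    also have "\<dots> \<le> 2 / r * (2 * real n)"
      using D wn v0n r by (intro mult_left_mono) auto
    finally show ?thesis by simp
  qed
  then show ?thesis by blast
qed

lemma multiplier_norm_le:
  assumes "u \<in> B_double H"
  shows "multiplier_norm A u \<le> ereal (B_norm u)"
  unfolding multiplier_norm_def
proof (rule SUP_least)
  fix v assume v: "v \<in> {v \<in> A. B_norm v \<le> 1}"
  have uB: "u \<in> B_alg" using assms by (simp add: B_double_iff)
  have "B_norm (u * v) \<le> B_norm u * B_norm v" using B_alg_mult[OF uB A_B] v by blast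
  also have "\<dots> \<le> B_norm u * 1" using v B_norm_nonneg[OF uB] by (intro mult_left_mono) auto
  finally show "ereal (B_norm (u * v)) \<le> ereal (B_norm u)" by simp
qed

end

text \<open>
  The density is almost invariant on the compact set of all inverses of elements of the double cosets
  meeting \<open>F\<close>; the inverses enter because \<open>corr f z\<close> compares \<open>f\<close> with its translate \<open>y \<mapsto> f (- z + y)\<close>.
\<close>

lemma bounded_approximate_identity:
  fixes H :: "'a::{topological_group_add,t2_space} set"
  assumes lc: "locally_compact_space (euclidean :: 'a topology)" and am: "amenable TYPE('a)"
    and H: "is_subgroup H" "compact H" and F: "finite F" and e: "e > 0"
  shows "\<exists>w\<in>B_double H. cocompact_support H w \<and> B_norm w \<le> 1 \<and> (\<forall>x\<in>F. cmod (w x - 1) \<le> e)"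
proof -
  obtain \<mu> :: "'a measure" and m where m: "left_haar_measure \<mu>" "left_invariant_mean \<mu> m"
    using am unfolding amenable_def by blast
  interpret amenable_haar \<mu> m by unfold_locales (use lc m in auto)
  have "compact (uminus ` (\<Union>x\<in>F. double_coset H x))"
    by (intro compact_continuous_image continuous_intros compact_double_coset H finite_imp_compact F)
  then obtain f where f: "f \<in> Cc" "\<And>y. 0 \<le> f y" "I f = 1"
    "\<And>z. z \<in> uminus ` (\<Union>x\<in>F. double_coset H x) \<Longrightarrow> I (\<lambda>y. \<bar>f (z + y) - f y\<bar>) \<le> e"
    using reiter_compact[OF _ e] by metis
  define \<phi> where "\<phi> x = complex_of_real (corr f x)" for x
  interpret P: pd_function \<phi>
    unfolding \<phi>_def by unfold_locales (rule corr_pd[OF f(1-3)])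
  have cont: "continuous_on UNIV \<phi>"
    unfolding \<phi>_def by (intro continuous_intros corr_continuous[OF f(1-3)])
  obtain w where w: "w \<in> B_double H" "B_norm w \<le> Re (\<phi> 0)"
    "\<And>x t e. (\<And>z. z \<in> double_coset H x \<Longrightarrow> cmod (\<phi> z - t) \<le> e) \<Longrightarrow> cmod (w x - t) \<le> e"
    using P.biinvariant_average[OF cont H(1)] by blast
  obtain K where K: "compact K" "\<And>x. x \<notin> K \<Longrightarrow> corr f x = 0" using corr_support[OF f(1-3)] by blast
  have cK: "compact (\<Union>x\<in>K. double_coset H x)" by (rule compact_double_coset[OF H(2) K(1)])
  have zero: "w x = 0" if x: "x \<notin> (\<Union>x\<in>K. double_coset H x)" for x
  proof -
    have "cmod (w x - 0) \<le> 0"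
    proof (rule w(3))
      fix z assume "z \<in> double_coset H x"
      then have "z \<notin> K" using x double_coset_swap[OF H(1)] by blast
      then show "cmod (\<phi> z - 0) \<le> 0" using K(2) by (simp add: \<phi>_def)
    qed
    then show ?thesis by simp
  qed
  have "supp w \<subseteq> (\<Union>x\<in>K. double_coset H x)"
    unfolding supp_def by (rule closure_minimal) (use zero cK compact_imp_closed in blast)+
  then have "compact (supp w)"
    using cK by (metis closed_closure compact_Int_closed inf.absorb_iff2 supp_def)
  moreover have "B_norm w \<le> 1" using w(2) corr_zero[OF f(1-3)] by (simp add: \<phi>_def)
  moreover have "cmod (w x - 1) \<le> e" if x: "x \<in> F" for x
  proof (rule w(3))
    fix z assume "z \<in> double_coset H x"
    then have "- z \<in> uminus ` (\<Union>x\<in>F. double_coset H x)" using x by blast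
    then have "I (\<lambda>y. \<bar>f (- z + y) - f y\<bar>) \<le> e" by (rule f(4))
    then show "cmod (\<phi> z - 1) \<le> e" unfolding \<phi>_def using corr_near_one[OF f(1-3), of z] by linarith
  qed
  ultimately show ?thesis using w(1) cocompact_if_compact by blast
qed

theorem multiplier_in_B:
  fixes H :: "'a::{topological_group_add,t2_space} set"
  assumes lc: "locally_compact_space (euclidean :: 'a topology)" and am: "amenable TYPE('a)"
    and HH: "is_subgroup H" "compact H"
    and u: "u \<in> multiplier_algebra (A_double H)"
    and C: "\<And>v. v \<in> A_double H \<Longrightarrow> B_norm v \<le> 1 \<Longrightarrow> B_norm (u * v) \<le> C"
  shows "u \<in> B_double H" "B_norm u \<le> C"
proof -
  interpret double_coset_algebra H by unfold_locales (rule HH)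
  have uA: "u * v \<in> A" if "v \<in> A" for v using u that by (simp add: multiplier_algebra_def)
  have "\<exists>w. \<forall>F n. finite F \<longrightarrow> w (F, n) \<in> A \<and> B_norm (w (F, n)) \<le> 1 \<and>
      (\<forall>x\<in>F. cmod (w (F, n) x - 1) \<le> 1 / real (Suc n))"
  proof -
    have "\<exists>w. finite F \<longrightarrow> w \<in> A \<and> B_norm w \<le> 1 \<and> (\<forall>x\<in>F. cmod (w x - 1) \<le> 1 / real (Suc n))"
      for F :: "'a set" and n
      using bounded_approximate_identity[OF lc am HH, of F "1 / real (Suc n)"] cocompact_A by auto
    then have "\<forall>p. \<exists>w. finite (fst p) \<longrightarrow> w \<in> A \<and> B_norm w \<le> 1 \<and>
        (\<forall>x\<in>fst p. cmod (w x - 1) \<le> 1 / real (Suc (snd p)))" by blast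
    then obtain w where "\<forall>p. finite (fst p) \<longrightarrow> w p \<in> A \<and> B_norm (w p) \<le> 1 \<and>
        (\<forall>x\<in>fst p. cmod (w p x - 1) \<le> 1 / real (Suc (snd p)))" by metis
    then show ?thesis by (intro exI[of _ w]) auto
  qed
  then obtain w where w: "\<And>F n. finite F \<Longrightarrow> w (F, n) \<in> A" "\<And>F n. finite F \<Longrightarrow> B_norm (w (F, n)) \<le> 1"
    "\<And>F n x. finite F \<Longrightarrow> x \<in> F \<Longrightarrow> cmod (w (F, n) x - 1) \<le> 1 / real (Suc n)" by blast
  have nonzero: "\<exists>v\<in>A. v x \<noteq> 0" for x
  proof
    show "w ({x}, 1) \<in> A" by (rule w) simp
    show "w ({x}, 1) x \<noteq> 0" using w(3)[of "{x}" x 1] by auto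
  qed
  have cont: "continuous_on UNIV u"
  proof -
    have "isCont u x" for x
    proof -
      obtain v where v: "v \<in> A" "v x \<noteq> 0" using nonzero by blast
      have cv: "isCont v x" and cuv: "isCont (u * v) x"
        using B_alg_dominated(2)[OF A_B[OF v(1)]] B_alg_dominated(2)[OF A_B[OF uA[OF v(1)]]]
        unfolding continuous_on_eq_continuous_at[OF open_UNIV] by blast+
      have "((\<lambda>y. (u * v) y / v y) \<longlongrightarrow> (u * v) x / v x) (at x)"
        using cv cuv v(2) unfolding isCont_def by (intro tendsto_divide)
      moreover have "eventually (\<lambda>y. v y \<noteq> 0) (at x)"
        using cv v(2) unfolding isCont_def by (rule tendsto_imp_eventually_ne)
      then have "eventually (\<lambda>y. (u * v) y / v y = u y) (at x)" by eventually_elim simp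
      ultimately have "(u \<longlongrightarrow> (u * v) x / v x) (at x)" using tendsto_cong by fast
      then show ?thesis using v(2) by (simp add: isCont_def)
    qed
    then show ?thesis by (simp add: continuous_on_eq_continuous_at)
  qed
  have inv: "biinvariant H u"
    unfolding biinvariant_def
  proof (intro allI ballI)
    fix x k h assume kh: "k \<in> H" "h \<in> H"
    obtain v where v: "v \<in> A" "v x \<noteq> 0" using nonzero by blast
    have "v (k + x + h) = v x" "(u * v) (k + x + h) = (u * v) x"
      using A_biinvariant[OF v(1)] A_biinvariant[OF uA[OF v(1)]] kh by (auto simp: biinvariant_def)
    then show "u (k + x + h) = u x" using v(2) by simp
  qed
  \<comment> \<open>the index consists of a finite set of points and an error bound\<close>
  define \<F> where "\<F> = finite_subsets_at_top (UNIV :: 'a set) \<times>\<^sub>F sequentially"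
  have fin: "eventually (\<lambda>p. finite (fst p)) \<F>"
    unfolding \<F>_def eventually_prod_filter eventually_finite_subsets_at_top
    by (intro exI[of _ finite] exI[of _ "\<lambda>_. True"] conjI exI[of _ "{}"]) auto
  have "u \<in> B_alg \<and> B_norm u \<le> C"
  proof (rule B_alg_limit[of \<F> "\<lambda>p. u * w p"])
    show "\<F> \<noteq> bot" by (simp add: \<F>_def prod_filter_eq_bot)
    show "\<forall>\<^sub>F p in \<F>. u * w p \<in> B_alg \<and> B_norm (u * w p) \<le> C"
      using fin
    proof eventually_elim
      case (elim p)
      then show ?case using w(1,2)[of "fst p" "snd p"] C uA A_B by simp
    qed
    show "((\<lambda>p. (u * w p) x) \<longlongrightarrow> u x) \<F>" for x
    proof -
      have "((\<lambda>p. w p x - 1) \<longlongrightarrow> 0) \<F>"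
      proof (rule Lim_null_comparison)
        have "eventually (\<lambda>F. finite F \<and> x \<in> F) (finite_subsets_at_top UNIV)"
          unfolding eventually_finite_subsets_at_top by (intro exI[of _ "{x}"]) auto
        then have "eventually (\<lambda>p. finite (fst p) \<and> x \<in> fst p) \<F>"
          unfolding \<F>_def eventually_prod_filter by (intro exI[of _ "\<lambda>F. finite F \<and> x \<in> F"] exI[of _ "\<lambda>_. True"]) auto
        then show "\<forall>\<^sub>F p in \<F>. norm (w p x - 1) \<le> 1 / real (Suc (snd p))"
        proof eventually_elim
          case (elim p)
          then show ?case using w(3)[of "fst p" x "snd p"] by simp
        qed
        have "filterlim snd sequentially \<F>" unfolding \<F>_def by (rule filterlim_snd)
        moreover have "(\<lambda>n. 1 / real (Suc n)) \<longlonglongrightarrow> 0"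
          using LIMSEQ_inverse_real_of_nat by (simp add: field_simps)
        ultimately show "((\<lambda>p. 1 / real (Suc (snd p))) \<longlongrightarrow> 0) \<F>"
          by (rule filterlim_compose[rotated])
      qed
      then have "((\<lambda>p. w p x) \<longlongrightarrow> 1) \<F>" by (simp add: LIM_zero_iff)
      then have "((\<lambda>p. u x * w p x) \<longlongrightarrow> u x * 1) \<F>" by (rule tendsto_mult_left)
      then show ?thesis by simp
    qed
  qed (rule cont)
  then show "u \<in> B_double H" "B_norm u \<le> C" using inv by (simp_all add: B_double_iff)
qed

theorem theorem4p3:
  fixes H :: "'a::{topological_group_add,t2_space} set"
  assumes "locally_compact_space (euclidean :: 'a topology)"
    and "amenable TYPE('a)"
    and "is_subgroup H"
    and "compact H"
  shows "isometrically_isomorphic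
           (multiplier_algebra (A_double H)) (multiplier_norm (A_double H))
           (B_double H) (\<lambda>u. ereal (B_norm u))"
proof -
  interpret double_coset_algebra H by unfold_locales (rule assms(3))
  have eq: "multiplier_algebra A = B_double H"
  proof (intro set_eqI iffI)
    fix u assume u: "u \<in> multiplier_algebra A"
    then obtain C where "\<forall>v\<in>A. B_norm v \<le> 1 \<longrightarrow> B_norm (u * v) \<le> C" using multiplier_bounded by blast
    then show "u \<in> B_double H" using multiplier_in_B(1)[OF assms u] by blast
  next
    fix u assume "u \<in> B_double H"
    then show "u \<in> multiplier_algebra A" using A_mult by (simp add: multiplier_algebra_def)
  qed
  have norm: "ereal (B_norm u) = multiplier_norm A u" if u: "u \<in> multiplier_algebra A" for u
  proof (rule antisym)
    have uB: "u \<in> B_double H" using u eq by simp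
    show le: "multiplier_norm A u \<le> ereal (B_norm u)" by (rule multiplier_norm_le[OF uB])
    have up: "ereal (B_norm (u * v)) \<le> multiplier_norm A u" if "v \<in> A" "B_norm v \<le> 1" for v
      unfolding multiplier_norm_def using that by (intro SUP_upper) simp
    have "ereal (B_norm (u * 0)) \<le> multiplier_norm A u" using A_zero by (intro up) (simp_all add: B_alg_zero)
    then obtain c where c: "multiplier_norm A u = ereal c"
      using le by (cases "multiplier_norm A u") auto
    have "B_norm u \<le> c"
      by (rule multiplier_in_B(2)[OF assms u]) (use up c in auto)
    then show "ereal (B_norm u) \<le> multiplier_norm A u" by (simp add: c)
  qed
  show ?thesis
    unfolding isometrically_isomorphic_def
  proof (intro exI[of _ "\<lambda>u. u"] conjI ballI allI)
    show "bij_betw (\<lambda>u. u) (multiplier_algebra A) (B_double H)" by (simp add: bij_betw_def eq)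
  qed (use norm in auto)
qed

end
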